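(* Let $F$ be a gerbal action of a group $G$ on a category $\mathcal C$, choose isomorphisms $c(g_1,g_2):F_{g_1}F_{g_2}\xrightarrow{\cong}F_{g_1g_2}$ for all $g_1,g_2\in G$, and let $a:G\times G\times G\to\mathcal Z(\mathcal C)^\times$ be the associated map (see context). (i) $a$ is a cocycle, i.e. $$\rho_{g_1}a(g_2,g_3,g_4)\,a(g_1,g_2g_3,g_4)\,a(g_1,g_2,g_3)=a(g_1g_2,g_3,g_4)\,a(g_1,g_2,g_3g_4).$$ (ii) Given different isomorphisms $c'(g_1,g_2):F_{g_1}F_{g_2}\cong F_{g_1g_2}$, the new cocycle differs from the original one by a coboundary, and therefore there is a well-defined cohomology class $[a]\in H^3(G,\mathcal Z(\mathcal C)^\times)$ associated to a gerbal action of the group $G$ on the category $\mathcal C$. (iii) If this class is trivial, then the action $F$ can be upgraded to a genuine action, i.e. one can choose $c(g_1,g_2):F_{g_1}F_{g_2}\cong F_{g_1g_2}$ in such a way that for all $g_1,g_2,g_3$ the two isomorphisms $F_{g_1}F_{g_2}F_{g_3}\to F_{g_1g_2}F_{g_3}\to F_{g_1g_2g_3}$ and $F_{g_1}F_{g_2}F_{g_3}\to F_{g_1}F_{g_2g_3}\to F_{g_1g_2g_3}$ coincide. In this case, the set of (isomorphism classes of) isomorphisms $c(g_1,g_2)$ such that $F$ is a genuine action is a torsor under $H^2(G,\mathcal Z(\mathcal C)^\times)$. Furthermore, the automorphism group of such $F$ is $H^1(G,\mathcal Z(\mathcal C)^\times)$.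
   Context: A gerbal action of a group $G$ on a category $\mathcal C$ is a group homomorphism from $G$ to the group of isomorphism classes of auto-equivalences of $\mathcal C$; equivalently an assignment $g\mapsto F_g$ of auto-equivalences such that $F_e\cong\mathbf 1_{\mathcal C}$ and $F_gF_{g'}\cong F_{gg'}$. $\mathcal Z(\mathcal C)^\times$ is the (abelian) group of automorphisms of the identity functor $\mathbf 1_{\mathcal C}$. The group $G$ acts on it by $\rho$, determined by $\rho_g(a)_{F_g(X)}=F_g(a_X)$ for every object $X$. For auto-equivalences $x,y$, $\mathcal Z(\mathcal C)^\times$ acts simply transitively on the set of isomorphisms $x\to y$ (if nonempty) by $(a\cdot\phi)_X=a_{y(X)}\circ\phi_X$. Given the chosen $c(g_1,g_2)$, $a(g_1,g_2,g_3)\in\mathcal Z(\mathcal C)^\times$ is the unique element such that, for every object $X$, the composite $F_{g_1}F_{g_2}F_{g_3}(X)\to F_{g_1g_2}F_{g_3}(X)\to F_{g_1g_2g_3}(X)$ followed by $a(g_1,g_2,g_3)_{F_{g_1g_2g_3}(X)}$ equals the composite $F_{g_1}F_{g_2}F_{g_3}(X)\to F_{g_1}F_{g_2g_3}(X)\to F_{g_1g_2g_3}(X)$. A genuine action of $G$ on $\mathcal C$ is a monoidal functor from $G$ (regarded as a discrete monoidal groupoid) to the monoidal groupoid of auto-equivalences of $\mathcal C$ and their isomorphisms. Isomorphisms, and in particular automorphisms, of genuine actions are invertible monoidal natural transformations.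
   Formalization: In (iii), "the automorphism group of such F is H^1" is false when G acts nontrivially on Z(C)^×; it is replaced by: Aut(F) is isomorphic to the 1-cocycles Z^1, and Aut(F) modulo the automorphisms induced by Z(C)^× (inner ones) is isomorphic to H^1. *)

theory Defs
  imports "HOL-Algebra.Group_Action" "HOL-Algebra.FiniteProduct"
begin

section \<open>Categories, endofunctors and natural isomorphisms\<close>

record ('o, 'm) cat =
  Obj :: "'o set"
  Arr :: "'m set"
  Dom :: "'m \<Rightarrow> 'o"
  Cod :: "'m \<Rightarrow> 'o"
  Ide :: "'o \<Rightarrow> 'm"
  Comp :: "'m \<Rightarrow> 'm \<Rightarrow> 'm"  (infixl \<open>\<cdot>\<index>\<close> 70)

definition Hom_set :: "('o, 'm) cat \<Rightarrow> 'o \<Rightarrow> 'o \<Rightarrow> 'm set" where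
  "Hom_set C X Y = {f \<in> Arr C. Dom C f = X \<and> Cod C f = Y}"

locale category =
  fixes C :: "('o, 'm) cat" (structure)
  assumes Dom_in_Obj: "f \<in> Arr C \<Longrightarrow> Dom C f \<in> Obj C"
    and Cod_in_Obj: "f \<in> Arr C \<Longrightarrow> Cod C f \<in> Obj C"
    and Ide_in_Hom: "X \<in> Obj C \<Longrightarrow> Ide C X \<in> Hom_set C X X"
    and Comp_in_Hom: "\<lbrakk>f \<in> Hom_set C X Y; g \<in> Hom_set C Y Z\<rbrakk> \<Longrightarrow> g \<cdot> f \<in> Hom_set C X Z"
    and Comp_Ide: "f \<in> Hom_set C X Y \<Longrightarrow> f \<cdot> Ide C X = f"
    and Ide_Comp: "f \<in> Hom_set C X Y \<Longrightarrow> Ide C Y \<cdot> f = f"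
    and Comp_assoc:
      "\<lbrakk>f \<in> Hom_set C W X; g \<in> Hom_set C X Y; h \<in> Hom_set C Y Z\<rbrakk>
        \<Longrightarrow> (h \<cdot> g) \<cdot> f = h \<cdot> (g \<cdot> f)"

definition iso_arrow :: "('o, 'm) cat \<Rightarrow> 'm \<Rightarrow> bool" where
  "iso_arrow C f \<longleftrightarrow> f \<in> Arr C \<and>
     (\<exists>g \<in> Hom_set C (Cod C f) (Dom C f).
        g \<cdot>\<^bsub>C\<^esub> f = Ide C (Dom C f) \<and> f \<cdot>\<^bsub>C\<^esub> g = Ide C (Cod C f))"

record ('o, 'm) endo =
  on_obj :: "'o \<Rightarrow> 'o"
  on_arr :: "'m \<Rightarrow> 'm"

definition endofunctor :: "('o, 'm) cat \<Rightarrow> ('o, 'm) endo \<Rightarrow> bool" where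
  "endofunctor C F \<longleftrightarrow>
     (\<forall>X \<in> Obj C. on_obj F X \<in> Obj C) \<and>
     (\<forall>X \<in> Obj C. \<forall>Y \<in> Obj C. \<forall>f \<in> Hom_set C X Y.
        on_arr F f \<in> Hom_set C (on_obj F X) (on_obj F Y)) \<and>
     (\<forall>X \<in> Obj C. on_arr F (Ide C X) = Ide C (on_obj F X)) \<and>
     (\<forall>f \<in> Arr C. \<forall>g \<in> Arr C. Cod C f = Dom C g \<longrightarrow>
        on_arr F (g \<cdot>\<^bsub>C\<^esub> f) = on_arr F g \<cdot>\<^bsub>C\<^esub> on_arr F f)"

definition id_endo :: "('o, 'm) endo" where
  "id_endo = \<lparr>on_obj = (\<lambda>X. X), on_arr = (\<lambda>f. f)\<rparr>"

definition comp_endo :: "('o, 'm) endo \<Rightarrow> ('o, 'm) endo \<Rightarrow> ('o, 'm) endo"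
    (infixr \<open>\<circ>\<^sub>F\<close> 75) where
  "F \<circ>\<^sub>F F' = \<lparr>on_obj = on_obj F \<circ> on_obj F', on_arr = on_arr F \<circ> on_arr F'\<rparr>"

text \<open>
  Families of arrows indexed by the objects of \<open>C\<close> are functions that are \<^const>\<open>undefined\<close>
  outside \<open>Obj C\<close>, so that equality of families is equality of HOL functions.
\<close>

definition nat_isos :: "('o, 'm) cat \<Rightarrow> ('o, 'm) endo \<Rightarrow> ('o, 'm) endo \<Rightarrow> ('o \<Rightarrow> 'm) set" where
  "nat_isos C F F' =
     {\<eta> \<in> \<Pi>\<^sub>E X \<in> Obj C. Hom_set C (on_obj F X) (on_obj F' X).
        (\<forall>X \<in> Obj C. iso_arrow C (\<eta> X)) \<and>
        (\<forall>f \<in> Arr C. \<eta> (Cod C f) \<cdot>\<^bsub>C\<^esub> on_arr F f = on_arr F' f \<cdot>\<^bsub>C\<^esub> \<eta> (Dom C f))}"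

definition nat_isomorphic :: "('o, 'm) cat \<Rightarrow> ('o, 'm) endo \<Rightarrow> ('o, 'm) endo \<Rightarrow> bool" where
  "nat_isomorphic C F F' \<longleftrightarrow> nat_isos C F F' \<noteq> {}"

definition autoequivalence :: "('o, 'm) cat \<Rightarrow> ('o, 'm) endo \<Rightarrow> bool" where
  "autoequivalence C F \<longleftrightarrow> endofunctor C F \<and>
     (\<exists>F'. endofunctor C F' \<and>
        nat_isomorphic C (F \<circ>\<^sub>F F') id_endo \<and> nat_isomorphic C (F' \<circ>\<^sub>F F) id_endo)"

definition center_units :: "('o, 'm) cat \<Rightarrow> ('o \<Rightarrow> 'm) monoid" where
  "center_units C =
     \<lparr>carrier = nat_isos C id_endo id_endo,
      mult = (\<lambda>a b. \<lambda>X \<in> Obj C. a X \<cdot>\<^bsub>C\<^esub> b X),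
      one = (\<lambda>X \<in> Obj C. Ide C X)\<rparr>"


section \<open>Group cohomology\<close>

text \<open>
  Inhomogeneous cochains of \<open>G\<close> with coefficients in the (multiplicatively written) abelian
  group \<open>A\<close> on which \<open>G\<close> acts through \<open>\<rho>\<close>. Elements of \<open>G\<^sup>n\<close> are lists of length \<open>n\<close>.
\<close>

definition tuples :: "('g, 'b) monoid_scheme \<Rightarrow> nat \<Rightarrow> 'g list set" where
  "tuples G n = {xs \<in> lists (carrier G). length xs = n}"

definition cochain_group ::
    "('g, 'b) monoid_scheme \<Rightarrow> ('a, 'c) monoid_scheme \<Rightarrow> nat \<Rightarrow> ('g list \<Rightarrow> 'a) monoid" where
  "cochain_group G A n =
     \<lparr>carrier = tuples G n \<rightarrow>\<^sub>E carrier A,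
      mult = (\<lambda>f f'. \<lambda>xs \<in> tuples G n. f xs \<otimes>\<^bsub>A\<^esub> f' xs),
      one = (\<lambda>xs \<in> tuples G n. \<one>\<^bsub>A\<^esub>)\<rparr>"

text \<open>\<open>merge_at G i [x\<^sub>1, \<dots>, x\<^sub>n]\<close> multiplies the entries with (1-based) indices \<open>i\<close> and \<open>i + 1\<close>.\<close>

definition merge_at :: "('g, 'b) monoid_scheme \<Rightarrow> nat \<Rightarrow> 'g list \<Rightarrow> 'g list" where
  "merge_at G i xs = take (i - 1) xs @ [xs ! (i - 1) \<otimes>\<^bsub>G\<^esub> xs ! i] @ drop (i + 1) xs"

definition differential ::
    "('g, 'b) monoid_scheme \<Rightarrow> ('a, 'c) monoid_scheme \<Rightarrow> ('g \<Rightarrow> 'a \<Rightarrow> 'a) \<Rightarrow> nat \<Rightarrow>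
      ('g list \<Rightarrow> 'a) \<Rightarrow> ('g list \<Rightarrow> 'a)" where
  "differential G A \<rho> n f =
     (\<lambda>xs \<in> tuples G (Suc n).
        \<rho> (hd xs) (f (tl xs))
        \<otimes>\<^bsub>A\<^esub> (\<Otimes>\<^bsub>A\<^esub>i \<in> {1..n}. f (merge_at G i xs) [^]\<^bsub>A\<^esub> ((- 1) ^ i :: int))
        \<otimes>\<^bsub>A\<^esub> f (butlast xs) [^]\<^bsub>A\<^esub> ((- 1) ^ Suc n :: int))"

definition cocycle_group ::
    "('g, 'b) monoid_scheme \<Rightarrow> ('a, 'c) monoid_scheme \<Rightarrow> ('g \<Rightarrow> 'a \<Rightarrow> 'a) \<Rightarrow> nat \<Rightarrow>
      ('g list \<Rightarrow> 'a) monoid" where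
  "cocycle_group G A \<rho> n =
     (cochain_group G A n)
       \<lparr>carrier := kernel (cochain_group G A n) (cochain_group G A (Suc n)) (differential G A \<rho> n)\<rparr>"

fun coboundaries ::
    "('g, 'b) monoid_scheme \<Rightarrow> ('a, 'c) monoid_scheme \<Rightarrow> ('g \<Rightarrow> 'a \<Rightarrow> 'a) \<Rightarrow> nat \<Rightarrow>
      ('g list \<Rightarrow> 'a) set" where
  "coboundaries G A \<rho> 0 = {\<one>\<^bsub>cochain_group G A 0\<^esub>}"
| "coboundaries G A \<rho> (Suc n) = differential G A \<rho> n ` carrier (cochain_group G A n)"

definition cohomology_group ::
    "('g, 'b) monoid_scheme \<Rightarrow> ('a, 'c) monoid_scheme \<Rightarrow> ('g \<Rightarrow> 'a \<Rightarrow> 'a) \<Rightarrow> nat \<Rightarrow>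
      ('g list \<Rightarrow> 'a) set monoid" where
  "cohomology_group G A \<rho> n = cocycle_group G A \<rho> n Mod coboundaries G A \<rho> n"

definition cohomology_class ::
    "('g, 'b) monoid_scheme \<Rightarrow> ('a, 'c) monoid_scheme \<Rightarrow> ('g \<Rightarrow> 'a \<Rightarrow> 'a) \<Rightarrow> nat \<Rightarrow>
      ('g list \<Rightarrow> 'a) \<Rightarrow> ('g list \<Rightarrow> 'a) set" where
  "cohomology_class G A \<rho> n f = coboundaries G A \<rho> n #>\<^bsub>cocycle_group G A \<rho> n\<^esub> f"


section \<open>Gerbal actions\<close>

definition gerbal_action ::
    "('g, 'b) monoid_scheme \<Rightarrow> ('o, 'm) cat \<Rightarrow> ('g \<Rightarrow> ('o, 'm) endo) \<Rightarrow> bool" where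
  "gerbal_action G C F \<longleftrightarrow>
     (\<forall>g \<in> carrier G. autoequivalence C (F g)) \<and>
     nat_isomorphic C (F \<one>\<^bsub>G\<^esub>) id_endo \<and>
     (\<forall>g \<in> carrier G. \<forall>h \<in> carrier G. nat_isomorphic C (F g \<circ>\<^sub>F F h) (F (g \<otimes>\<^bsub>G\<^esub> h)))"

text \<open>
  Two assignments \<open>F\<close>, \<open>F'\<close> represent the same homomorphism from \<open>G\<close> to the group of
  isomorphism classes of auto-equivalences iff they are pointwise isomorphic.
\<close>

definition same_gerbal ::
    "('g, 'b) monoid_scheme \<Rightarrow> ('o, 'm) cat \<Rightarrow>
      ('g \<Rightarrow> ('o, 'm) endo) \<Rightarrow> ('g \<Rightarrow> ('o, 'm) endo) \<Rightarrow> bool" where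
  "same_gerbal G C F F' \<longleftrightarrow> (\<forall>g \<in> carrier G. nat_isomorphic C (F g) (F' g))"

definition center_action ::
    "('o, 'm) cat \<Rightarrow> ('g \<Rightarrow> ('o, 'm) endo) \<Rightarrow> 'g \<Rightarrow> ('o \<Rightarrow> 'm) \<Rightarrow> ('o \<Rightarrow> 'm)" where
  "center_action C F g a =
     (THE b. b \<in> carrier (center_units C) \<and>
        (\<forall>X \<in> Obj C. b (on_obj (F g) X) = on_arr (F g) (a X)))"

text \<open>A choice of isomorphisms \<open>c (g, h) : F g \<circ>\<^sub>F F h \<rightarrow> F (g h)\<close> for all \<open>g\<close>, \<open>h\<close> in \<open>G\<close>.\<close>

definition compositors ::
    "('g, 'b) monoid_scheme \<Rightarrow> ('o, 'm) cat \<Rightarrow> ('g \<Rightarrow> ('o, 'm) endo) \<Rightarrow>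
      ('g \<times> 'g \<Rightarrow> 'o \<Rightarrow> 'm) set" where
  "compositors G C F =
     (\<Pi>\<^sub>E (g, h) \<in> carrier G \<times> carrier G. nat_isos C (F g \<circ>\<^sub>F F h) (F (g \<otimes>\<^bsub>G\<^esub> h)))"

text \<open>
  The composites \<open>F g\<^sub>1 F g\<^sub>2 F g\<^sub>3 X \<rightarrow> F (g\<^sub>1 g\<^sub>2) F g\<^sub>3 X \<rightarrow> F (g\<^sub>1 g\<^sub>2 g\<^sub>3) X\<close> and
  \<open>F g\<^sub>1 F g\<^sub>2 F g\<^sub>3 X \<rightarrow> F g\<^sub>1 F (g\<^sub>2 g\<^sub>3) X \<rightarrow> F (g\<^sub>1 g\<^sub>2 g\<^sub>3) X\<close>.
\<close>

definition left_path ::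
    "('g, 'b) monoid_scheme \<Rightarrow> ('o, 'm) cat \<Rightarrow> ('g \<Rightarrow> ('o, 'm) endo) \<Rightarrow>
      ('g \<times> 'g \<Rightarrow> 'o \<Rightarrow> 'm) \<Rightarrow> 'g \<Rightarrow> 'g \<Rightarrow> 'g \<Rightarrow> 'o \<Rightarrow> 'm" where
  "left_path G C F c g1 g2 g3 X =
     c (g1 \<otimes>\<^bsub>G\<^esub> g2, g3) X \<cdot>\<^bsub>C\<^esub> c (g1, g2) (on_obj (F g3) X)"

definition right_path ::
    "('g, 'b) monoid_scheme \<Rightarrow> ('o, 'm) cat \<Rightarrow> ('g \<Rightarrow> ('o, 'm) endo) \<Rightarrow>
      ('g \<times> 'g \<Rightarrow> 'o \<Rightarrow> 'm) \<Rightarrow> 'g \<Rightarrow> 'g \<Rightarrow> 'g \<Rightarrow> 'o \<Rightarrow> 'm" where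
  "right_path G C F c g1 g2 g3 X =
     c (g1, g2 \<otimes>\<^bsub>G\<^esub> g3) X \<cdot>\<^bsub>C\<^esub> on_arr (F g1) (c (g2, g3) X)"

definition associator ::
    "('g, 'b) monoid_scheme \<Rightarrow> ('o, 'm) cat \<Rightarrow> ('g \<Rightarrow> ('o, 'm) endo) \<Rightarrow>
      ('g \<times> 'g \<Rightarrow> 'o \<Rightarrow> 'm) \<Rightarrow> 'g list \<Rightarrow> 'o \<Rightarrow> 'm" where
  "associator G C F c =
     (\<lambda>xs \<in> tuples G 3. case xs of [g1, g2, g3] \<Rightarrow>
        (THE a. a \<in> carrier (center_units C) \<and>
           (\<forall>X \<in> Obj C. a (on_obj (F (g1 \<otimes>\<^bsub>G\<^esub> g2 \<otimes>\<^bsub>G\<^esub> g3)) X) \<cdot>\<^bsub>C\<^esub> left_path G C F c g1 g2 g3 X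
              = right_path G C F c g1 g2 g3 X)))"

abbreviation Zgrp where
  "Zgrp G C F n \<equiv> cocycle_group G (center_units C) (center_action C F) n"

abbreviation Hgrp where
  "Hgrp G C F n \<equiv> cohomology_group G (center_units C) (center_action C F) n"

abbreviation Hclass where
  "Hclass G C F n \<equiv> cohomology_class G (center_units C) (center_action C F) n"

definition gerbal_class ::
    "('g, 'b) monoid_scheme \<Rightarrow> ('o, 'm) cat \<Rightarrow> ('g \<Rightarrow> ('o, 'm) endo) \<Rightarrow>
      ('g list \<Rightarrow> 'o \<Rightarrow> 'm) set" where
  "gerbal_class G C F =
     (THE \<kappa>. \<forall>c \<in> compositors G C F. \<kappa> = Hclass G C F 3 (associator G C F c))"


section \<open>Genuine actions\<close>

definition coherent ::
    "('g, 'b) monoid_scheme \<Rightarrow> ('o, 'm) cat \<Rightarrow> ('g \<Rightarrow> ('o, 'm) endo) \<Rightarrow>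
      ('g \<times> 'g \<Rightarrow> 'o \<Rightarrow> 'm) \<Rightarrow> bool" where
  "coherent G C F c \<longleftrightarrow>
     (\<forall>g1 \<in> carrier G. \<forall>g2 \<in> carrier G. \<forall>g3 \<in> carrier G. \<forall>X \<in> Obj C.
        left_path G C F c g1 g2 g3 X = right_path G C F c g1 g2 g3 X)"

text \<open>
  A monoidal functor from the discrete monoidal groupoid \<open>G\<close> to the (strict) monoidal groupoid of
  auto-equivalences of \<open>C\<close>: an assignment \<open>F\<close> with structure isomorphisms
  \<open>c (g, h) : F g \<circ>\<^sub>F F h \<rightarrow> F (g h)\<close> and \<open>u : id_endo \<rightarrow> F \<one>\<close>, subject to the associativity
  axiom and the two unit axioms.
\<close>

definition genuine_action ::
    "('g, 'b) monoid_scheme \<Rightarrow> ('o, 'm) cat \<Rightarrow> ('g \<Rightarrow> ('o, 'm) endo) \<Rightarrow>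
      ('g \<times> 'g \<Rightarrow> 'o \<Rightarrow> 'm) \<Rightarrow> ('o \<Rightarrow> 'm) \<Rightarrow> bool" where
  "genuine_action G C F c u \<longleftrightarrow>
     (\<forall>g \<in> carrier G. autoequivalence C (F g)) \<and>
     c \<in> compositors G C F \<and>
     u \<in> nat_isos C id_endo (F \<one>\<^bsub>G\<^esub>) \<and>
     coherent G C F c \<and>
     (\<forall>g \<in> carrier G. \<forall>X \<in> Obj C.
        c (\<one>\<^bsub>G\<^esub>, g) X \<cdot>\<^bsub>C\<^esub> u (on_obj (F g) X) = Ide C (on_obj (F g) X) \<and>
        c (g, \<one>\<^bsub>G\<^esub>) X \<cdot>\<^bsub>C\<^esub> on_arr (F g) (u X) = Ide C (on_obj (F g) X))"

text \<open>Invertible monoidal natural transformations from \<open>(F, c, u)\<close> to \<open>(F', c', u')\<close>.\<close>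

definition genuine_isos ::
    "('g, 'b) monoid_scheme \<Rightarrow> ('o, 'm) cat \<Rightarrow>
      ('g \<Rightarrow> ('o, 'm) endo) \<Rightarrow> ('g \<times> 'g \<Rightarrow> 'o \<Rightarrow> 'm) \<Rightarrow> ('o \<Rightarrow> 'm) \<Rightarrow>
      ('g \<Rightarrow> ('o, 'm) endo) \<Rightarrow> ('g \<times> 'g \<Rightarrow> 'o \<Rightarrow> 'm) \<Rightarrow> ('o \<Rightarrow> 'm) \<Rightarrow>
      ('g \<Rightarrow> 'o \<Rightarrow> 'm) set" where
  "genuine_isos G C F c u F' c' u' =
     {\<phi> \<in> \<Pi>\<^sub>E g \<in> carrier G. nat_isos C (F g) (F' g).
        (\<forall>g \<in> carrier G. \<forall>h \<in> carrier G. \<forall>X \<in> Obj C.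
           \<phi> (g \<otimes>\<^bsub>G\<^esub> h) X \<cdot>\<^bsub>C\<^esub> c (g, h) X
           = c' (g, h) X \<cdot>\<^bsub>C\<^esub> (\<phi> g (on_obj (F' h) X) \<cdot>\<^bsub>C\<^esub> on_arr (F g) (\<phi> h X))) \<and>
        (\<forall>X \<in> Obj C. \<phi> \<one>\<^bsub>G\<^esub> X \<cdot>\<^bsub>C\<^esub> u X = u' X)}"

definition genuine_structures ::
    "('g, 'b) monoid_scheme \<Rightarrow> ('o, 'm) cat \<Rightarrow> ('g \<Rightarrow> ('o, 'm) endo) \<Rightarrow>
      ('g \<times> 'g \<Rightarrow> 'o \<Rightarrow> 'm) set" where
  "genuine_structures G C F = {c. \<exists>u. genuine_action G C F c u}"

definition structure_iso ::
    "('g, 'b) monoid_scheme \<Rightarrow> ('o, 'm) cat \<Rightarrow> ('g \<Rightarrow> ('o, 'm) endo) \<Rightarrow>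
      (('g \<times> 'g \<Rightarrow> 'o \<Rightarrow> 'm) \<times> ('g \<times> 'g \<Rightarrow> 'o \<Rightarrow> 'm)) set" where
  "structure_iso G C F =
     {(c, c'). \<exists>u u'. genuine_action G C F c u \<and> genuine_action G C F c' u' \<and>
        genuine_isos G C F c u F c' u' \<noteq> {}}"

definition structure_classes ::
    "('g, 'b) monoid_scheme \<Rightarrow> ('o, 'm) cat \<Rightarrow> ('g \<Rightarrow> ('o, 'm) endo) \<Rightarrow>
      ('g \<times> 'g \<Rightarrow> 'o \<Rightarrow> 'm) set set" where
  "structure_classes G C F = genuine_structures G C F // structure_iso G C F"

text \<open>
  The pointwise action \<open>(a \<cdot> \<phi>)\<^sub>X = a\<^bsub>y X\<^esub> \<circ> \<phi>\<^sub>X\<close> of the automorphisms \<open>a\<close> of the identity functor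
  on isomorphisms \<open>\<phi> : x \<rightarrow> y\<close>, extended to 2-cochains acting on choices of compositors.
\<close>

definition twist ::
    "('g, 'b) monoid_scheme \<Rightarrow> ('o, 'm) cat \<Rightarrow> ('g \<Rightarrow> ('o, 'm) endo) \<Rightarrow>
      ('g list \<Rightarrow> 'o \<Rightarrow> 'm) \<Rightarrow> ('g \<times> 'g \<Rightarrow> 'o \<Rightarrow> 'm) \<Rightarrow> ('g \<times> 'g \<Rightarrow> 'o \<Rightarrow> 'm)" where
  "twist G C F b c =
     (\<lambda>(g, h) \<in> carrier G \<times> carrier G. \<lambda>X \<in> Obj C.
        b [g, h] (on_obj (F (g \<otimes>\<^bsub>G\<^esub> h)) X) \<cdot>\<^bsub>C\<^esub> c (g, h) X)"

text \<open>
  The operation \<open>[b] \<cdot> [c] = [b \<cdot> c]\<close> on classes. It is written, like the product of cosets in a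
  quotient group, as a set of products; that this set is again an isomorphism class is part of
  being a group action. The restriction is only there because permutations of a set are required
  to be extensional in \<^const>\<open>BijGroup\<close>.
\<close>

definition class_twist ::
    "('g, 'b) monoid_scheme \<Rightarrow> ('o, 'm) cat \<Rightarrow> ('g \<Rightarrow> ('o, 'm) endo) \<Rightarrow>
      ('g list \<Rightarrow> 'o \<Rightarrow> 'm) set \<Rightarrow>
      ('g \<times> 'g \<Rightarrow> 'o \<Rightarrow> 'm) set \<Rightarrow> ('g \<times> 'g \<Rightarrow> 'o \<Rightarrow> 'm) set" where
  "class_twist G C F \<beta> =
     (\<lambda>\<gamma> \<in> structure_classes G C F. {twist G C F b c | b c. b \<in> \<beta> \<and> c \<in> \<gamma>})"

definition torsor :: "('h, 'b) monoid_scheme \<Rightarrow> 'x set \<Rightarrow> ('h \<Rightarrow> 'x \<Rightarrow> 'x) \<Rightarrow> bool" where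
  "torsor H S \<phi> \<longleftrightarrow> group_action H S \<phi> \<and> S \<noteq> {} \<and>
     (\<forall>x \<in> S. \<forall>y \<in> S. \<exists>!h. h \<in> carrier H \<and> \<phi> h x = y)"

definition genuine_aut_group ::
    "('g, 'b) monoid_scheme \<Rightarrow> ('o, 'm) cat \<Rightarrow> ('g \<Rightarrow> ('o, 'm) endo) \<Rightarrow>
      ('g \<times> 'g \<Rightarrow> 'o \<Rightarrow> 'm) \<Rightarrow> ('o \<Rightarrow> 'm) \<Rightarrow> ('g \<Rightarrow> 'o \<Rightarrow> 'm) monoid" where
  "genuine_aut_group G C F c u =
     \<lparr>carrier = genuine_isos G C F c u F c u,
      mult = (\<lambda>\<phi> \<psi>. \<lambda>g \<in> carrier G. \<lambda>X \<in> Obj C. \<phi> g X \<cdot>\<^bsub>C\<^esub> \<psi> g X),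
      one = (\<lambda>g \<in> carrier G. \<lambda>X \<in> Obj C. Ide C (on_obj (F g) X))\<rparr>"

text \<open>
  An automorphism \<open>m\<close> of the identity functor induces on every genuine action the automorphism
  \<open>F g = id_endo \<circ>\<^sub>F F g \<circ>\<^sub>F id_endo \<rightarrow> F g\<close> given by \<open>m\<close> on the left and \<open>m\<^sup>-\<^sup>1\<close> on the right. If \<open>G\<close>
  acts nontrivially on the centre these need not be identities. They are exactly the
  automorphisms isomorphic, through a modification, to the identity automorphism, when genuine
  actions are regarded as pseudofunctors on the one-object 2-category \<open>BG\<close>. The automorphisms
  form the group of 1-cocycles; it is only modulo the inner ones that they form
  the first cohomology group.
\<close>

definition inner_auts ::
    "('g, 'b) monoid_scheme \<Rightarrow> ('o, 'm) cat \<Rightarrow> ('g \<Rightarrow> ('o, 'm) endo) \<Rightarrow>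
      ('g \<times> 'g \<Rightarrow> 'o \<Rightarrow> 'm) \<Rightarrow> ('o \<Rightarrow> 'm) \<Rightarrow> ('g \<Rightarrow> 'o \<Rightarrow> 'm) set" where
  "inner_auts G C F c u =
     {\<phi> \<in> carrier (genuine_aut_group G C F c u).
        \<exists>m \<in> carrier (center_units C). \<forall>g \<in> carrier G. \<forall>X \<in> Obj C.
          \<phi> g X \<cdot>\<^bsub>C\<^esub> on_arr (F g) (m X) = m (on_obj (F g) X)}"

definition cochain_aut ::
    "('g, 'b) monoid_scheme \<Rightarrow> ('o, 'm) cat \<Rightarrow> ('g \<Rightarrow> ('o, 'm) endo) \<Rightarrow>
      ('g list \<Rightarrow> 'o \<Rightarrow> 'm) \<Rightarrow> ('g \<Rightarrow> 'o \<Rightarrow> 'm)" where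
  "cochain_aut G C F z = (\<lambda>g \<in> carrier G. \<lambda>X \<in> Obj C. z [g] (on_obj (F g) X))"

end

(*
  On arrows, an automorphism a of the identity functor acts by a * f = a_(cod f) o f. This action
  commutes with composition on both sides and satisfies F_g (a * f) = rho_g(a) * F_g f, and on the
  natural isomorphisms into a fixed auto-equivalence it is simply transitive. Hence every choice
  of c is a twist of any other one by a unique 2-cochain b, and twisting multiplies the associator
  by db. The cocycle identity is the pentagon of the five ways to contract F_1 F_2 F_3 F_4. The
  coherent choices of c are those with trivial associator, so they form a torsor under the
  2-cocycles; a coherent c has a unique unit. Automorphisms of the individual F_g are 1-cochains z,
  and such a family is an isomorphism from c to c' precisely when c is the twist of c' by dz. This
  gives the three cohomological statements after passing to quotients.
*)

theory Submission
  imports Defs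
begin

section \<open>Quotients of torsors and of isomorphisms\<close>

text \<open>The functors \<open>F g\<close> are only auto-equivalences, so the objects
  \<open>F g X\<close> need not exhaust \<open>Obj C\<close>, while \<open>\<rho>\<close> and the
  associator are specified by components at such objects alone. Everything rests on one fact: an
  automorphism of an auto-equivalence \<open>H\<close> is \<open>X |-> a (H X)\<close> for exactly
  one central \<open>a\<close>. It comes from the two natural isomorphisms of a quasi-inverse, which
  need not satisfy triangle identities. It yields simple transitivity, the existence of
  \<open>\<rho>\<close>, and the invariance of \<open>\<rho>\<close> under isomorphism of functors;
  multiplicativity of \<open>\<rho>\<close> is this invariance along \<open>c (g, h)\<close>.

  A genuine action carries a unit, a choice of compositors does not. For coherent \<open>c\<close>
  all unit axioms follow from one equation at the neutral element, and that equation has exactly one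
  solution. Hence neither the unit nor the unit condition on morphisms leaves a trace in the
  cohomology.

  The automorphisms of a genuine action form the group of 1-cocycles; the first cohomology group
  appears after dividing by the inner ones, where a central \<open>m\<close> gives the coboundary of
  its inverse.\<close>

lemma iso_Mod_image:
  assumes f: "f \<in> iso G H" and N: "N \<lhd> G"
  shows "(\<lambda>X. f ` X) \<in> iso (G Mod N) (H Mod f ` N)"
proof -
  interpret N: normal N G by (rule N)
  have hom: "f \<in> hom G H" and inj: "inj_on f (carrier G)" and img: "f ` carrier G = carrier H"
    using f by (auto simp: iso_def bij_betw_def)
  have mult: "f (x \<otimes>\<^bsub>G\<^esub> y) = f x \<otimes>\<^bsub>H\<^esub> f y" if "x \<in> carrier G" "y \<in> carrier G" for x y
    using hom that by (rule hom_mult)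
  have coset: "f ` (N #>\<^bsub>G\<^esub> x) = f ` N #>\<^bsub>H\<^esub> f x" if "x \<in> carrier G" for x
    using that N.subset by (force simp: r_coset_def mult)
  have set_mult: "f ` (X <#>\<^bsub>G\<^esub> Y) = f ` X <#>\<^bsub>H\<^esub> f ` Y"
    if "X \<subseteq> carrier G" "Y \<subseteq> carrier G" for X Y
  proof -
    have "f (x \<otimes>\<^bsub>G\<^esub> y) = f x \<otimes>\<^bsub>H\<^esub> f y" if "x \<in> X" "y \<in> Y" for x y
      using that \<open>X \<subseteq> carrier G\<close> \<open>Y \<subseteq> carrier G\<close> mult by blast
    then show ?thesis by (simp add: set_mult_def image_UN)
  qed
  have sub: "X \<subseteq> carrier G" if "X \<in> carrier (G Mod N)" for X
    using that N.subset by (auto simp: carrier_FactGroup r_coset_def)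
  have "(\<lambda>X. f ` X) ` carrier (G Mod N) = carrier (H Mod f ` N)"
    by (auto simp: carrier_FactGroup image_image coset img[symmetric])
  moreover have "inj_on (\<lambda>X. f ` X) (carrier (G Mod N))"
  proof (rule inj_onI)
    fix X Y assume "X \<in> carrier (G Mod N)" "Y \<in> carrier (G Mod N)" "f ` X = f ` Y"
    then show "X = Y" using inj_on_image_eq_iff[OF inj sub sub] by simp
  qed
  ultimately show ?thesis
    using set_mult sub by (auto simp: iso_def hom_def bij_betw_def)
qed

text \<open>A simply transitive action of an abelian group \<open>Z\<close> descends to a simply
  transitive action of \<open>Z Mod B\<close> on the \<open>B\<close>-orbits. The relation
  \<open>R\<close> and the set of products have the shape of \<open>structure_iso\<close> and
  \<open>class_twist\<close>.\<close>

lemma torsor_Mod: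
  fixes Z (structure)
  assumes Z: "comm_group Z" and B: "subgroup B Z"
    and closed: "\<And>z x. \<lbrakk>z \<in> carrier Z; x \<in> S\<rbrakk> \<Longrightarrow> act z x \<in> S"
    and act_one: "\<And>x. x \<in> S \<Longrightarrow> act \<one> x = x"
    and act_mult: "\<And>z w x. \<lbrakk>z \<in> carrier Z; w \<in> carrier Z; x \<in> S\<rbrakk>
      \<Longrightarrow> act (z \<otimes> w) x = act z (act w x)"
    and trans: "\<And>x y. \<lbrakk>x \<in> S; y \<in> S\<rbrakk> \<Longrightarrow> \<exists>z \<in> carrier Z. act z x = y"
    and free: "\<And>z w x. \<lbrakk>z \<in> carrier Z; w \<in> carrier Z; x \<in> S; act z x = act w x\<rbrakk> \<Longrightarrow> z = w"
    and nonempty: "S \<noteq> {}"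
    and R: "R = {(x, y). x \<in> S \<and> y \<in> S \<and> (\<exists>b \<in> B. x = act b y)}"
  shows "torsor (Z Mod B) (S // R) (\<lambda>\<beta>. \<lambda>\<gamma> \<in> S // R. {act b c | b c. b \<in> \<beta> \<and> c \<in> \<gamma>})"
    (is "torsor _ ?E ?f")
proof -
  interpret Z: comm_group Z by (rule Z)
  interpret B: subgroup B Z by (rule B)
  interpret N: normal B Z using B by (rule Z.subgroup_imp_normal)
  \<comment> \<open>The equivalence classes of \<open>R\<close> turn out to be these orbits; since
    \<open>B\<close> contains inverses, the side on which \<open>b\<close> occurs in
    \<open>R\<close> does not matter.\<close>
  define orb where "orb x = (\<lambda>b. act b x) ` B" for x
  define \<phi> where "\<phi> = ?f"
  have inv_act: "act (inv z) (act z x) = x" if "z \<in> carrier Z" "x \<in> S" for z x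
    using that by (simp flip: act_mult add: act_one)
  have orbI: "act b x \<in> orb x" if "b \<in> B" for b x
    using that unfolding orb_def by (rule imageI)
  have orbE: "\<exists>b. b \<in> B \<and> y = act b x" if "y \<in> orb x" for x y
    using that unfolding orb_def by blast
  have self: "x \<in> orb x" if "x \<in> S" for x
    using orbI[OF B.one_closed, of x] that by (simp add: act_one)
  have cls: "R `` {x} = orb x" if x: "x \<in> S" for x
  proof (intro equalityI subsetI)
    fix y assume "y \<in> R `` {x}"
    then obtain b where b: "y \<in> S" "b \<in> B" "x = act b y" unfolding R by blast
    have "act (inv b) (act b y) = y" using b(1,2) by (simp add: inv_act)
    then show "y \<in> orb x" using orbI[OF B.m_inv_closed[OF b(2)], of x] b(3) by simp
  next
    fix y assume "y \<in> orb x"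
    then obtain b where b: "b \<in> B" "y = act b x" using orbE by blast
    have "x = act (inv b) (act b x)" using x b(1) by (simp add: inv_act)
    moreover have "y \<in> S" using b x closed by simp
    moreover have "inv b \<in> B" using b by simp
    ultimately show "y \<in> R `` {x}" using x b(2) unfolding R by blast
  qed
  have E: "?E = orb ` S"
    by (auto simp: quotient_def cls)
  have orb_eqI: "orb (act b y) = orb y" if b: "b \<in> B" and y: "y \<in> S" for b y
  proof (intro equalityI subsetI)
    fix w assume "w \<in> orb (act b y)"
    then obtain a where a: "a \<in> B" "w = act a (act b y)" using orbE by blast
    then have "w = act (a \<otimes> b) y" using b y by (simp add: act_mult)
    then show "w \<in> orb y" using orbI[of "a \<otimes> b" y] a b by simp
  next
    fix w assume "w \<in> orb y"
    then obtain a where a: "a \<in> B" "w = act a y" using orbE by blast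
    have "act (a \<otimes> inv b) (act b y) = act a y"
      using a(1) b y by (simp add: act_mult closed inv_act)
    then show "w \<in> orb (act b y)" using orbI[of "a \<otimes> inv b" "act b y"] a b by simp
  qed
  have orb_eqD: "\<exists>b \<in> B. x = act b y" if "orb x = orb y" "x \<in> S" for x y
    using self[OF that(2)] that(1) orbE by blast
  have tw: "\<phi> (B #> z) (orb x) = orb (act z x)" if z: "z \<in> carrier Z" and x: "x \<in> S" for z x
  proof -
    have "{act b c | b c. b \<in> B #> z \<and> c \<in> orb x} = orb (act z x)"
    proof (intro equalityI subsetI)
      fix y assume "y \<in> {act b c | b c. b \<in> B #> z \<and> c \<in> orb x}"
      then obtain b b' where b: "b \<in> B" "b' \<in> B" "y = act (b \<otimes> z) (act b' x)"
        unfolding r_coset_def by (auto dest!: orbE)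
      then have "y = act (b \<otimes> z \<otimes> b') x" using z x by (simp add: act_mult)
      \<comment> \<open>Commutativity of \<open>Z\<close> enters here: it collects the two elements
        of \<open>B\<close>, so that the set of products is a single orbit.\<close>
      also have "b \<otimes> z \<otimes> b' = (b \<otimes> b') \<otimes> z" using b z by (simp add: Z.m_ac)
      also have "act \<dots> x = act (b \<otimes> b') (act z x)" using b z x by (simp add: act_mult)
      finally show "y \<in> orb (act z x)" using orbI[of "b \<otimes> b'" "act z x"] b by simp
    next
      fix y assume "y \<in> orb (act z x)"
      then obtain b where b: "b \<in> B" "y = act b (act z x)" using orbE by blast
      then have "y = act (b \<otimes> z) x" using z x by (simp add: act_mult)
      moreover have "b \<otimes> z \<in> B #> z" using b by (auto simp: r_coset_def)
      ultimately show "y \<in> {act b c | b c. b \<in> B #> z \<and> c \<in> orb x}"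
        using self[OF x] by blast
    qed
    then show ?thesis using x by (simp add: \<phi>_def E)
  qed
  have Bij: "\<phi> \<beta> \<in> Bij ?E" if \<beta>: "\<beta> \<in> carrier (Z Mod B)" for \<beta>
  proof -
    obtain z where z: "z \<in> carrier Z" "\<beta> = B #> z" using \<beta> by (auto simp: carrier_FactGroup)
    have z': "act z (act (inv z) x) = x" if "x \<in> S" for x
      using z that by (simp flip: act_mult add: act_one)
    \<comment> \<open>The inverse permutation is the action of the coset of the inverse.\<close>
    have "bij_betw (\<phi> (B #> z)) ?E ?E"
      by (rule bij_betwI[where g = "\<phi> (B #> inv z)"])
        (use z in \<open>auto simp: E tw closed inv_act z'\<close>)
    then show ?thesis by (simp add: Bij_def z \<phi>_def)
  qed
  have mult: "\<phi> (\<beta> <#> \<beta>') = \<phi> \<beta> \<otimes>\<^bsub>BijGroup ?E\<^esub> \<phi> \<beta>'"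
    if \<beta>: "\<beta> \<in> carrier (Z Mod B)" and \<beta>': "\<beta>' \<in> carrier (Z Mod B)" for \<beta> \<beta>'
  proof -
    obtain z w where z: "z \<in> carrier Z" "\<beta> = B #> z" and w: "w \<in> carrier Z" "\<beta>' = B #> w"
      using \<beta> \<beta>' by (auto simp: carrier_FactGroup)
    have "\<phi> (\<beta> <#> \<beta>') = compose ?E (\<phi> \<beta>) (\<phi> \<beta>')"
    proof (rule extensionalityI[where A = ?E])
      fix \<gamma> assume "\<gamma> \<in> ?E"
      then obtain x where x: "x \<in> S" "\<gamma> = orb x" by (auto simp: E)
      have "\<phi> (\<beta> <#> \<beta>') \<gamma> = orb (act (z \<otimes> w) x)"
        using x z w tw[of "z \<otimes> w" x] by (simp add: N.rcos_sum)
      also have "\<dots> = \<phi> \<beta> (\<phi> \<beta>' \<gamma>)"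
        using x z w closed by (simp only: tw act_mult)
      finally show "\<phi> (\<beta> <#> \<beta>') \<gamma> = compose ?E (\<phi> \<beta>) (\<phi> \<beta>') \<gamma>"
        using \<open>\<gamma> \<in> ?E\<close> by (simp add: compose_def)
    qed (auto simp: compose_def \<phi>_def)
    then show ?thesis using Bij \<beta> \<beta>' by (simp add: BijGroup_def)
  qed
  have "group_action (Z Mod B) ?E \<phi>"
    by (intro group_action.intro group_hom.intro group_hom_axioms.intro homI
        N.factorgroup_is_group group_BijGroup)
      (use Bij mult in \<open>auto simp: BijGroup_def\<close>)
  moreover have "\<exists>!h. h \<in> carrier (Z Mod B) \<and> \<phi> h \<xi> = \<eta>" if \<xi>: "\<xi> \<in> ?E" and \<eta>: "\<eta> \<in> ?E" for \<xi> \<eta>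
  proof -
    obtain x y where x: "x \<in> S" "\<xi> = orb x" and y: "y \<in> S" "\<eta> = orb y"
      using \<xi> \<eta> by (auto simp: E)
    obtain z where z: "z \<in> carrier Z" "act z x = y" using trans x y by blast
    show ?thesis
    proof (rule ex1I[where a = "B #> z"])
      show "B #> z \<in> carrier (Z Mod B) \<and> \<phi> (B #> z) \<xi> = \<eta>"
        using tw[OF z(1) x(1)] x y z by (simp add: carrier_FactGroup)
      fix h assume h: "h \<in> carrier (Z Mod B) \<and> \<phi> h \<xi> = \<eta>"
      then obtain w where w: "w \<in> carrier Z" "h = B #> w" by (auto simp: carrier_FactGroup)
      then have "orb (act w x) = orb y" using h tw[OF w(1) x(1)] x y by simp
      \<comment> \<open>Equality of classes gives equality in \<open>S\<close> up to some
        \<open>b\<close> in \<open>B\<close>; freeness on \<open>S\<close> then puts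
        \<open>w\<close> and \<open>z\<close> into the same coset.\<close>
      then obtain b where b: "b \<in> B" "act w x = act b y"
        using orb_eqD closed w x by blast
      then have "act w x = act (b \<otimes> z) x" using z x by (simp add: act_mult)
      then have "w = b \<otimes> z" using free w z x b by simp
      then show "h = B #> z"
        using b z w Z.repr_independence[OF _ z(1) B, of w] by (auto simp: r_coset_def)
    qed
  qed
  ultimately show ?thesis
    using nonempty unfolding torsor_def \<phi>_def[symmetric] by (simp add: E)
qed

section \<open>Group cohomology in low degrees\<close>

lemma comm_group_cochain_group:
  assumes "comm_group A"
  shows "comm_group (cochain_group G A n)"
proof -
  interpret A: comm_group A by (rule assms)
  show ?thesis
  proof (rule comm_groupI)
    show "\<exists>f' \<in> carrier (cochain_group G A n). f' \<otimes>\<^bsub>cochain_group G A n\<^esub> f = \<one>\<^bsub>cochain_group G A n\<^esub>"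
      if "f \<in> carrier (cochain_group G A n)" for f
      using that by (intro bexI[where x = "\<lambda>xs \<in> tuples G n. inv\<^bsub>A\<^esub> f xs"])
        (auto simp: cochain_group_def intro!: restrict_ext A.l_inv dest: PiE_mem)
  qed (auto simp: cochain_group_def PiE_mem A.m_assoc PiE_iff extensional_def
        intro!: restrict_ext A.m_comm intro: ext)
qed

lemma merge_at_in_tuples:
  assumes "group G" "xs \<in> tuples G (Suc n)" "i \<in> {1..n}"
  shows "merge_at G i xs \<in> tuples G n"
proof -
  interpret group G by (rule assms)
  show ?thesis
    using assms(2,3) by (auto simp: tuples_def merge_at_def in_lists_conv_set
        dest: in_set_takeD in_set_dropD)
qed

text \<open>The actions induced by two isomorphic gerbal actions are only known to agree on the
  centre, so agreement on \<open>carrier A\<close> has to suffice for equal coboundaries.\<close>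

lemma differential_cong:
  assumes "group G" and f: "f \<in> carrier (cochain_group G A n)"
    and eq: "\<And>g a. \<lbrakk>g \<in> carrier G; a \<in> carrier A\<rbrakk> \<Longrightarrow> \<rho> g a = \<rho>' g a"
  shows "differential G A \<rho> n f = differential G A \<rho>' n f"
proof -
  have "\<rho> (hd xs) (f (tl xs)) = \<rho>' (hd xs) (f (tl xs))" if "xs \<in> tuples G (Suc n)" for xs
  proof (rule eq)
    show "hd xs \<in> carrier G" using that by (auto simp: tuples_def length_Suc_conv)
    have "tl xs \<in> tuples G n" using that by (auto simp: tuples_def length_Suc_conv)
    then show "f (tl xs) \<in> carrier A" using f by (auto simp: cochain_group_def)
  qed
  then show ?thesis by (simp add: differential_def cong: restrict_cong)
qed

lemma coboundaries_cong:
  assumes "group G"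
    and eq: "\<And>g a. \<lbrakk>g \<in> carrier G; a \<in> carrier A\<rbrakk> \<Longrightarrow> \<rho> g a = \<rho>' g a"
  shows "coboundaries G A \<rho> n = coboundaries G A \<rho>' n"
proof (cases n)
  case (Suc k)
  have "differential G A \<rho> k f = differential G A \<rho>' k f" if "f \<in> carrier (cochain_group G A k)" for f
    using assms(1) that eq by (rule differential_cong)
  then show ?thesis by (simp add: Suc cong: image_cong)
qed simp

locale group_module = group G + A: comm_group A
  for G :: "('g, 'b) monoid_scheme" (structure) and A :: "('a, 'c) monoid_scheme" (structure) +
  fixes \<rho> :: "'g \<Rightarrow> 'a \<Rightarrow> 'a"
  assumes rho_hom: "g \<in> carrier G \<Longrightarrow> \<rho> g \<in> hom A A"
    and rho_mult: "\<lbrakk>g \<in> carrier G; h \<in> carrier G; a \<in> carrier A\<rbrakk> \<Longrightarrow> \<rho> (g \<otimes> h) a = \<rho> g (\<rho> h a)"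
begin

abbreviation "\<C> \<equiv> cochain_group G A"
abbreviation "\<Z> \<equiv> cocycle_group G A \<rho>"
abbreviation "\<B> \<equiv> coboundaries G A \<rho>"
abbreviation "\<d> \<equiv> differential G A \<rho>"

sublocale C: comm_group "\<C> n" for n
  by (rule comm_group_cochain_group) unfold_locales

lemma rho_closed [simp]: "\<lbrakk>g \<in> carrier G; a \<in> carrier A\<rbrakk> \<Longrightarrow> \<rho> g a \<in> carrier A"
  using rho_hom hom_in_carrier by metis

lemma rho_distrib:
  "\<lbrakk>g \<in> carrier G; a \<in> carrier A; b \<in> carrier A\<rbrakk> \<Longrightarrow> \<rho> g (a \<otimes>\<^bsub>A\<^esub> b) = \<rho> g a \<otimes>\<^bsub>A\<^esub> \<rho> g b"
  by (rule hom_mult[OF rho_hom])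

lemma rho_inv:
  assumes "g \<in> carrier G" "a \<in> carrier A"
  shows "\<rho> g (inv\<^bsub>A\<^esub> a) = inv\<^bsub>A\<^esub> \<rho> g a"
proof -
  interpret group_hom A A "\<rho> g"
    by (intro group_hom.intro group_hom_axioms.intro A.is_group rho_hom assms(1))
  show ?thesis using assms by simp
qed

lemma cochain_closed [simp]: "\<lbrakk>f \<in> carrier (\<C> n); xs \<in> tuples G n\<rbrakk> \<Longrightarrow> f xs \<in> carrier A"
  by (auto simp: cochain_group_def)

lemma cochain_mult [simp]: "xs \<in> tuples G n \<Longrightarrow> (f \<otimes>\<^bsub>\<C> n\<^esub> f') xs = f xs \<otimes>\<^bsub>A\<^esub> f' xs"
  by (simp add: cochain_group_def)

lemma cochain_one [simp]: "xs \<in> tuples G n \<Longrightarrow> \<one>\<^bsub>\<C> n\<^esub> xs = \<one>\<^bsub>A\<^esub>"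
  by (simp add: cochain_group_def)

lemma cochain_ext:
  "\<lbrakk>f \<in> carrier (\<C> n); f' \<in> carrier (\<C> n); \<And>xs. xs \<in> tuples G n \<Longrightarrow> f xs = f' xs\<rbrakk> \<Longrightarrow> f = f'"
  by (auto simp: cochain_group_def intro: PiE_ext)

lemma tl_tuples [simp]: "xs \<in> tuples G (Suc n) \<Longrightarrow> tl xs \<in> tuples G n"
  and hd_tuples [simp]: "xs \<in> tuples G (Suc n) \<Longrightarrow> hd xs \<in> carrier G"
  and butlast_tuples [simp]: "xs \<in> tuples G (Suc n) \<Longrightarrow> butlast xs \<in> tuples G n"
  by (auto simp: tuples_def length_Suc_conv dest: in_set_butlastD)

lemma merge_tuples [simp]:
  "\<lbrakk>xs \<in> tuples G (Suc n); i \<in> {1..n}\<rbrakk> \<Longrightarrow> merge_at G i xs \<in> tuples G n"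
  by (rule merge_at_in_tuples) (auto intro: is_group)

lemma differential_closed [simp]: "f \<in> carrier (\<C> n) \<Longrightarrow> \<d> n f \<in> carrier (\<C> (Suc n))"
  by (subst cochain_group_def) (auto simp: differential_def Pi_def)

lemma differential_mult:
  assumes f: "f \<in> carrier (\<C> n)" and f': "f' \<in> carrier (\<C> n)"
  shows "\<d> n (f \<otimes>\<^bsub>\<C> n\<^esub> f') = \<d> n f \<otimes>\<^bsub>\<C> (Suc n)\<^esub> \<d> n f'"
proof (rule cochain_ext)
  fix xs assume xs: "xs \<in> tuples G (Suc n)"
  \<comment> \<open>The product over the inner faces; its multiplicativity is separate from that of
    the two outer terms, because only the first outer term involves \<open>\<rho>\<close>.\<close>
  define M where "M f = (\<Otimes>\<^bsub>A\<^esub>i \<in> {1..n}. f (merge_at G i xs) [^]\<^bsub>A\<^esub> ((- 1) ^ i :: int))" for f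
  have d: "\<d> n f xs = \<rho> (hd xs) (f (tl xs)) \<otimes>\<^bsub>A\<^esub> M f \<otimes>\<^bsub>A\<^esub> f (butlast xs) [^]\<^bsub>A\<^esub> ((- 1) ^ Suc n :: int)"
    for f using xs by (simp add: differential_def M_def)
  have M: "M f \<in> carrier A" if "f \<in> carrier (\<C> n)" for f
    using that xs by (auto simp: M_def Pi_def)
  have "M (f \<otimes>\<^bsub>\<C> n\<^esub> f') = (\<Otimes>\<^bsub>A\<^esub>i \<in> {1..n}. f (merge_at G i xs) [^]\<^bsub>A\<^esub> ((- 1) ^ i :: int)
       \<otimes>\<^bsub>A\<^esub> f' (merge_at G i xs) [^]\<^bsub>A\<^esub> ((- 1) ^ i :: int))"
    unfolding M_def using xs f f' by (intro A.finprod_cong) (auto simp: A.int_pow_distrib simp_implies_def)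
  also have "\<dots> = M f \<otimes>\<^bsub>A\<^esub> M f'"
    unfolding M_def using xs f f' by (intro A.finprod_multf) auto
  finally have *: "M (f \<otimes>\<^bsub>\<C> n\<^esub> f') = M f \<otimes>\<^bsub>A\<^esub> M f'" .
  have "f (tl xs) \<in> carrier A" "f' (tl xs) \<in> carrier A"
    "f (butlast xs) \<in> carrier A" "f' (butlast xs) \<in> carrier A" "hd xs \<in> carrier G"
    using f f' xs by (auto intro: cochain_closed)
  then show "\<d> n (f \<otimes>\<^bsub>\<C> n\<^esub> f') xs = (\<d> n f \<otimes>\<^bsub>\<C> (Suc n)\<^esub> \<d> n f') xs"
    using xs * M[OF f] M[OF f']
    by (simp only: d cochain_mult tl_tuples butlast_tuples) (simp add: rho_distrib A.int_pow_distrib A.m_ac)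
qed (use assms in simp_all)

lemma differential_group_hom: "group_hom (\<C> n) (\<C> (Suc n)) (\<d> n)"
  by (intro group_hom.intro group_hom_axioms.intro homI C.is_group)
    (simp_all add: differential_mult)

lemma carrier_cocycle: "carrier (\<Z> n) = {f \<in> carrier (\<C> n). \<d> n f = \<one>\<^bsub>\<C> (Suc n)\<^esub>}"
  by (simp add: cocycle_group_def kernel_def)

lemma mult_cocycle [simp]: "monoid.mult (\<Z> n) = monoid.mult (\<C> n)"
  and one_cocycle [simp]: "one (\<Z> n) = one (\<C> n)"
  by (simp_all add: cocycle_group_def)

lemma cocycle_subgroup: "subgroup (carrier (\<Z> n)) (\<C> n)"
  using group_hom.subgroup_kernel[OF differential_group_hom] by (simp add: cocycle_group_def)

lemma cocycle_comm_group: "comm_group (\<Z> n)"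
proof (rule group.group_comm_groupI)
  show "group (\<Z> n)"
    using subgroup.subgroup_is_group[OF cocycle_subgroup C.is_group, of n]
    by (simp add: cocycle_group_def)
qed (simp add: carrier_cocycle C.m_comm)

lemma coboundaries_subgroup: "subgroup (\<B> n) (\<C> n)"
proof (cases n)
  case 0
  then show ?thesis using C.triv_subgroup by simp
next
  case (Suc k)
  then show ?thesis using group_hom.img_is_subgroup[OF differential_group_hom] by simp
qed

section \<open>Explicit differentials and cocycle conditions in low degrees\<close>

text \<open>The alternating product is unfolded once in each of the degrees 0 to 3, so that later
  arguments see only products and inverses.\<close>

lemma differential_0:
  assumes "f \<in> carrier (\<C> 0)" "g \<in> carrier G"
  shows "\<d> 0 f [g] = \<rho> g (f []) \<otimes>\<^bsub>A\<^esub> inv\<^bsub>A\<^esub> f []"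
proof -
  have "f [] \<in> carrier A" using assms(1) by (simp add: tuples_def)
  then show ?thesis using assms(2) by (simp add: differential_def tuples_def A.int_pow_neg)
qed

lemma differential_1:
  assumes "f \<in> carrier (\<C> 1)" "g \<in> carrier G" "h \<in> carrier G"
  shows "\<d> 1 f [g, h] = \<rho> g (f [h]) \<otimes>\<^bsub>A\<^esub> inv\<^bsub>A\<^esub> f [g \<otimes> h] \<otimes>\<^bsub>A\<^esub> f [g]"
proof -
  have *: "f [x] \<in> carrier A" if "x \<in> carrier G" for x
    using assms(1) that by (simp add: tuples_def)
  show ?thesis
    using assms(2,3) * by (simp add: differential_def tuples_def merge_at_def A.int_pow_neg)
qed

lemma differential_2:
  assumes "f \<in> carrier (\<C> 2)" "g \<in> carrier G" "h \<in> carrier G" "k \<in> carrier G"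
  shows "\<d> 2 f [g, h, k] =
    \<rho> g (f [h, k]) \<otimes>\<^bsub>A\<^esub> (inv\<^bsub>A\<^esub> f [g \<otimes> h, k] \<otimes>\<^bsub>A\<^esub> f [g, h \<otimes> k]) \<otimes>\<^bsub>A\<^esub> inv\<^bsub>A\<^esub> f [g, h]"
proof -
  have *: "f [x, y] \<in> carrier A" if "x \<in> carrier G" "y \<in> carrier G" for x y
    using assms(1) that by (simp add: tuples_def)
  have "{1..2::nat} = {1, 2}" by auto
  then show ?thesis
    using assms(2-) * by (simp add: differential_def tuples_def merge_at_def A.int_pow_neg)
qed

lemma differential_3:
  assumes "f \<in> carrier (\<C> 3)"
    and "g \<in> carrier G" "h \<in> carrier G" "k \<in> carrier G" "l \<in> carrier G"
  shows "\<d> 3 f [g, h, k, l] =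
    \<rho> g (f [h, k, l]) \<otimes>\<^bsub>A\<^esub> (inv\<^bsub>A\<^esub> f [g \<otimes> h, k, l] \<otimes>\<^bsub>A\<^esub>
      (f [g, h \<otimes> k, l] \<otimes>\<^bsub>A\<^esub> inv\<^bsub>A\<^esub> f [g, h, k \<otimes> l])) \<otimes>\<^bsub>A\<^esub> f [g, h, k]"
proof -
  have *: "f [x, y, z] \<in> carrier A" if "x \<in> carrier G" "y \<in> carrier G" "z \<in> carrier G" for x y z
    using assms(1) that by (simp add: tuples_def)
  have "{1..3::nat} = {1, 2, 3}" by auto
  then show ?thesis
    using assms(2-) * by (simp add: differential_def tuples_def merge_at_def A.int_pow_neg numeral_3_eq_3)
qed

lemma div_eq_one_iff:
  assumes "x \<in> carrier A" "y \<in> carrier A"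
  shows "x \<otimes>\<^bsub>A\<^esub> inv\<^bsub>A\<^esub> y = \<one>\<^bsub>A\<^esub> \<longleftrightarrow> x = y"
proof
  assume *: "x \<otimes>\<^bsub>A\<^esub> inv\<^bsub>A\<^esub> y = \<one>\<^bsub>A\<^esub>"
  have "x = x \<otimes>\<^bsub>A\<^esub> inv\<^bsub>A\<^esub> y \<otimes>\<^bsub>A\<^esub> y" using assms by (simp add: A.m_assoc)
  then show "x = y" using assms unfolding * by simp
qed (use assms in simp)

text \<open>These equivalences translate between cochains indexed by lists and identities quantified
  over single group elements.\<close>

lemma ball_tuples_0: "(\<forall>xs \<in> tuples G 0. P xs) \<longleftrightarrow> P []"
  by (auto simp: tuples_def)

lemma ball_tuples_Suc:
  "(\<forall>xs \<in> tuples G (Suc n). P xs) \<longleftrightarrow> (\<forall>g \<in> carrier G. \<forall>xs \<in> tuples G n. P (g # xs))"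
proof (intro iffI ballI)
  fix xs assume "\<forall>g \<in> carrier G. \<forall>xs \<in> tuples G n. P (g # xs)" and xs: "xs \<in> tuples G (Suc n)"
  then have "P (hd xs # tl xs)" by simp
  moreover have "xs \<noteq> []" using xs by (auto simp: tuples_def)
  ultimately show "P xs" by simp
qed (simp add: tuples_def)

lemma ball_tuples_1: "(\<forall>xs \<in> tuples G 1. P xs) \<longleftrightarrow> (\<forall>g \<in> carrier G. P [g])"
  and ball_tuples_2: "(\<forall>xs \<in> tuples G 2. P xs) \<longleftrightarrow> (\<forall>g \<in> carrier G. \<forall>h \<in> carrier G. P [g, h])"
  and ball_tuples_3: "(\<forall>xs \<in> tuples G 3. P xs) \<longleftrightarrow>
    (\<forall>g \<in> carrier G. \<forall>h \<in> carrier G. \<forall>k \<in> carrier G. P [g, h, k])"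
  and ball_tuples_4: "(\<forall>xs \<in> tuples G 4. P xs) \<longleftrightarrow>
    (\<forall>g \<in> carrier G. \<forall>h \<in> carrier G. \<forall>k \<in> carrier G. \<forall>l \<in> carrier G. P [g, h, k, l])"
  by (simp_all add: ball_tuples_0 ball_tuples_Suc eval_nat_numeral)

text \<open>Sorting with \<open>A.m_ac\<close> may leave a factor and its inverse apart in a
  right-nested product; this rule and the next two cancel such a pair in the positions that
  occur.\<close>

lemma mult_div_cancel:
  assumes "x \<in> carrier A" "y \<in> carrier A"
  shows "x \<otimes>\<^bsub>A\<^esub> (inv\<^bsub>A\<^esub> x \<otimes>\<^bsub>A\<^esub> y) = y"
  using assms by (simp flip: A.m_assoc)

lemma mult_div_cancel':
  assumes "x \<in> carrier A" "y \<in> carrier A" "z \<in> carrier A"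
  shows "x \<otimes>\<^bsub>A\<^esub> (y \<otimes>\<^bsub>A\<^esub> (inv\<^bsub>A\<^esub> x \<otimes>\<^bsub>A\<^esub> z)) = y \<otimes>\<^bsub>A\<^esub> z"
  using assms by (simp add: A.m_lcomm[of y "inv\<^bsub>A\<^esub> x"] mult_div_cancel)

lemma mult_div_cancel'':
  assumes "x \<in> carrier A" "y \<in> carrier A"
  shows "x \<otimes>\<^bsub>A\<^esub> (y \<otimes>\<^bsub>A\<^esub> inv\<^bsub>A\<^esub> x) = y"
  using assms mult_div_cancel'[of x y "\<one>\<^bsub>A\<^esub>"] by simp

lemma cocycle_iff:
  assumes "f \<in> carrier (\<C> n)"
  shows "f \<in> carrier (\<Z> n) \<longleftrightarrow> (\<forall>xs \<in> tuples G (Suc n). \<d> n f xs = \<one>\<^bsub>A\<^esub>)"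
proof -
  have "\<d> n f = \<one>\<^bsub>\<C> (Suc n)\<^esub> \<longleftrightarrow> (\<forall>xs \<in> tuples G (Suc n). \<d> n f xs = \<one>\<^bsub>A\<^esub>)"
  proof
    assume *: "\<forall>xs \<in> tuples G (Suc n). \<d> n f xs = \<one>\<^bsub>A\<^esub>"
    show "\<d> n f = \<one>\<^bsub>\<C> (Suc n)\<^esub>"
      by (rule cochain_ext[of _ "Suc n"]) (use * assms in simp_all)
  qed simp
  then show ?thesis using assms by (simp add: carrier_cocycle)
qed

text \<open>Terms with negative exponent are moved to the other side of the equation; in degree 1
  this gives the crossed homomorphisms.\<close>

lemma cocycle_1_iff:
  assumes f: "f \<in> carrier (\<C> 1)"
  shows "f \<in> carrier (\<Z> 1) \<longleftrightarrow>
    (\<forall>g \<in> carrier G. \<forall>h \<in> carrier G. f [g \<otimes> h] = f [g] \<otimes>\<^bsub>A\<^esub> \<rho> g (f [h]))"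
proof -
  have *: "f [x] \<in> carrier A" if "x \<in> carrier G" for x
    using f that by (simp add: tuples_def)
  have "\<d> 1 f [g, h] = \<one>\<^bsub>A\<^esub> \<longleftrightarrow> f [g \<otimes> h] = f [g] \<otimes>\<^bsub>A\<^esub> \<rho> g (f [h])"
    if "g \<in> carrier G" "h \<in> carrier G" for g h
  proof -
    have "\<d> 1 f [g, h] = (f [g] \<otimes>\<^bsub>A\<^esub> \<rho> g (f [h])) \<otimes>\<^bsub>A\<^esub> inv\<^bsub>A\<^esub> f [g \<otimes> h]"
      using that f * by (simp only: differential_1) (simp add: A.m_ac)
    also have "\<dots> = \<one>\<^bsub>A\<^esub> \<longleftrightarrow> f [g] \<otimes>\<^bsub>A\<^esub> \<rho> g (f [h]) = f [g \<otimes> h]"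
      by (rule div_eq_one_iff) (use that * in simp_all)
    finally show ?thesis by (simp only: eq_commute)
  qed
  moreover have "Suc 1 = 2" by simp
  ultimately show ?thesis
    unfolding cocycle_iff[OF f] by (simp only: ball_tuples_2) simp
qed

lemma cocycle_2_iff:
  assumes f: "f \<in> carrier (\<C> 2)"
  shows "f \<in> carrier (\<Z> 2) \<longleftrightarrow>
    (\<forall>g \<in> carrier G. \<forall>h \<in> carrier G. \<forall>k \<in> carrier G.
      \<rho> g (f [h, k]) \<otimes>\<^bsub>A\<^esub> f [g, h \<otimes> k] = f [g \<otimes> h, k] \<otimes>\<^bsub>A\<^esub> f [g, h])"
proof -
  have *: "f [x, y] \<in> carrier A" if "x \<in> carrier G" "y \<in> carrier G" for x y
    using f that by (simp add: tuples_def)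
  have "\<d> 2 f [g, h, k] = \<one>\<^bsub>A\<^esub> \<longleftrightarrow>
      \<rho> g (f [h, k]) \<otimes>\<^bsub>A\<^esub> f [g, h \<otimes> k] = f [g \<otimes> h, k] \<otimes>\<^bsub>A\<^esub> f [g, h]"
    if "g \<in> carrier G" "h \<in> carrier G" "k \<in> carrier G" for g h k
  proof -
    have "\<d> 2 f [g, h, k] =
        (\<rho> g (f [h, k]) \<otimes>\<^bsub>A\<^esub> f [g, h \<otimes> k]) \<otimes>\<^bsub>A\<^esub> inv\<^bsub>A\<^esub> (f [g \<otimes> h, k] \<otimes>\<^bsub>A\<^esub> f [g, h])"
      using that f * by (simp only: differential_2) (simp add: A.m_ac A.inv_mult)
    then show ?thesis using that * by (simp add: div_eq_one_iff)
  qed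
  moreover have "Suc 2 = 3" by simp
  ultimately show ?thesis
    unfolding cocycle_iff[OF f] by (simp add: ball_tuples_3 del: One_nat_def)
qed

lemma cocycle_3_iff:
  assumes f: "f \<in> carrier (\<C> 3)"
  shows "f \<in> carrier (\<Z> 3) \<longleftrightarrow>
    (\<forall>g \<in> carrier G. \<forall>h \<in> carrier G. \<forall>k \<in> carrier G. \<forall>l \<in> carrier G.
      \<rho> g (f [h, k, l]) \<otimes>\<^bsub>A\<^esub> f [g, h \<otimes> k, l] \<otimes>\<^bsub>A\<^esub> f [g, h, k]
      = f [g \<otimes> h, k, l] \<otimes>\<^bsub>A\<^esub> f [g, h, k \<otimes> l])"
proof -
  have *: "f [x, y, z] \<in> carrier A" if "x \<in> carrier G" "y \<in> carrier G" "z \<in> carrier G" for x y z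
    using f that by (simp add: tuples_def)
  have "\<d> 3 f [g, h, k, l] = \<one>\<^bsub>A\<^esub> \<longleftrightarrow>
      \<rho> g (f [h, k, l]) \<otimes>\<^bsub>A\<^esub> f [g, h \<otimes> k, l] \<otimes>\<^bsub>A\<^esub> f [g, h, k]
      = f [g \<otimes> h, k, l] \<otimes>\<^bsub>A\<^esub> f [g, h, k \<otimes> l]"
    if "g \<in> carrier G" "h \<in> carrier G" "k \<in> carrier G" "l \<in> carrier G" for g h k l
  proof -
    have "\<d> 3 f [g, h, k, l] =
        (\<rho> g (f [h, k, l]) \<otimes>\<^bsub>A\<^esub> f [g, h \<otimes> k, l] \<otimes>\<^bsub>A\<^esub> f [g, h, k])
        \<otimes>\<^bsub>A\<^esub> inv\<^bsub>A\<^esub> (f [g \<otimes> h, k, l] \<otimes>\<^bsub>A\<^esub> f [g, h, k \<otimes> l])"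
      using that f * by (simp only: differential_3) (simp add: A.m_ac A.inv_mult)
    then show ?thesis using that * by (simp add: div_eq_one_iff)
  qed
  moreover have "Suc 3 = 4" by simp
  ultimately show ?thesis
    unfolding cocycle_iff[OF f] by (simp add: ball_tuples_4 del: One_nat_def)
qed

section \<open>Coboundaries are cocycles in degrees 1 and 2\<close>

text \<open>This and the next lemma are \<open>d d = 1\<close> in the degrees where the quotient is
  used as a group, in the torsor and in the automorphism statement.\<close>

lemma coboundary_1_imp_cocycle: "\<B> 1 \<subseteq> carrier (\<Z> 1)"
proof
  fix b assume "b \<in> \<B> 1"
  then obtain f where f: "f \<in> carrier (\<C> 0)" "b = \<d> 0 f" by auto
  have f0: "f [] \<in> carrier A" using f(1) by (simp add: tuples_def)
  have b: "b \<in> carrier (\<C> 1)" using f by simp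
  have "b [g \<otimes> h] = b [g] \<otimes>\<^bsub>A\<^esub> \<rho> g (b [h])" if g: "g \<in> carrier G" "h \<in> carrier G" for g h
  proof -
    \<comment> \<open>The sum telescopes: \<open>\<rho> g (f [])\<close> occurs once from each
      factor, with opposite exponents.\<close>
    have "b [g] \<otimes>\<^bsub>A\<^esub> \<rho> g (b [h]) =
        (\<rho> g (\<rho> h (f [])) \<otimes>\<^bsub>A\<^esub> inv\<^bsub>A\<^esub> f []) \<otimes>\<^bsub>A\<^esub> (\<rho> g (f []) \<otimes>\<^bsub>A\<^esub> inv\<^bsub>A\<^esub> \<rho> g (f []))"
      using g f f0 by (simp add: differential_0 rho_distrib rho_inv) (simp add: A.m_ac mult_div_cancel)
    then show ?thesis
      using g f f0 by (simp add: differential_0 rho_mult)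
  qed
  then show "b \<in> carrier (\<Z> 1)" using b cocycle_1_iff by blast
qed

lemma coboundary_2_imp_cocycle: "\<B> 2 \<subseteq> carrier (\<Z> 2)"
proof
  fix b assume "b \<in> \<B> 2"
  then obtain f where f: "f \<in> carrier (\<C> 1)" "b = \<d> 1 f" by (auto simp: numeral_2_eq_2)
  have f1: "f [x] \<in> carrier A" if "x \<in> carrier G" for x using f(1) that by (simp add: tuples_def)
  have b: "b \<in> carrier (\<C> 2)" using differential_closed[OF f(1)] f(2) by (simp add: numeral_2_eq_2)
  have "\<rho> g (b [h, k]) \<otimes>\<^bsub>A\<^esub> b [g, h \<otimes> k] = b [g \<otimes> h, k] \<otimes>\<^bsub>A\<^esub> b [g, h]"
    if g: "g \<in> carrier G" "h \<in> carrier G" "k \<in> carrier G" for g h k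
  proof -
    \<comment> \<open>The common value of both sides. The left side contains in addition
      \<open>\<rho> g (f [h \<otimes> k])\<close> with its inverse, the right side
      \<open>f [g \<otimes> h]\<close> with its inverse.\<close>
    let ?m = "\<rho> g (\<rho> h (f [k])) \<otimes>\<^bsub>A\<^esub> \<rho> g (f [h]) \<otimes>\<^bsub>A\<^esub> inv\<^bsub>A\<^esub> f [g \<otimes> (h \<otimes> k)] \<otimes>\<^bsub>A\<^esub> f [g]"
    have "\<rho> g (b [h, k]) \<otimes>\<^bsub>A\<^esub> b [g, h \<otimes> k] =
        ?m \<otimes>\<^bsub>A\<^esub> (\<rho> g (f [h \<otimes> k]) \<otimes>\<^bsub>A\<^esub> inv\<^bsub>A\<^esub> \<rho> g (f [h \<otimes> k]))"
      using g f(1) f1 unfolding f(2)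
      by (simp only: differential_1 rho_distrib rho_inv m_closed A.m_closed A.inv_closed rho_closed)
        (simp add: A.m_ac mult_div_cancel)
    also have "\<dots> = ?m" using g f1 by simp
    also have "\<dots> = ?m \<otimes>\<^bsub>A\<^esub> (f [g \<otimes> h] \<otimes>\<^bsub>A\<^esub> inv\<^bsub>A\<^esub> f [g \<otimes> h])" using g f1 by simp
    also have "\<dots> = b [g \<otimes> h, k] \<otimes>\<^bsub>A\<^esub> b [g, h]"
      using g f(1) f1 unfolding f(2)
      by (simp only: differential_1 m_closed A.m_closed A.inv_closed rho_closed rho_mult m_assoc)
        (simp add: A.m_ac mult_div_cancel mult_div_cancel')
    finally show ?thesis .
  qed
  then show "b \<in> carrier (\<Z> 2)" using b cocycle_2_iff by blast
qed

lemma coboundaries_subgroup_cocycles: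
  assumes "\<B> n \<subseteq> carrier (\<Z> n)"
  shows "subgroup (\<B> n) (\<Z> n)"
  using C.subgroup_incl[OF coboundaries_subgroup cocycle_subgroup assms]
  by (simp add: cocycle_group_def)

text \<open>Unlike the cohomology group, the class only refers to the product of cochains, so no
  relation between coboundaries and cocycles enters.\<close>

lemma cohomology_class_eq:
  "cohomology_class G A \<rho> n f = \<B> n #>\<^bsub>\<C> n\<^esub> f"
  by (simp add: cohomology_class_def r_coset_def)

lemma cohomology_class_coboundary_mult:
  assumes "b \<in> \<B> n" "f \<in> carrier (\<C> n)"
  shows "cohomology_class G A \<rho> n (b \<otimes>\<^bsub>\<C> n\<^esub> f) = cohomology_class G A \<rho> n f"
proof -
  have "b \<otimes>\<^bsub>\<C> n\<^esub> f \<in> \<B> n #>\<^bsub>\<C> n\<^esub> f"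
    using assms by (auto simp: r_coset_def)
  then show ?thesis
    using C.repr_independence[OF _ assms(2) coboundaries_subgroup] by (simp add: cohomology_class_eq)
qed

text \<open>The unit of a quotient by \<open>Mod\<close> is the subgroup itself, so this is the
  criterion for a vanishing class.\<close>

lemma cohomology_class_eq_one_iff:
  assumes "f \<in> carrier (\<C> n)"
  shows "cohomology_class G A \<rho> n f = \<B> n \<longleftrightarrow> f \<in> \<B> n"
  using C.rcos_self[OF assms coboundaries_subgroup] C.coset_join2[OF assms coboundaries_subgroup]
  by (auto simp: cohomology_class_eq)

end

section \<open>The centre of a category\<close>

lemma comp_endo_simps [simp]:
  "on_obj (F \<circ>\<^sub>F H) X = on_obj F (on_obj H X)"
  "on_arr (F \<circ>\<^sub>F H) f = on_arr F (on_arr H f)"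
  by (simp_all add: comp_endo_def)

lemma id_endo_simps [simp]: "on_obj id_endo X = X" "on_arr id_endo f = f"
  by (simp_all add: id_endo_def)

context category
begin

section \<open>Arrows, isomorphisms, functors and natural isomorphisms\<close>

lemma Hom_iff: "f \<in> Hom_set C X Y \<longleftrightarrow> f \<in> Arr C \<and> Dom C f = X \<and> Cod C f = Y"
  by (simp add: Hom_set_def)

lemma Obj_Dom [simp]: "f \<in> Arr C \<Longrightarrow> Dom C f \<in> Obj C"
  and Obj_Cod [simp]: "f \<in> Arr C \<Longrightarrow> Cod C f \<in> Obj C"
  by (rule Dom_in_Obj Cod_in_Obj, assumption)+

lemma Ide_simps [simp]:
  assumes "X \<in> Obj C"
  shows "Ide C X \<in> Arr C" "Dom C (Ide C X) = X" "Cod C (Ide C X) = X"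
  using Ide_in_Hom[OF assms] by (simp_all add: Hom_iff)

lemma comp_simps [simp]:
  assumes "g \<in> Arr C" "f \<in> Arr C" "Dom C g = Cod C f"
  shows "g \<cdot> f \<in> Arr C" "Dom C (g \<cdot> f) = Dom C f" "Cod C (g \<cdot> f) = Cod C g"
  using Comp_in_Hom[of f "Dom C f" "Dom C g" g "Cod C g"] assms by (simp_all add: Hom_iff)

lemma comp_Ide [simp]: "\<lbrakk>f \<in> Arr C; Dom C f = X\<rbrakk> \<Longrightarrow> f \<cdot> Ide C X = f"
  and Ide_comp [simp]: "\<lbrakk>f \<in> Arr C; Cod C f = X\<rbrakk> \<Longrightarrow> Ide C X \<cdot> f = f"
  using Comp_Ide[of f X "Cod C f"] Ide_Comp[of f "Dom C f" X] by (simp_all add: Hom_iff)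

lemma comp_assoc:
  "\<lbrakk>f \<in> Arr C; g \<in> Arr C; h \<in> Arr C; Dom C g = Cod C f; Dom C h = Cod C g\<rbrakk>
    \<Longrightarrow> (h \<cdot> g) \<cdot> f = h \<cdot> (g \<cdot> f)"
  using Comp_assoc[of f "Dom C f" "Dom C g" g "Dom C h" h "Cod C h"] by (simp add: Hom_iff)

lemma iso_arrow_Arr [simp]: "iso_arrow C f \<Longrightarrow> f \<in> Arr C"
  by (simp add: iso_arrow_def)

lemma iso_arrowI:
  "\<lbrakk>f \<in> Arr C; g \<in> Arr C; Dom C g = Cod C f; Cod C g = Dom C f;
    g \<cdot> f = Ide C (Dom C f); f \<cdot> g = Ide C (Cod C f)\<rbrakk> \<Longrightarrow> iso_arrow C f"
  unfolding iso_arrow_def by (blast intro: Hom_iff[THEN iffD2])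

definition inv_arr :: "'m \<Rightarrow> 'm" where
  "inv_arr f = (SOME g. g \<in> Hom_set C (Cod C f) (Dom C f) \<and>
     g \<cdot> f = Ide C (Dom C f) \<and> f \<cdot> g = Ide C (Cod C f))"

lemma inv_arr:
  assumes "iso_arrow C f"
  shows inv_arr_Arr [simp]: "inv_arr f \<in> Arr C"
    and Dom_inv_arr [simp]: "Dom C (inv_arr f) = Cod C f"
    and Cod_inv_arr [simp]: "Cod C (inv_arr f) = Dom C f"
    and inv_arr_comp [simp]: "inv_arr f \<cdot> f = Ide C (Dom C f)"
    and comp_inv_arr [simp]: "f \<cdot> inv_arr f = Ide C (Cod C f)"
proof -
  have "inv_arr f \<in> Hom_set C (Cod C f) (Dom C f) \<and>
     inv_arr f \<cdot> f = Ide C (Dom C f) \<and> f \<cdot> inv_arr f = Ide C (Cod C f)"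
    unfolding inv_arr_def by (rule someI_ex) (use assms in \<open>auto simp: iso_arrow_def\<close>)
  then show "inv_arr f \<in> Arr C" "Dom C (inv_arr f) = Cod C f" "Cod C (inv_arr f) = Dom C f"
    "inv_arr f \<cdot> f = Ide C (Dom C f)" "f \<cdot> inv_arr f = Ide C (Cod C f)"
    by (simp_all add: Hom_iff)
qed

lemma iso_inv_arr [simp]: "iso_arrow C f \<Longrightarrow> iso_arrow C (inv_arr f)"
  by (rule iso_arrowI[where g = f]) simp_all

lemma iso_Ide [simp]: "X \<in> Obj C \<Longrightarrow> iso_arrow C (Ide C X)"
  by (rule iso_arrowI[where g = "Ide C X"]) simp_all

lemma comp_inv_arr_cancel [simp]:
  assumes "iso_arrow C f" "g \<in> Arr C"
  shows "Cod C g = Cod C f \<Longrightarrow> f \<cdot> (inv_arr f \<cdot> g) = g"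
    and "Cod C g = Dom C f \<Longrightarrow> inv_arr f \<cdot> (f \<cdot> g) = g"
proof -
  show "f \<cdot> (inv_arr f \<cdot> g) = g" if "Cod C g = Cod C f"
    using assms that by (subst comp_assoc[symmetric]) simp_all
  show "inv_arr f \<cdot> (f \<cdot> g) = g" if "Cod C g = Dom C f"
    using assms that by (subst comp_assoc[symmetric]) simp_all
qed

lemma iso_comp [simp]:
  assumes f: "iso_arrow C f" and g: "iso_arrow C g" and "Dom C g = Cod C f"
  shows "iso_arrow C (g \<cdot> f)"
  by (rule iso_arrowI[where g = "inv_arr f \<cdot> inv_arr g"]) (use assms in \<open>simp_all add: comp_assoc\<close>)

lemma iso_cancel_left:
  assumes "iso_arrow C f" "g \<in> Arr C" "h \<in> Arr C" "Cod C g = Dom C f" "Cod C h = Dom C f"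
    and "f \<cdot> g = f \<cdot> h"
  shows "g = h"
  using comp_inv_arr_cancel(2)[OF assms(1,2,4)] comp_inv_arr_cancel(2)[OF assms(1,3,5)]
  unfolding assms(6) by (rule trans[OF sym])

lemma iso_cancel_right:
  assumes "iso_arrow C f" "g \<in> Arr C" "h \<in> Arr C" "Dom C g = Cod C f" "Dom C h = Cod C f"
    and "g \<cdot> f = h \<cdot> f"
  shows "g = h"
proof -
  have "x \<cdot> f \<cdot> inv_arr f = x" if "x \<in> Arr C" "Dom C x = Cod C f" for x
    using that assms(1) by (simp add: comp_assoc)
  from this[OF assms(2,4)] this[OF assms(3,5)] show ?thesis
    unfolding assms(6) by (rule trans[OF sym])
qed

lemma endofunctorD [simp]:
  assumes "endofunctor C F"
  shows endo_obj: "X \<in> Obj C \<Longrightarrow> on_obj F X \<in> Obj C"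
    and endo_Ide: "X \<in> Obj C \<Longrightarrow> on_arr F (Ide C X) = Ide C (on_obj F X)"
    and endo_Arr: "f \<in> Arr C \<Longrightarrow> on_arr F f \<in> Arr C"
    and endo_Dom: "f \<in> Arr C \<Longrightarrow> Dom C (on_arr F f) = on_obj F (Dom C f)"
    and endo_Cod: "f \<in> Arr C \<Longrightarrow> Cod C (on_arr F f) = on_obj F (Cod C f)"
    and endo_comp: "\<lbrakk>f \<in> Arr C; g \<in> Arr C; Dom C g = Cod C f\<rbrakk>
      \<Longrightarrow> on_arr F (g \<cdot> f) = on_arr F g \<cdot> on_arr F f"
proof -
  have "on_arr F f \<in> Hom_set C (on_obj F (Dom C f)) (on_obj F (Cod C f))" if "f \<in> Arr C" for f
    using assms that Obj_Dom[OF that] Obj_Cod[OF that] unfolding endofunctor_def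
    by (blast intro: Hom_iff[THEN iffD2])
  then show "f \<in> Arr C \<Longrightarrow> on_arr F f \<in> Arr C"
    "f \<in> Arr C \<Longrightarrow> Dom C (on_arr F f) = on_obj F (Dom C f)"
    "f \<in> Arr C \<Longrightarrow> Cod C (on_arr F f) = on_obj F (Cod C f)"
    by (simp_all add: Hom_iff)
qed (use assms in \<open>unfold endofunctor_def, simp_all\<close>)

lemma endo_iso [simp]:
  assumes "endofunctor C F" "iso_arrow C f"
  shows "iso_arrow C (on_arr F f)"
  by (rule iso_arrowI[where g = "on_arr F (inv_arr f)"])
    (use assms endo_comp[OF assms(1), of f "inv_arr f"] endo_comp[OF assms(1), of "inv_arr f" f]
      in simp_all)

lemma endo_id [simp]: "endofunctor C id_endo"
  by (simp add: endofunctor_def)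

lemma endo_comp_endo [simp]: "\<lbrakk>endofunctor C F; endofunctor C H\<rbrakk> \<Longrightarrow> endofunctor C (F \<circ>\<^sub>F H)"
  unfolding endofunctor_def[of C "F \<circ>\<^sub>F H"] by (simp add: Hom_iff)

lemma nat_isosI:
  assumes "\<And>X. X \<in> Obj C \<Longrightarrow> iso_arrow C (\<eta> X)"
    and "\<And>X. X \<in> Obj C \<Longrightarrow> Dom C (\<eta> X) = on_obj F X"
    and "\<And>X. X \<in> Obj C \<Longrightarrow> Cod C (\<eta> X) = on_obj H X"
    and "\<And>f. f \<in> Arr C \<Longrightarrow> \<eta> (Cod C f) \<cdot> on_arr F f = on_arr H f \<cdot> \<eta> (Dom C f)"
  shows "restrict \<eta> (Obj C) \<in> nat_isos C F H"
  using assms by (simp add: nat_isos_def Hom_iff)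

lemma nat_isosD:
  assumes "\<eta> \<in> nat_isos C F H"
  shows nat_iso: "X \<in> Obj C \<Longrightarrow> iso_arrow C (\<eta> X)"
    and nat_Arr: "X \<in> Obj C \<Longrightarrow> \<eta> X \<in> Arr C"
    and nat_Dom: "X \<in> Obj C \<Longrightarrow> Dom C (\<eta> X) = on_obj F X"
    and nat_Cod: "X \<in> Obj C \<Longrightarrow> Cod C (\<eta> X) = on_obj H X"
    and naturality: "f \<in> Arr C \<Longrightarrow> \<eta> (Cod C f) \<cdot> on_arr F f = on_arr H f \<cdot> \<eta> (Dom C f)"
    and nat_extensional: "\<eta> \<in> extensional (Obj C)"
  using assms by (auto simp: nat_isos_def Hom_iff PiE_iff)

lemmas nat_simps = nat_iso nat_Arr nat_Dom nat_Cod

lemma nat_isos_ext: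
  assumes "\<eta> \<in> nat_isos C F H" "\<theta> \<in> nat_isos C F' H'"
    and "\<And>X. X \<in> Obj C \<Longrightarrow> \<eta> X = \<theta> X"
  shows "\<eta> = \<theta>"
  by (rule extensionalityI[OF nat_extensional[OF assms(1)] nat_extensional[OF assms(2)] assms(3)])

lemma nat_isos_comp:
  assumes "endofunctor C E" "endofunctor C F" "endofunctor C H"
    and \<eta>: "\<eta> \<in> nat_isos C E F" and \<theta>: "\<theta> \<in> nat_isos C F H"
  shows "(\<lambda>X \<in> Obj C. \<theta> X \<cdot> \<eta> X) \<in> nat_isos C E H"
proof (rule nat_isosI)
  note [simp] = nat_isosD[OF \<eta>] nat_isosD[OF \<theta>] assms
  fix f assume f: "f \<in> Arr C"
  have "\<theta> (Cod C f) \<cdot> \<eta> (Cod C f) \<cdot> on_arr E f = (\<theta> (Cod C f) \<cdot> on_arr F f) \<cdot> \<eta> (Dom C f)"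
    using f by (simp add: comp_assoc del: naturality[OF \<theta>])
  then show "\<theta> (Cod C f) \<cdot> \<eta> (Cod C f) \<cdot> on_arr E f = on_arr H f \<cdot> (\<theta> (Dom C f) \<cdot> \<eta> (Dom C f))"
    using f by (simp add: comp_assoc)
qed (simp_all add: nat_isosD[OF \<eta>] nat_isosD[OF \<theta>])

lemma nat_isos_inv:
  assumes F: "endofunctor C F" and H: "endofunctor C H" and \<eta>: "\<eta> \<in> nat_isos C F H"
  shows "(\<lambda>X \<in> Obj C. inv_arr (\<eta> X)) \<in> nat_isos C H F"
proof (rule nat_isosI)
  note [simp] = nat_simps[OF \<eta>] F H
  fix f assume f: "f \<in> Arr C"
  have "inv_arr (\<eta> (Cod C f)) \<cdot> on_arr H f =
      inv_arr (\<eta> (Cod C f)) \<cdot> ((on_arr H f \<cdot> \<eta> (Dom C f)) \<cdot> inv_arr (\<eta> (Dom C f)))"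
    using f by (simp add: comp_assoc)
  also have "\<dots> = on_arr F f \<cdot> inv_arr (\<eta> (Dom C f))"
    unfolding naturality[OF \<eta> f, symmetric] using f by (simp add: comp_assoc)
  finally show "inv_arr (\<eta> (Cod C f)) \<cdot> on_arr H f = on_arr F f \<cdot> inv_arr (\<eta> (Dom C f))" .
qed (simp_all add: nat_isosD[OF \<eta>])

text \<open>The Godement product, written as in \<open>genuine_isos\<close>. It serves to carry
  compositors from one gerbal action to an isomorphic one.\<close>

lemma nat_isos_hcomp:
  assumes endo: "endofunctor C F" "endofunctor C F'" "endofunctor C H" "endofunctor C H'"
    and \<eta>: "\<eta> \<in> nat_isos C F F'" and \<theta>: "\<theta> \<in> nat_isos C H H'"
  shows "(\<lambda>X \<in> Obj C. \<eta> (on_obj H' X) \<cdot> on_arr F (\<theta> X)) \<in> nat_isos C (F \<circ>\<^sub>F H) (F' \<circ>\<^sub>F H')"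
proof (rule nat_isosI)
  note [simp] = nat_simps[OF \<eta>]
    nat_simps[OF \<theta>] endo
  fix f assume f: "f \<in> Arr C"
  have "\<eta> (on_obj H' (Cod C f)) \<cdot> on_arr F (\<theta> (Cod C f)) \<cdot> on_arr F (on_arr H f) =
      \<eta> (on_obj H' (Cod C f)) \<cdot> on_arr F (on_arr H' f \<cdot> \<theta> (Dom C f))"
    unfolding naturality[OF \<theta> f, symmetric] using f by (simp add: comp_assoc)
  also have "\<dots> = \<eta> (Cod C (on_arr H' f)) \<cdot> on_arr F (on_arr H' f) \<cdot> on_arr F (\<theta> (Dom C f))"
    using f by (simp add: comp_assoc)
  also have "\<dots> = on_arr F' (on_arr H' f) \<cdot> (\<eta> (on_obj H' (Dom C f)) \<cdot> on_arr F (\<theta> (Dom C f)))"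
    unfolding naturality[OF \<eta> endo_Arr[OF endo(4) f]] using f by (simp add: comp_assoc)
  finally show "\<eta> (on_obj H' (Cod C f)) \<cdot> on_arr F (\<theta> (Cod C f)) \<cdot> on_arr (F \<circ>\<^sub>F H) f =
      on_arr (F' \<circ>\<^sub>F H') f \<cdot> (\<eta> (on_obj H' (Dom C f)) \<cdot> on_arr F (\<theta> (Dom C f)))"
    by simp
qed (simp_all add: nat_isosD[OF \<eta>] nat_isosD[OF \<theta>] endo)

section \<open>The automorphism group of the identity functor\<close>

abbreviation "Z \<equiv> center_units C"

lemma carrier_Z: "carrier Z = nat_isos C id_endo id_endo"
  by (simp add: center_units_def)

lemma Z_simps [simp]:
  assumes "a \<in> carrier Z" "X \<in> Obj C"
  shows "iso_arrow C (a X)" "a X \<in> Arr C" "Dom C (a X) = X" "Cod C (a X) = X"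
  using assms nat_isosD[of a id_endo id_endo] by (simp_all add: carrier_Z)

lemma Z_natural: "\<lbrakk>a \<in> carrier Z; f \<in> Arr C\<rbrakk> \<Longrightarrow> a (Cod C f) \<cdot> f = f \<cdot> a (Dom C f)"
  using naturality[of a id_endo id_endo] by (simp add: carrier_Z)

lemma Z_ext: "\<lbrakk>a \<in> carrier Z; b \<in> carrier Z; \<And>X. X \<in> Obj C \<Longrightarrow> a X = b X\<rbrakk> \<Longrightarrow> a = b"
  unfolding carrier_Z by (rule nat_isos_ext)

lemma Z_mult [simp]: "X \<in> Obj C \<Longrightarrow> (a \<otimes>\<^bsub>Z\<^esub> b) X = a X \<cdot> b X"
  and Z_one [simp]: "X \<in> Obj C \<Longrightarrow> \<one>\<^bsub>Z\<^esub> X = Ide C X"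
  by (simp_all add: center_units_def)

lemma Z_mult_closed: "\<lbrakk>a \<in> carrier Z; b \<in> carrier Z\<rbrakk> \<Longrightarrow> a \<otimes>\<^bsub>Z\<^esub> b \<in> carrier Z"
  using nat_isos_comp[of id_endo id_endo id_endo b a]
  by (simp add: carrier_Z) (simp add: center_units_def)

lemma Z_one_closed: "\<one>\<^bsub>Z\<^esub> \<in> carrier Z"
  unfolding carrier_Z by (simp add: center_units_def nat_isosI)

lemma comm_group_Z: "comm_group Z"
proof (rule comm_groupI)
  fix a b c assume a: "a \<in> carrier Z" and b: "b \<in> carrier Z" and c: "c \<in> carrier Z"
  show "a \<otimes>\<^bsub>Z\<^esub> b \<otimes>\<^bsub>Z\<^esub> c = a \<otimes>\<^bsub>Z\<^esub> (b \<otimes>\<^bsub>Z\<^esub> c)"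
    by (rule Z_ext) (use a b c in \<open>simp_all add: Z_mult_closed comp_assoc\<close>)
next
  fix a b assume a: "a \<in> carrier Z" and b: "b \<in> carrier Z"
  show "a \<otimes>\<^bsub>Z\<^esub> b = b \<otimes>\<^bsub>Z\<^esub> a"
  proof (rule Z_ext)
    fix X assume "X \<in> Obj C"
    \<comment> \<open>Commutativity is naturality of \<open>a\<close> at the endomorphism
      \<open>b X\<close>.\<close>
    then show "(a \<otimes>\<^bsub>Z\<^esub> b) X = (b \<otimes>\<^bsub>Z\<^esub> a) X" using Z_natural[OF a, of "b X"] a b by simp
  qed (use a b in \<open>simp_all add: Z_mult_closed\<close>)
next
  fix a assume a: "a \<in> carrier Z"
  show "\<one>\<^bsub>Z\<^esub> \<otimes>\<^bsub>Z\<^esub> a = a"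
    by (rule Z_ext) (use a in \<open>simp_all add: Z_mult_closed Z_one_closed\<close>)
  have a': "(\<lambda>X \<in> Obj C. inv_arr (a X)) \<in> carrier Z"
    using a nat_isos_inv[of id_endo id_endo a] by (simp add: carrier_Z)
  moreover have "(\<lambda>X \<in> Obj C. inv_arr (a X)) \<otimes>\<^bsub>Z\<^esub> a = \<one>\<^bsub>Z\<^esub>"
    by (rule Z_ext) (use a in \<open>simp_all add: Z_mult_closed[OF a'] Z_one_closed\<close>)
  ultimately show "\<exists>a' \<in> carrier Z. a' \<otimes>\<^bsub>Z\<^esub> a = \<one>\<^bsub>Z\<^esub>" by blast
qed (simp_all add: Z_mult_closed Z_one_closed)

sublocale Z: comm_group Z
  by (rule comm_group_Z)

text \<open>The action of the centre on single arrows commutes with composition on either side, and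
  through \<open>\<rho>\<close> with functors; this replaces all manipulations of components by equational reasoning.\<close>

definition act :: "('o \<Rightarrow> 'm) \<Rightarrow> 'm \<Rightarrow> 'm"  (infixr \<open>\<star>\<close> 65) where
  "a \<star> f = a (Cod C f) \<cdot> f"

lemma act_simps [simp]:
  assumes "a \<in> carrier Z" "f \<in> Arr C"
  shows "a \<star> f \<in> Arr C" "Dom C (a \<star> f) = Dom C f" "Cod C (a \<star> f) = Cod C f"
  using assms by (simp_all add: act_def)

lemma iso_act [simp]: "\<lbrakk>a \<in> carrier Z; iso_arrow C f\<rbrakk> \<Longrightarrow> iso_arrow C (a \<star> f)"
  by (simp add: act_def)

lemma act_one [simp]: "f \<in> Arr C \<Longrightarrow> \<one>\<^bsub>Z\<^esub> \<star> f = f"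
  by (simp add: act_def)

lemma act_act [simp]: "\<lbrakk>a \<in> carrier Z; b \<in> carrier Z; f \<in> Arr C\<rbrakk> \<Longrightarrow> a \<star> b \<star> f = (a \<otimes>\<^bsub>Z\<^esub> b) \<star> f"
  by (simp add: act_def comp_assoc)

lemma act_comp [simp]:
  "\<lbrakk>a \<in> carrier Z; f \<in> Arr C; g \<in> Arr C; Dom C g = Cod C f\<rbrakk> \<Longrightarrow> (a \<star> g) \<cdot> f = a \<star> (g \<cdot> f)"
  by (simp add: act_def comp_assoc)

text \<open>Naturality of \<open>a\<close> at \<open>g\<close> moves its component from the domain
  of \<open>g\<close> to the codomain.\<close>

lemma comp_act [simp]:
  assumes "a \<in> carrier Z" "f \<in> Arr C" "g \<in> Arr C" "Dom C g = Cod C f"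
  shows "g \<cdot> (a \<star> f) = a \<star> (g \<cdot> f)"
proof -
  have "g \<cdot> (a \<star> f) = (g \<cdot> a (Dom C g)) \<cdot> f" using assms by (simp add: act_def comp_assoc)
  also have "\<dots> = (a (Cod C g) \<cdot> g) \<cdot> f" using assms by (simp add: Z_natural)
  also have "\<dots> = a \<star> (g \<cdot> f)" using assms by (simp add: act_def comp_assoc)
  finally show ?thesis .
qed

lemma act_cancel:
  assumes "a \<in> carrier Z" "b \<in> carrier Z" "iso_arrow C f" "a \<star> f = b \<star> f"
  shows "a (Cod C f) = b (Cod C f)"
  using iso_cancel_right[of f "a (Cod C f)" "b (Cod C f)"] assms by (simp add: act_def)

lemma autoequivalence_endo [simp]: "autoequivalence C F \<Longrightarrow> endofunctor C F"
  by (simp add: autoequivalence_def)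

section \<open>Auto-equivalences: simple transitivity and the induced action on the centre\<close>

text \<open>Essential surjectivity: every \<open>Y\<close> is isomorphic to some
  \<open>F (F' Y)\<close> through \<open>\<epsilon>\<close>, and naturality along
  \<open>\<epsilon> Y\<close> determines the component at \<open>Y\<close> from the one at the image
  object.\<close>

lemma center_eqI_autoequivalence:
  assumes F: "autoequivalence C F" and a: "a \<in> carrier Z" and b: "b \<in> carrier Z"
    and eq: "\<And>X. X \<in> Obj C \<Longrightarrow> a (on_obj F X) = b (on_obj F X)"
  shows "a = b"
proof -
  obtain F' \<epsilon> where F': "endofunctor C F'" and \<epsilon>: "\<epsilon> \<in> nat_isos C (F \<circ>\<^sub>F F') id_endo"
    using F unfolding autoequivalence_def nat_isomorphic_def by blast
  show ?thesis
  proof (rule Z_ext[OF a b])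
    fix Y assume Y: "Y \<in> Obj C"
    note [simp] = nat_simps[OF \<epsilon>] F F' Y a b
    have "a \<star> \<epsilon> Y = \<epsilon> Y \<cdot> a (on_obj F (on_obj F' Y))"
      using Z_natural[OF a, of "\<epsilon> Y"] by (simp add: act_def)
    also have "\<dots> = \<epsilon> Y \<cdot> b (on_obj F (on_obj F' Y))"
      by (simp add: eq)
    also have "\<dots> = b \<star> \<epsilon> Y"
      using Z_natural[OF b, of "\<epsilon> Y"] by (simp add: act_def)
    finally show "a Y = b Y" using act_cancel[of a b "\<epsilon> Y"] by simp
  qed
qed

text \<open>The existence half of the fact that automorphisms of \<open>F\<close> are central
  elements. Since \<open>\<epsilon>\<close> and \<open>\<eta>\<close> are chosen independently, the
  required equation is first proved at objects \<open>F' Y\<close> and then spread to all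
  objects.\<close>

lemma automorphism_of_autoequivalence:
  assumes F: "autoequivalence C F" and \<phi>: "\<phi> \<in> nat_isos C F F"
  shows "\<exists>a \<in> carrier Z. \<forall>X \<in> Obj C. \<phi> X = a (on_obj F X)"
proof -
  obtain F' \<epsilon> \<eta> where F': "endofunctor C F'" and \<epsilon>: "\<epsilon> \<in> nat_isos C (F \<circ>\<^sub>F F') id_endo"
    and \<eta>: "\<eta> \<in> nat_isos C (F' \<circ>\<^sub>F F) id_endo"
    using F unfolding autoequivalence_def nat_isomorphic_def by blast
  note [simp] = nat_simps[OF \<epsilon>] nat_simps[OF \<eta>] nat_simps[OF \<phi>] F F'
  \<comment> \<open>The whiskering of \<open>\<phi>\<close> with \<open>F'\<close> is an
    automorphism of \<open>F \<circ> F'\<close>; conjugation by \<open>\<epsilon>\<close> turns it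
    into one of the identity functor.\<close>
  define a where "a = (\<lambda>Y \<in> Obj C. \<epsilon> Y \<cdot> (\<phi> (on_obj F' Y) \<cdot> inv_arr (\<epsilon> Y)))"
  have a: "a \<in> carrier Z"
    unfolding a_def carrier_Z
  proof (rule nat_isosI)
    fix f assume f: "f \<in> Arr C"
    let ?X = "Dom C f" and ?Y = "Cod C f" and ?g = "on_arr F (on_arr F' f)"
    have nat: "\<epsilon> ?Y \<cdot> ?g = f \<cdot> \<epsilon> ?X" using naturality[OF \<epsilon> f] by simp
    \<comment> \<open>An arbitrary arrow is the conjugate under \<open>\<epsilon>\<close> of its
      image under \<open>F \<circ> F'\<close>, so naturality of \<open>\<phi>\<close> at
      \<open>F' f\<close> gives that of \<open>a\<close> at \<open>f\<close>.\<close>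
    have "f = f \<cdot> \<epsilon> ?X \<cdot> inv_arr (\<epsilon> ?X)" using f by (simp add: comp_assoc)
    also have "\<dots> = \<epsilon> ?Y \<cdot> (?g \<cdot> inv_arr (\<epsilon> ?X))"
      unfolding nat[symmetric] using f by (simp add: comp_assoc)
    finally have f': "f = \<epsilon> ?Y \<cdot> (?g \<cdot> inv_arr (\<epsilon> ?X))" .
    have "\<epsilon> ?Y \<cdot> (\<phi> (on_obj F' ?Y) \<cdot> inv_arr (\<epsilon> ?Y)) \<cdot> f
        = \<epsilon> ?Y \<cdot> (\<phi> (on_obj F' ?Y) \<cdot> inv_arr (\<epsilon> ?Y)) \<cdot> (\<epsilon> ?Y \<cdot> (?g \<cdot> inv_arr (\<epsilon> ?X)))"
      by (rule arg_cong[OF f'])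
    also have "\<dots> = \<epsilon> ?Y \<cdot> ((\<phi> (Cod C (on_arr F' f)) \<cdot> ?g) \<cdot> inv_arr (\<epsilon> ?X))"
      using f by (simp add: comp_assoc)
    also have "\<dots> = \<epsilon> ?Y \<cdot> ?g \<cdot> (\<phi> (on_obj F' ?X) \<cdot> inv_arr (\<epsilon> ?X))"
      using f naturality[OF \<phi>, of "on_arr F' f"] by (simp add: comp_assoc)
    also have "\<epsilon> ?Y \<cdot> ?g = f \<cdot> \<epsilon> ?X" by (rule nat)
    also have "f \<cdot> \<epsilon> ?X \<cdot> (\<phi> (on_obj F' ?X) \<cdot> inv_arr (\<epsilon> ?X)) =
        f \<cdot> (\<epsilon> ?X \<cdot> (\<phi> (on_obj F' ?X) \<cdot> inv_arr (\<epsilon> ?X)))"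
      using f by (simp add: comp_assoc)
    finally show "\<epsilon> ?Y \<cdot> (\<phi> (on_obj F' ?Y) \<cdot> inv_arr (\<epsilon> ?Y)) \<cdot> on_arr id_endo f =
        on_arr id_endo f \<cdot> (\<epsilon> ?X \<cdot> (\<phi> (on_obj F' ?X) \<cdot> inv_arr (\<epsilon> ?X)))"
      by simp
  qed simp_all
  \<comment> \<open>The case \<open>X = F' Y\<close>: naturality of \<open>a\<close> at
    \<open>\<epsilon> Y\<close> undoes the conjugation.\<close>
  have a_FF': "a (on_obj F (on_obj F' Y)) = \<phi> (on_obj F' Y)" if Y: "Y \<in> Obj C" for Y
  proof (rule iso_cancel_left[of "\<epsilon> Y"])
    have "\<epsilon> Y \<cdot> a (on_obj F (on_obj F' Y)) = a Y \<cdot> \<epsilon> Y"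
      using Z_natural[OF a, of "\<epsilon> Y"] Y by simp
    also have "\<dots> = \<epsilon> Y \<cdot> \<phi> (on_obj F' Y)" using Y by (simp add: a_def comp_assoc)
    finally show "\<epsilon> Y \<cdot> a (on_obj F (on_obj F' Y)) = \<epsilon> Y \<cdot> \<phi> (on_obj F' Y)" .
  qed (use Y a in simp_all)
  \<comment> \<open>For general \<open>X\<close>, both \<open>\<phi>\<close> and \<open>a\<close>
    are natural along \<open>F (\<eta> X)\<close>, which starts at the image of an object of the
    form \<open>F' Y\<close> with \<open>Y = F X\<close>.\<close>
  have "\<phi> X = a (on_obj F X)" if X: "X \<in> Obj C" for X
  proof (rule iso_cancel_right[of "on_arr F (\<eta> X)"])
    have "\<phi> X \<cdot> on_arr F (\<eta> X) = on_arr F (\<eta> X) \<cdot> \<phi> (on_obj F' (on_obj F X))"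
      using naturality[OF \<phi>, of "\<eta> X"] X by simp
    also have "\<dots> = on_arr F (\<eta> X) \<cdot> a (on_obj F (on_obj F' (on_obj F X)))"
      using X by (simp add: a_FF')
    also have "\<dots> = a (on_obj F X) \<cdot> on_arr F (\<eta> X)"
      using Z_natural[OF a, of "on_arr F (\<eta> X)"] X by simp
    finally show "\<phi> X \<cdot> on_arr F (\<eta> X) = a (on_obj F X) \<cdot> on_arr F (\<eta> X)" .
  qed (use X a in simp_all)
  then show ?thesis using a by blast
qed

lemma nat_isos_act:
  assumes E: "endofunctor C E" and F: "endofunctor C F" and \<phi>: "\<phi> \<in> nat_isos C E F" and a: "a \<in> carrier Z"
  shows "(\<lambda>X \<in> Obj C. a \<star> \<phi> X) \<in> nat_isos C E F"
proof (rule nat_isosI)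
  note [simp] = nat_isosD[OF \<phi>] E F a
  fix f assume f: "f \<in> Arr C"
  then show "(a \<star> \<phi> (Cod C f)) \<cdot> on_arr E f = on_arr F f \<cdot> (a \<star> \<phi> (Dom C f))" by simp
qed (simp_all add: nat_isosD[OF \<phi>] a)

text \<open>The element is found by applying the description of automorphisms of \<open>F\<close> to
  \<open>\<psi>\<close> composed with the inverse of \<open>\<phi>\<close>.\<close>

lemma nat_isos_transitive:
  assumes E: "endofunctor C E" and F: "autoequivalence C F"
    and \<phi>: "\<phi> \<in> nat_isos C E F" and \<psi>: "\<psi> \<in> nat_isos C E F"
  shows "\<exists>a \<in> carrier Z. \<forall>X \<in> Obj C. \<psi> X = a \<star> \<phi> X"
proof -
  note [simp] = nat_simps[OF \<phi>] nat_simps[OF \<psi>] E F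
  have "(\<lambda>X \<in> Obj C. inv_arr (\<phi> X)) \<in> nat_isos C F E"
    using nat_isos_inv[OF E _ \<phi>] by simp
  from nat_isos_comp[OF _ _ _ this \<psi>]
  have "(\<lambda>X \<in> Obj C. \<psi> X \<cdot> (\<lambda>X \<in> Obj C. inv_arr (\<phi> X)) X) \<in> nat_isos C F F" by simp
  from automorphism_of_autoequivalence[OF F this]
  obtain a where a: "a \<in> carrier Z" "\<And>X. X \<in> Obj C \<Longrightarrow> \<psi> X \<cdot> inv_arr (\<phi> X) = a (on_obj F X)"
    by auto
  have "\<psi> X = a \<star> \<phi> X" if X: "X \<in> Obj C" for X
  proof -
    have "\<psi> X = (\<psi> X \<cdot> inv_arr (\<phi> X)) \<cdot> \<phi> X"
      using X by (simp add: comp_assoc del: comp_inv_arr)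
    then show ?thesis using X by (simp add: a act_def)
  qed
  then show ?thesis using a(1) by blast
qed

lemma nat_isos_free:
  assumes F: "autoequivalence C F" and \<phi>: "\<phi> \<in> nat_isos C E F"
    and a: "a \<in> carrier Z" and b: "b \<in> carrier Z"
    and eq: "\<And>X. X \<in> Obj C \<Longrightarrow> a \<star> \<phi> X = b \<star> \<phi> X"
  shows "a = b"
  by (rule center_eqI_autoequivalence[OF F a b])
    (use act_cancel[OF a b nat_iso[OF \<phi>] eq] nat_Cod[OF \<phi>] in simp)

text \<open>The formula of \<open>center_action\<close> for one endofunctor instead of a family, so
  that different members of a family, and different families, can be compared.\<close>

definition center_endo :: "('o, 'm) endo \<Rightarrow> ('o \<Rightarrow> 'm) \<Rightarrow> ('o \<Rightarrow> 'm)" where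
  "center_endo F a =
     (THE b. b \<in> carrier Z \<and> (\<forall>X \<in> Obj C. b (on_obj F X) = on_arr F (a X)))"

lemma center_endo_unique:
  assumes F: "autoequivalence C F" and b: "b \<in> carrier Z"
    and eq: "\<And>X. X \<in> Obj C \<Longrightarrow> b (on_obj F X) = on_arr F (a X)"
  shows "center_endo F a = b"
  unfolding center_endo_def
proof (rule the_equality)
  show "b \<in> carrier Z \<and> (\<forall>X \<in> Obj C. b (on_obj F X) = on_arr F (a X))" using b eq by blast
  fix b' assume "b' \<in> carrier Z \<and> (\<forall>X \<in> Obj C. b' (on_obj F X) = on_arr F (a X))"
  then show "b' = b" using center_eqI_autoequivalence[OF F _ b] eq by simp
qed

text \<open>Applying \<open>F\<close> to the components of \<open>a\<close> gives an automorphism of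
  \<open>F\<close>, hence one coming from a central element.\<close>

lemma center_endo:
  assumes F: "autoequivalence C F" and a: "a \<in> carrier Z"
  shows center_endo_closed [simp]: "center_endo F a \<in> carrier Z"
    and center_endo_apply: "X \<in> Obj C \<Longrightarrow> center_endo F a (on_obj F X) = on_arr F (a X)"
proof -
  have "(\<lambda>X \<in> Obj C. on_arr F (a X)) \<in> nat_isos C F F"
  proof (rule nat_isosI)
    fix f assume f: "f \<in> Arr C"
    have "on_arr F (a (Cod C f)) \<cdot> on_arr F f = on_arr F (a (Cod C f) \<cdot> f)"
      using f F a by simp
    also have "\<dots> = on_arr F f \<cdot> on_arr F (a (Dom C f))"
      unfolding Z_natural[OF a f] using f F a by simp
    finally show "on_arr F (a (Cod C f)) \<cdot> on_arr F f = on_arr F f \<cdot> on_arr F (a (Dom C f))" .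
  qed (use F a in simp_all)
  from automorphism_of_autoequivalence[OF F this] obtain b where b: "b \<in> carrier Z"
    and eq: "\<And>X. X \<in> Obj C \<Longrightarrow> b (on_obj F X) = on_arr F (a X)"
    by force
  have "center_endo F a = b" by (rule center_endo_unique[OF F b eq])
  then show "center_endo F a \<in> carrier Z"
    and "X \<in> Obj C \<Longrightarrow> center_endo F a (on_obj F X) = on_arr F (a X)"
    using b eq by simp_all
qed

lemma on_arr_act [simp]:
  "\<lbrakk>autoequivalence C F; a \<in> carrier Z; f \<in> Arr C\<rbrakk> \<Longrightarrow> on_arr F (a \<star> f) = center_endo F a \<star> on_arr F f"
  by (simp add: act_def center_endo_apply)

lemma center_endo_hom:
  assumes F: "autoequivalence C F"
  shows "center_endo F \<in> hom Z Z"
proof (rule homI)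
  fix a b assume "a \<in> carrier Z" "b \<in> carrier Z"
  then show "center_endo F (a \<otimes>\<^bsub>Z\<^esub> b) = center_endo F a \<otimes>\<^bsub>Z\<^esub> center_endo F b"
    using F by (intro center_endo_unique[OF F]) (simp_all add: center_endo_apply)
qed (use F in simp)

text \<open>Isomorphic functors induce the same map on the centre. Three instances are used:
  \<open>F g \<circ> F h -> F (g h)\<close> makes \<open>\<rho>\<close> multiplicative,
  \<open>id -> F 1\<close> makes it unital, and \<open>F g -> F' g\<close> makes it independent of
  the representatives.\<close>

lemma center_endo_transport:
  assumes H: "autoequivalence C H" and F: "endofunctor C F" and \<phi>: "\<phi> \<in> nat_isos C F H"
    and a: "a \<in> carrier Z" and b: "b \<in> carrier Z"
    and eq: "\<And>X. X \<in> Obj C \<Longrightarrow> b (on_obj F X) = on_arr F (a X)"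
  shows "center_endo H a = b"
proof (rule center_endo_unique[OF H b])
  fix X assume X: "X \<in> Obj C"
  note [simp] = nat_simps[OF \<phi>] F H a b X
  show "b (on_obj H X) = on_arr H (a X)"
  proof (rule iso_cancel_right[of "\<phi> X"])
    have "b (on_obj H X) \<cdot> \<phi> X = \<phi> X \<cdot> b (on_obj F X)"
      using Z_natural[OF b, of "\<phi> X"] by simp
    also have "\<dots> = on_arr H (a X) \<cdot> \<phi> X"
      using naturality[OF \<phi>, of "a X"] by (simp add: eq)
    finally show "b (on_obj H X) \<cdot> \<phi> X = on_arr H (a X) \<cdot> \<phi> X" .
  qed simp_all
qed

text \<open>Five faces of the diagram carry one central factor each; the remaining face
  \<open>k \<cdot> y = l \<cdot> p\<close> commutes exactly. Both ways around start at
  \<open>r \<cdot> (q \<cdot> p)\<close> and end at \<open>u \<cdot> (w \<cdot> y)\<close>. With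
  abstract arrows, only their endpoints have to be checked in the application.\<close>

lemma pentagon:
  assumes a: "a1 \<in> carrier Z" "a2 \<in> carrier Z" "a3 \<in> carrier Z" "a4 \<in> carrier Z" "a5 \<in> carrier Z"
    and p: "p \<in> Hom_set C A B" and q: "q \<in> Hom_set C B D" and r: "r \<in> Hom_set C D E"
    and s: "s \<in> Hom_set C B' D" and t: "t \<in> Hom_set C A B'"
    and u: "u \<in> Hom_set C D' E" and v: "v \<in> Hom_set C B' D'" and w: "w \<in> Hom_set C K D'"
    and y: "y \<in> Hom_set C A K" and z: "z \<in> Hom_set C L E" and k: "k \<in> Hom_set C K L"
    and l: "l \<in> Hom_set C B L"
    and st: "a1 \<star> (q \<cdot> p) = s \<cdot> t" and uv: "a2 \<star> (r \<cdot> s) = u \<cdot> v" and wy: "a3 \<star> (v \<cdot> t) = w \<cdot> y"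
    and zl: "a4 \<star> (r \<cdot> q) = z \<cdot> l" and uw: "a5 \<star> (z \<cdot> k) = u \<cdot> w" and ky: "k \<cdot> y = l \<cdot> p"
  shows "(a3 \<otimes>\<^bsub>Z\<^esub> a2 \<otimes>\<^bsub>Z\<^esub> a1) \<star> (r \<cdot> (q \<cdot> p)) = (a4 \<otimes>\<^bsub>Z\<^esub> a5) \<star> (r \<cdot> (q \<cdot> p))"
proof -
  note [simp] = a p[unfolded Hom_iff] q[unfolded Hom_iff] r[unfolded Hom_iff] s[unfolded Hom_iff]
    t[unfolded Hom_iff] u[unfolded Hom_iff] v[unfolded Hom_iff] w[unfolded Hom_iff]
    y[unfolded Hom_iff] z[unfolded Hom_iff] k[unfolded Hom_iff] l[unfolded Hom_iff]
  have "(a3 \<otimes>\<^bsub>Z\<^esub> a2 \<otimes>\<^bsub>Z\<^esub> a1) \<star> (r \<cdot> (q \<cdot> p)) = a3 \<star> a2 \<star> (r \<cdot> (a1 \<star> (q \<cdot> p)))"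
    by (simp add: Z.m_assoc)
  also have "\<dots> = a3 \<star> ((a2 \<star> (r \<cdot> s)) \<cdot> t)"
    unfolding st by (simp add: comp_assoc)
  also have "\<dots> = u \<cdot> (a3 \<star> (v \<cdot> t))"
    unfolding uv by (simp add: comp_assoc)
  also have "\<dots> = (a5 \<star> (z \<cdot> k)) \<cdot> y"
    unfolding wy uw by (simp add: comp_assoc)
  also have "\<dots> = a5 \<star> (z \<cdot> (k \<cdot> y))"
    by (simp add: comp_assoc)
  also have "\<dots> = a5 \<star> ((a4 \<star> (r \<cdot> q)) \<cdot> p)"
    unfolding ky zl by (simp add: comp_assoc)
  also have "\<dots> = (a4 \<otimes>\<^bsub>Z\<^esub> a5) \<star> (r \<cdot> (q \<cdot> p))"
    by (simp add: comp_assoc Z.m_comm)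
  finally show ?thesis .
qed

end

section \<open>Gerbal actions\<close>

locale gerbal = category C + G: group G
  for C :: "('o, 'm) cat" (structure) and G :: "('g, 'b) monoid_scheme" (structure) +
  fixes F :: "'g \<Rightarrow> ('o, 'm) endo"
  assumes gerbal_action: "gerbal_action G C F"
begin

abbreviation "K \<equiv> compositors G C F"
abbreviation "\<alpha> \<equiv> associator G C F"
abbreviation "left \<equiv> left_path G C F"
abbreviation "right \<equiv> right_path G C F"

lemma F_auto [simp]: "g \<in> carrier G \<Longrightarrow> autoequivalence C (F g)"
  using gerbal_action by (simp add: gerbal_action_def)

lemma compositors_exist: "K \<noteq> {}"
  using gerbal_action unfolding gerbal_action_def nat_isomorphic_def compositors_def PiE_eq_empty_iff
  by auto

lemma center_action_eq: "center_action C F g = center_endo (F g)"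
  by (simp add: center_action_def center_endo_def fun_eq_iff)

lemma compositor_nat:
  assumes "c \<in> K" "g \<in> carrier G" "h \<in> carrier G"
  shows "c (g, h) \<in> nat_isos C (F g \<circ>\<^sub>F F h) (F (g \<otimes>\<^bsub>G\<^esub> h))"
  using PiE_mem[OF assms(1)[unfolded compositors_def], of "(g, h)"] assms(2,3) by simp

sublocale M: group_module G Z "center_action C F"
proof unfold_locales
  show "center_action C F g \<in> hom Z Z" if "g \<in> carrier G" for g
    using that by (simp add: center_action_eq center_endo_hom)
  fix g h a assume gh: "g \<in> carrier G" "h \<in> carrier G" and a: "a \<in> carrier Z"
  \<comment> \<open>Any compositor serves to identify \<open>F g \<circ> F h\<close> with
    \<open>F (g \<otimes> h)\<close>, because the induced map on the centre depends only on the
    isomorphism class of the functor.\<close>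
  obtain c where c: "c \<in> K" using compositors_exist by blast
  show "center_action C F (g \<otimes>\<^bsub>G\<^esub> h) a = center_action C F g (center_action C F h a)"
    unfolding center_action_eq
    by (rule center_endo_transport[OF _ _ compositor_nat[OF c gh] a])
      (use gh a in \<open>simp_all add: center_endo_apply\<close>)
qed

declare on_arr_act [simp del]

text \<open>Takes over from \<open>on_arr_act\<close> as rewrite rule, so that functors produce
  \<open>center_action C F g\<close>, the action under which the centre is a module in
  \<open>M\<close>.\<close>

lemma on_arr_F_act [simp]:
  "\<lbrakk>g \<in> carrier G; a \<in> carrier Z; f \<in> Arr C\<rbrakk>
    \<Longrightarrow> on_arr (F g) (a \<star> f) = center_action C F g a \<star> on_arr (F g) f"
  by (simp add: center_action_eq on_arr_act)

lemma compositor_simps [simp]: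
  assumes "c \<in> K" "g \<in> carrier G" "h \<in> carrier G" "X \<in> Obj C"
  shows "iso_arrow C (c (g, h) X)" "c (g, h) X \<in> Arr C"
    "Dom C (c (g, h) X) = on_obj (F g) (on_obj (F h) X)" "Cod C (c (g, h) X) = on_obj (F (g \<otimes>\<^bsub>G\<^esub> h)) X"
  using nat_simps[OF compositor_nat[OF assms(1-3)] assms(4)] by simp_all

lemma compositor_natural:
  assumes "c \<in> K" "g \<in> carrier G" "h \<in> carrier G" "f \<in> Arr C"
  shows "c (g, h) (Cod C f) \<cdot> on_arr (F g) (on_arr (F h) f) = on_arr (F (g \<otimes>\<^bsub>G\<^esub> h)) f \<cdot> c (g, h) (Dom C f)"
  using naturality[OF compositor_nat[OF assms(1-3)] assms(4)] by simp

lemma compositorsI: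
  assumes "\<And>g h. \<lbrakk>g \<in> carrier G; h \<in> carrier G\<rbrakk> \<Longrightarrow> c g h \<in> nat_isos C (F g \<circ>\<^sub>F F h) (F (g \<otimes>\<^bsub>G\<^esub> h))"
  shows "(\<lambda>(g, h) \<in> carrier G \<times> carrier G. c g h) \<in> K"
  unfolding compositors_def by (rule PiE_I) (use assms in auto)

lemma compositors_ext:
  assumes c: "c \<in> K" and c': "c' \<in> K"
    and eq: "\<And>g h X. \<lbrakk>g \<in> carrier G; h \<in> carrier G; X \<in> Obj C\<rbrakk> \<Longrightarrow> c (g, h) X = c' (g, h) X"
  shows "c = c'"
proof (rule PiE_ext[OF c[unfolded compositors_def] c'[unfolded compositors_def]])
  fix x assume "x \<in> carrier G \<times> carrier G"
  then obtain g h where x: "x = (g, h)" "g \<in> carrier G" "h \<in> carrier G" by blast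
  show "c x = c' x"
    unfolding x(1) by (rule nat_isos_ext[OF compositor_nat compositor_nat]) (use c c' x eq in simp_all)
qed

section \<open>The associator and its cocycle identity\<close>

text \<open>The target is bracketed to the right although the path ends at the left bracketing: both
  paths then lie in one set of isomorphisms, on which the centre acts simply transitively.\<close>

lemma left_nat:
  assumes c: "c \<in> K" and g: "g1 \<in> carrier G" "g2 \<in> carrier G" "g3 \<in> carrier G"
  shows "(\<lambda>X \<in> Obj C. left c g1 g2 g3 X)
    \<in> nat_isos C (F g1 \<circ>\<^sub>F F g2 \<circ>\<^sub>F F g3) (F (g1 \<otimes>\<^bsub>G\<^esub> (g2 \<otimes>\<^bsub>G\<^esub> g3)))"
proof (rule nat_isosI)
  note [simp] = c g
  fix f assume f: "f \<in> Arr C"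
  let ?X = "Dom C f" and ?Y = "Cod C f"
  have "left c g1 g2 g3 ?Y \<cdot> on_arr (F g1 \<circ>\<^sub>F F g2 \<circ>\<^sub>F F g3) f
      = c (g1 \<otimes>\<^bsub>G\<^esub> g2, g3) ?Y \<cdot> (c (g1, g2) (Cod C (on_arr (F g3) f)) \<cdot> on_arr (F g1) (on_arr (F g2) (on_arr (F g3) f)))"
    using f by (simp add: left_path_def comp_assoc)
  also have "\<dots> = (c (g1 \<otimes>\<^bsub>G\<^esub> g2, g3) ?Y \<cdot> on_arr (F (g1 \<otimes>\<^bsub>G\<^esub> g2)) (on_arr (F g3) f)) \<cdot> c (g1, g2) (on_obj (F g3) ?X)"
    unfolding compositor_natural[OF c g(1,2) endo_Arr[OF autoequivalence_endo[OF F_auto[OF g(3)]] f]]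
    using f by (simp add: comp_assoc)
  also have "\<dots> = on_arr (F (g1 \<otimes>\<^bsub>G\<^esub> (g2 \<otimes>\<^bsub>G\<^esub> g3))) f \<cdot> left c g1 g2 g3 ?X"
    unfolding compositor_natural[OF c G.m_closed[OF g(1,2)] g(3) f]
    using f by (simp add: left_path_def comp_assoc G.m_assoc)
  finally show "left c g1 g2 g3 ?Y \<cdot> on_arr (F g1 \<circ>\<^sub>F F g2 \<circ>\<^sub>F F g3) f
      = on_arr (F (g1 \<otimes>\<^bsub>G\<^esub> (g2 \<otimes>\<^bsub>G\<^esub> g3))) f \<cdot> left c g1 g2 g3 ?X" .
qed (use c g in \<open>simp_all add: left_path_def G.m_assoc\<close>)

lemma right_nat:
  assumes c: "c \<in> K" and g: "g1 \<in> carrier G" "g2 \<in> carrier G" "g3 \<in> carrier G"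
  shows "(\<lambda>X \<in> Obj C. right c g1 g2 g3 X)
    \<in> nat_isos C (F g1 \<circ>\<^sub>F F g2 \<circ>\<^sub>F F g3) (F (g1 \<otimes>\<^bsub>G\<^esub> (g2 \<otimes>\<^bsub>G\<^esub> g3)))"
proof (rule nat_isosI)
  note [simp] = c g
  fix f assume f: "f \<in> Arr C"
  let ?X = "Dom C f" and ?Y = "Cod C f"
  have "right c g1 g2 g3 ?Y \<cdot> on_arr (F g1 \<circ>\<^sub>F F g2 \<circ>\<^sub>F F g3) f
      = c (g1, g2 \<otimes>\<^bsub>G\<^esub> g3) ?Y \<cdot> on_arr (F g1) (c (g2, g3) ?Y \<cdot> on_arr (F g2) (on_arr (F g3) f))"
    using f by (simp add: right_path_def comp_assoc)
  also have "\<dots> = (c (g1, g2 \<otimes>\<^bsub>G\<^esub> g3) ?Y \<cdot> on_arr (F g1) (on_arr (F (g2 \<otimes>\<^bsub>G\<^esub> g3)) f)) \<cdot> on_arr (F g1) (c (g2, g3) ?X)"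
    unfolding compositor_natural[OF c g(2,3) f]
    using f by (simp add: comp_assoc)
  also have "\<dots> = on_arr (F (g1 \<otimes>\<^bsub>G\<^esub> (g2 \<otimes>\<^bsub>G\<^esub> g3))) f \<cdot> right c g1 g2 g3 ?X"
    unfolding compositor_natural[OF c g(1) G.m_closed[OF g(2,3)] f]
    using f by (simp add: right_path_def comp_assoc)
  finally show "right c g1 g2 g3 ?Y \<cdot> on_arr (F g1 \<circ>\<^sub>F F g2 \<circ>\<^sub>F F g3) f
      = on_arr (F (g1 \<otimes>\<^bsub>G\<^esub> (g2 \<otimes>\<^bsub>G\<^esub> g3))) f \<cdot> right c g1 g2 g3 ?X" .
qed (use c g in \<open>simp_all add: right_path_def\<close>)

lemma path_simps [simp]:
  assumes "c \<in> K" "g1 \<in> carrier G" "g2 \<in> carrier G" "g3 \<in> carrier G" "X \<in> Obj C"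
  shows "iso_arrow C (left c g1 g2 g3 X)" "left c g1 g2 g3 X \<in> Arr C"
    "Dom C (left c g1 g2 g3 X) = on_obj (F g1) (on_obj (F g2) (on_obj (F g3) X))"
    "Cod C (left c g1 g2 g3 X) = on_obj (F (g1 \<otimes>\<^bsub>G\<^esub> (g2 \<otimes>\<^bsub>G\<^esub> g3))) X"
    "right c g1 g2 g3 X \<in> Arr C"
    "Dom C (right c g1 g2 g3 X) = on_obj (F g1) (on_obj (F g2) (on_obj (F g3) X))"
    "Cod C (right c g1 g2 g3 X) = on_obj (F (g1 \<otimes>\<^bsub>G\<^esub> (g2 \<otimes>\<^bsub>G\<^esub> g3))) X"
  using nat_simps[OF left_nat[OF assms(1-4)] assms(5)] nat_simps[OF right_nat[OF assms(1-4)] assms(5)]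
    assms(5) by simp_all

lemma associator_unique:
  assumes c: "c \<in> K" and g: "g1 \<in> carrier G" "g2 \<in> carrier G" "g3 \<in> carrier G"
    and a: "a \<in> carrier Z"
    and eq: "\<And>X. X \<in> Obj C \<Longrightarrow> a \<star> left c g1 g2 g3 X = right c g1 g2 g3 X"
  shows "\<alpha> c [g1, g2, g3] = a"
proof -
  have "\<alpha> c [g1, g2, g3] = (THE a. a \<in> carrier Z \<and>
      (\<forall>X \<in> Obj C. a \<star> left c g1 g2 g3 X = right c g1 g2 g3 X))"
    using c g by (simp add: associator_def tuples_def act_def G.m_assoc cong: conj_cong ball_cong)
  also have "\<dots> = a"
  proof (rule the_equality)
    show "a \<in> carrier Z \<and> (\<forall>X \<in> Obj C. a \<star> left c g1 g2 g3 X = right c g1 g2 g3 X)"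
      using a eq by blast
    fix b assume b: "b \<in> carrier Z \<and> (\<forall>X \<in> Obj C. b \<star> left c g1 g2 g3 X = right c g1 g2 g3 X)"
    show "b = a"
      by (rule nat_isos_free[OF _ left_nat[OF c g]]) (use a b eq g in simp_all)
  qed
  finally show ?thesis .
qed

text \<open>Transitivity supplies a central element relating the two paths; freeness, through
  \<open>associator_unique\<close>, identifies it with the one selected by the definite
  description.\<close>

lemma associator:
  assumes c: "c \<in> K" and g: "g1 \<in> carrier G" "g2 \<in> carrier G" "g3 \<in> carrier G"
  shows associator_closed [simp]: "\<alpha> c [g1, g2, g3] \<in> carrier Z"
    and associator_act: "X \<in> Obj C \<Longrightarrow> \<alpha> c [g1, g2, g3] \<star> left c g1 g2 g3 X = right c g1 g2 g3 X"
proof -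
  obtain a where a: "a \<in> carrier Z"
    and eq: "\<And>X. X \<in> Obj C \<Longrightarrow> right c g1 g2 g3 X = a \<star> left c g1 g2 g3 X"
    using nat_isos_transitive[OF _ _ left_nat[OF c g] right_nat[OF c g]] g by force
  have "\<alpha> c [g1, g2, g3] = a" by (rule associator_unique[OF c g a]) (simp add: eq)
  then show "\<alpha> c [g1, g2, g3] \<in> carrier Z"
    and "X \<in> Obj C \<Longrightarrow> \<alpha> c [g1, g2, g3] \<star> left c g1 g2 g3 X = right c g1 g2 g3 X"
    using a eq by simp_all
qed

lemma associator_cochain [simp]:
  assumes "c \<in> K"
  shows "\<alpha> c \<in> carrier (M.\<C> 3)"
proof -
  have "\<forall>xs \<in> tuples G 3. \<alpha> c xs \<in> carrier Z"
    unfolding M.ball_tuples_3 using associator_closed[OF assms] by blast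
  moreover have "\<alpha> c \<in> extensional (tuples G 3)" by (simp add: associator_def)
  ultimately show ?thesis by (simp add: cochain_group_def PiE_iff)
qed

lemma associator_pentagon:
  assumes c: "c \<in> K"
    and g: "g1 \<in> carrier G" "g2 \<in> carrier G" "g3 \<in> carrier G" "g4 \<in> carrier G"
  shows "center_action C F g1 (\<alpha> c [g2, g3, g4]) \<otimes>\<^bsub>Z\<^esub> \<alpha> c [g1, g2 \<otimes>\<^bsub>G\<^esub> g3, g4] \<otimes>\<^bsub>Z\<^esub> \<alpha> c [g1, g2, g3]
    = \<alpha> c [g1 \<otimes>\<^bsub>G\<^esub> g2, g3, g4] \<otimes>\<^bsub>Z\<^esub> \<alpha> c [g1, g2, g3 \<otimes>\<^bsub>G\<^esub> g4]" (is "?a = ?b")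
proof (rule center_eqI_autoequivalence)
  note [simp] = c g
  show "autoequivalence C (F (g1 \<otimes>\<^bsub>G\<^esub> (g2 \<otimes>\<^bsub>G\<^esub> (g3 \<otimes>\<^bsub>G\<^esub> g4))))" by simp
  show a: "?a \<in> carrier Z" and b: "?b \<in> carrier Z" by simp_all
  fix X assume X[simp]: "X \<in> Obj C"
  let ?X4 = "on_obj (F g4) X"
  have X4 [simp]: "?X4 \<in> Obj C" by simp
  \<comment> \<open>The contraction entirely from the left, starting with \<open>g1\<close> and
    \<open>g2\<close>. It is an isomorphism onto an object of the form
    \<open>F (g1 g2 g3 g4) X\<close>, where the two central elements are compared.\<close>
  let ?P = "c (g1 \<otimes>\<^bsub>G\<^esub> g2 \<otimes>\<^bsub>G\<^esub> g3, g4) X \<cdot> (c (g1 \<otimes>\<^bsub>G\<^esub> g2, g3) ?X4 \<cdot> c (g1, g2) (on_obj (F g3) ?X4))"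
  have "?a \<star> ?P = ?b \<star> ?P"
  proof (rule pentagon[where s = "c (g1, g2 \<otimes>\<^bsub>G\<^esub> g3) ?X4" and t = "on_arr (F g1) (c (g2, g3) ?X4)"
        and u = "c (g1, g2 \<otimes>\<^bsub>G\<^esub> (g3 \<otimes>\<^bsub>G\<^esub> g4)) X" and v = "on_arr (F g1) (c (g2 \<otimes>\<^bsub>G\<^esub> g3, g4) X)"
        and w = "on_arr (F g1) (c (g2, g3 \<otimes>\<^bsub>G\<^esub> g4) X)"
        and y = "on_arr (F g1) (on_arr (F g2) (c (g3, g4) X))"
        and z = "c (g1 \<otimes>\<^bsub>G\<^esub> g2, g3 \<otimes>\<^bsub>G\<^esub> g4) X" and k = "c (g1, g2) (on_obj (F (g3 \<otimes>\<^bsub>G\<^esub> g4)) X)"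
        and l = "on_arr (F (g1 \<otimes>\<^bsub>G\<^esub> g2)) (c (g3, g4) X)"])
    show "\<alpha> c [g1, g2, g3] \<star> (c (g1 \<otimes>\<^bsub>G\<^esub> g2, g3) ?X4 \<cdot> c (g1, g2) (on_obj (F g3) ?X4))
        = c (g1, g2 \<otimes>\<^bsub>G\<^esub> g3) ?X4 \<cdot> on_arr (F g1) (c (g2, g3) ?X4)"
      using associator_act[OF c g(1-3) X4] by (simp only: left_path_def right_path_def)
    show "\<alpha> c [g1, g2 \<otimes>\<^bsub>G\<^esub> g3, g4] \<star> (c (g1 \<otimes>\<^bsub>G\<^esub> g2 \<otimes>\<^bsub>G\<^esub> g3, g4) X \<cdot> c (g1, g2 \<otimes>\<^bsub>G\<^esub> g3) ?X4)
        = c (g1, g2 \<otimes>\<^bsub>G\<^esub> (g3 \<otimes>\<^bsub>G\<^esub> g4)) X \<cdot> on_arr (F g1) (c (g2 \<otimes>\<^bsub>G\<^esub> g3, g4) X)"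
      using associator_act[OF c g(1) G.m_closed[OF g(2,3)] g(4) X]
      by (simp only: left_path_def right_path_def G.m_assoc g G.m_closed)
    \<comment> \<open>This face is the image under \<open>F g1\<close> of the associator equation
      for \<open>g2\<close>, \<open>g3\<close>, \<open>g4\<close>; this is how \<open>\<rho>\<close>
      enters the cocycle identity.\<close>
    show "center_action C F g1 (\<alpha> c [g2, g3, g4]) \<star> (on_arr (F g1) (c (g2 \<otimes>\<^bsub>G\<^esub> g3, g4) X) \<cdot> on_arr (F g1) (c (g2, g3) ?X4))
        = on_arr (F g1) (c (g2, g3 \<otimes>\<^bsub>G\<^esub> g4) X) \<cdot> on_arr (F g1) (on_arr (F g2) (c (g3, g4) X))"
      using arg_cong[OF associator_act[OF c g(2-4) X], of "on_arr (F g1)"]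
      by (simp add: left_path_def right_path_def G.m_assoc)
    show "\<alpha> c [g1 \<otimes>\<^bsub>G\<^esub> g2, g3, g4] \<star> (c (g1 \<otimes>\<^bsub>G\<^esub> g2 \<otimes>\<^bsub>G\<^esub> g3, g4) X \<cdot> c (g1 \<otimes>\<^bsub>G\<^esub> g2, g3) ?X4)
        = c (g1 \<otimes>\<^bsub>G\<^esub> g2, g3 \<otimes>\<^bsub>G\<^esub> g4) X \<cdot> on_arr (F (g1 \<otimes>\<^bsub>G\<^esub> g2)) (c (g3, g4) X)"
      using associator_act[OF c G.m_closed[OF g(1,2)] g(3,4) X]
      by (simp only: left_path_def right_path_def)
    show "\<alpha> c [g1, g2, g3 \<otimes>\<^bsub>G\<^esub> g4] \<star> (c (g1 \<otimes>\<^bsub>G\<^esub> g2, g3 \<otimes>\<^bsub>G\<^esub> g4) X \<cdot> c (g1, g2) (on_obj (F (g3 \<otimes>\<^bsub>G\<^esub> g4)) X))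
        = c (g1, g2 \<otimes>\<^bsub>G\<^esub> (g3 \<otimes>\<^bsub>G\<^esub> g4)) X \<cdot> on_arr (F g1) (c (g2, g3 \<otimes>\<^bsub>G\<^esub> g4) X)"
      using associator_act[OF c g(1,2) G.m_closed[OF g(3,4)] X]
      by (simp only: left_path_def right_path_def)
    \<comment> \<open>The face without central factor: contracting \<open>g1\<close>,
      \<open>g2\<close> and contracting \<open>g3\<close>, \<open>g4\<close> are interchangeable, by
      naturality of \<open>c (g1, g2)\<close> at the arrow \<open>c (g3, g4) X\<close>.\<close>
    show "c (g1, g2) (on_obj (F (g3 \<otimes>\<^bsub>G\<^esub> g4)) X) \<cdot> on_arr (F g1) (on_arr (F g2) (c (g3, g4) X))
        = on_arr (F (g1 \<otimes>\<^bsub>G\<^esub> g2)) (c (g3, g4) X) \<cdot> c (g1, g2) (on_obj (F g3) ?X4)"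
      using compositor_natural[OF c g(1,2), of "c (g3, g4) X"] by simp
  qed (simp_all add: Hom_iff G.m_assoc)
  then show "?a (on_obj (F (g1 \<otimes>\<^bsub>G\<^esub> (g2 \<otimes>\<^bsub>G\<^esub> (g3 \<otimes>\<^bsub>G\<^esub> g4)))) X) = ?b (on_obj (F (g1 \<otimes>\<^bsub>G\<^esub> (g2 \<otimes>\<^bsub>G\<^esub> (g3 \<otimes>\<^bsub>G\<^esub> g4)))) X)"
    using act_cancel[OF a b, of ?P] by (simp add: G.m_assoc del: Z_mult)
qed

lemma associator_cocycle: "c \<in> K \<Longrightarrow> \<alpha> c \<in> carrier (M.\<Z> 3)"
  by (simp add: M.cocycle_3_iff associator_pentagon)

section \<open>Twisting compositors by 2-cochains\<close>

lemma cochain_2_closed [simp]: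
  "\<lbrakk>b \<in> carrier (M.\<C> 2); g \<in> carrier G; h \<in> carrier G\<rbrakk> \<Longrightarrow> b [g, h] \<in> carrier Z"
  and cochain_1_closed [simp]: "\<lbrakk>z \<in> carrier (M.\<C> 1); g \<in> carrier G\<rbrakk> \<Longrightarrow> z [g] \<in> carrier Z"
  by (rule M.cochain_closed, assumption, simp add: tuples_def)+

lemma twist_apply:
  assumes "c \<in> K" "g \<in> carrier G" "h \<in> carrier G" "X \<in> Obj C"
  shows "twist G C F b c (g, h) X = b [g, h] \<star> c (g, h) X"
  using assms by (simp add: twist_def act_def)

lemma twist_closed [simp]:
  assumes b: "b \<in> carrier (M.\<C> 2)" and c: "c \<in> K"
  shows "twist G C F b c \<in> K"
proof -
  have "twist G C F b c = (\<lambda>(g, h) \<in> carrier G \<times> carrier G. \<lambda>X \<in> Obj C. b [g, h] \<star> c (g, h) X)"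
    using c by (auto simp: twist_def act_def intro!: restrict_ext)
  also have "\<dots> \<in> K"
    by (rule compositorsI, rule nat_isos_act) (use b c compositor_nat in simp_all)
  finally show ?thesis .
qed

lemma twist_one: "c \<in> K \<Longrightarrow> twist G C F \<one>\<^bsub>M.\<C> 2\<^esub> c = c"
  by (rule compositors_ext) (simp_all add: twist_apply tuples_def)

lemma twist_mult:
  assumes "b \<in> carrier (M.\<C> 2)" "b' \<in> carrier (M.\<C> 2)" "c \<in> K"
  shows "twist G C F (b \<otimes>\<^bsub>M.\<C> 2\<^esub> b') c = twist G C F b (twist G C F b' c)"
  by (rule compositors_ext) (use assms in \<open>simp_all add: twist_apply tuples_def\<close>)

lemma twist_free:
  assumes b: "b \<in> carrier (M.\<C> 2)" and b': "b' \<in> carrier (M.\<C> 2)" and c: "c \<in> K"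
    and eq: "twist G C F b c = twist G C F b' c"
  shows "b = b'"
proof (rule M.cochain_ext[OF b b'])
  have "b [g, h] = b' [g, h]" if g: "g \<in> carrier G" "h \<in> carrier G" for g h
  proof (rule nat_isos_free[OF _ compositor_nat[OF c g]])
    fix X assume X: "X \<in> Obj C"
    show "b [g, h] \<star> c (g, h) X = b' [g, h] \<star> c (g, h) X"
      using arg_cong[OF eq, of "\<lambda>c. c (g, h) X"] c g X by (simp add: twist_apply)
  qed (use b b' g in simp_all)
  then have "\<forall>xs \<in> tuples G 2. b xs = b' xs" by (simp add: M.ball_tuples_2)
  then show "b xs = b' xs" if "xs \<in> tuples G 2" for xs using that by blast
qed

lemma twist_transitive:
  assumes c: "c \<in> K" and c': "c' \<in> K"
  shows "\<exists>b \<in> carrier (M.\<C> 2). twist G C F b c = c'"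
proof -
  \<comment> \<open>The statement is indexed by lists of length two, so that the choice function is
    a cochain once it is restricted.\<close>
  have "\<forall>xs \<in> tuples G 2. \<exists>a \<in> carrier Z. \<forall>X \<in> Obj C.
      c' (xs ! 0, xs ! 1) X = a \<star> c (xs ! 0, xs ! 1) X"
    unfolding M.ball_tuples_2 using nat_isos_transitive[OF _ _ compositor_nat[OF c] compositor_nat[OF c']]
    by simp
  then obtain b where b: "\<And>xs. xs \<in> tuples G 2 \<Longrightarrow> b xs \<in> carrier Z \<and>
      (\<forall>X \<in> Obj C. c' (xs ! 0, xs ! 1) X = b xs \<star> c (xs ! 0, xs ! 1) X)"
    by (metis (no_types, lifting))
  define b' where "b' = restrict b (tuples G 2)"
  have b': "b' \<in> carrier (M.\<C> 2)" using b by (simp add: b'_def cochain_group_def)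
  have "twist G C F b' c = c'"
  proof (rule compositors_ext)
    fix g h X assume gX: "g \<in> carrier G" "h \<in> carrier G" "X \<in> Obj C"
    then show "twist G C F b' c (g, h) X = c' (g, h) X"
      using b[of "[g, h]"] c by (simp add: twist_apply b'_def tuples_def)
  qed (use b' c c' in simp_all)
  then show ?thesis using b' by blast
qed

text \<open>Twisting multiplies the left path by \<open>b [g1 g2, g3]\<close> and
  \<open>b [g1, g2]\<close>, and the right path by \<open>b [g1, g2 g3]\<close> and
  \<open>\<rho> g1 (b [g2, g3])\<close>, the last because \<open>F g1\<close> is applied to a
  twisted arrow. The quotient of the two factors is the differential of \<open>b\<close>.\<close>

lemma associator_twist:
  assumes b: "b \<in> carrier (M.\<C> 2)" and c: "c \<in> K"
  shows "\<alpha> (twist G C F b c) = M.\<d> 2 b \<otimes>\<^bsub>M.\<C> 3\<^esub> \<alpha> c"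
proof -
  note [simp] = b c
  have d: "M.\<d> 2 b \<in> carrier (M.\<C> 3)"
    using M.differential_closed[OF b] by (simp add: numeral_3_eq_3 numeral_2_eq_2)
  have "\<alpha> (twist G C F b c) [g1, g2, g3] = M.\<d> 2 b [g1, g2, g3] \<otimes>\<^bsub>Z\<^esub> \<alpha> c [g1, g2, g3]"
    if g: "g1 \<in> carrier G" "g2 \<in> carrier G" "g3 \<in> carrier G" for g1 g2 g3
  proof (rule associator_unique[OF twist_closed[OF b c] g])
    note [simp] = g
    let ?d = "M.\<d> 2 b [g1, g2, g3]" and ?a = "\<alpha> c [g1, g2, g3]"
    let ?r = "center_action C F g1 (b [g2, g3])"
    have dcl: "?d \<in> carrier Z" using M.cochain_closed[OF d] by (simp add: tuples_def)
    then show "?d \<otimes>\<^bsub>Z\<^esub> ?a \<in> carrier Z" by simp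
    \<comment> \<open>The formula for the differential, cleared of inverses: it relates the factors
      of the two paths.\<close>
    have "?d \<otimes>\<^bsub>Z\<^esub> (b [g1 \<otimes>\<^bsub>G\<^esub> g2, g3] \<otimes>\<^bsub>Z\<^esub> b [g1, g2]) = b [g1, g2 \<otimes>\<^bsub>G\<^esub> g3] \<otimes>\<^bsub>Z\<^esub> ?r"
      by (simp add: M.differential_2 Z.m_ac M.mult_div_cancel M.mult_div_cancel')
    then have eq: "b [g1, g2 \<otimes>\<^bsub>G\<^esub> g3] \<otimes>\<^bsub>Z\<^esub> ?r \<otimes>\<^bsub>Z\<^esub> ?a
        = ?d \<otimes>\<^bsub>Z\<^esub> ?a \<otimes>\<^bsub>Z\<^esub> (b [g1 \<otimes>\<^bsub>G\<^esub> g2, g3] \<otimes>\<^bsub>Z\<^esub> b [g1, g2])"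
      using dcl by (simp add: Z.m_ac)
    fix X assume X [simp]: "X \<in> Obj C"
    have left: "left (twist G C F b c) g1 g2 g3 X = (b [g1 \<otimes>\<^bsub>G\<^esub> g2, g3] \<otimes>\<^bsub>Z\<^esub> b [g1, g2]) \<star> left c g1 g2 g3 X"
      by (simp add: left_path_def twist_apply Z.m_comm)
    have right: "right (twist G C F b c) g1 g2 g3 X = (b [g1, g2 \<otimes>\<^bsub>G\<^esub> g3] \<otimes>\<^bsub>Z\<^esub> ?r) \<star> right c g1 g2 g3 X"
      by (simp add: right_path_def twist_apply Z.m_comm)
    have "right (twist G C F b c) g1 g2 g3 X = (b [g1, g2 \<otimes>\<^bsub>G\<^esub> g3] \<otimes>\<^bsub>Z\<^esub> ?r \<otimes>\<^bsub>Z\<^esub> ?a) \<star> left c g1 g2 g3 X"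
      unfolding right associator_act[OF c g X, symmetric] by simp
    then show "(?d \<otimes>\<^bsub>Z\<^esub> ?a) \<star> left (twist G C F b c) g1 g2 g3 X = right (twist G C F b c) g1 g2 g3 X"
      unfolding left eq using dcl by simp
  qed
  then have "\<forall>xs \<in> tuples G 3. \<alpha> (twist G C F b c) xs = (M.\<d> 2 b \<otimes>\<^bsub>M.\<C> 3\<^esub> \<alpha> c) xs"
    unfolding M.ball_tuples_3 by (simp add: tuples_def)
  then show ?thesis
    by (intro M.cochain_ext[where n = 3]) (use d in simp_all)
qed

lemma coherent_iff_associator:
  assumes c: "c \<in> K"
  shows "coherent G C F c \<longleftrightarrow> \<alpha> c = \<one>\<^bsub>M.\<C> 3\<^esub>"
proof
  assume coh: "coherent G C F c"
  have "\<alpha> c [g1, g2, g3] = \<one>\<^bsub>Z\<^esub>" if g: "g1 \<in> carrier G" "g2 \<in> carrier G" "g3 \<in> carrier G" for g1 g2 g3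
    by (rule associator_unique[OF c g]) (use coh c g in \<open>simp_all add: coherent_def\<close>)
  then have "\<forall>xs \<in> tuples G 3. \<alpha> c xs = \<one>\<^bsub>M.\<C> 3\<^esub> xs"
    unfolding M.ball_tuples_3 by (simp add: tuples_def)
  then show "\<alpha> c = \<one>\<^bsub>M.\<C> 3\<^esub>"
    by (intro M.cochain_ext[where n = 3]) (use c in simp_all)
next
  assume eq: "\<alpha> c = \<one>\<^bsub>M.\<C> 3\<^esub>"
  show "coherent G C F c"
    unfolding coherent_def
  proof (intro ballI)
    fix g1 g2 g3 X assume g: "g1 \<in> carrier G" "g2 \<in> carrier G" "g3 \<in> carrier G" "X \<in> Obj C"
    then show "left c g1 g2 g3 X = right c g1 g2 g3 X"
      using associator_act[OF c g(1-4)] c by (simp add: eq tuples_def)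
  qed
qed

lemma coherent_twist_iff:
  assumes b: "b \<in> carrier (M.\<C> 2)" and c: "c \<in> K" and coh: "coherent G C F c"
  shows "coherent G C F (twist G C F b c) \<longleftrightarrow> b \<in> carrier (M.\<Z> 2)"
proof -
  have d: "M.\<d> 2 b \<in> carrier (M.\<C> 3)"
    using M.differential_closed[OF b] by (simp add: numeral_3_eq_3 numeral_2_eq_2)
  have "\<alpha> (twist G C F b c) = M.\<d> 2 b"
    using associator_twist[OF b c] coh[unfolded coherent_iff_associator[OF c]] d by simp
  then show ?thesis
    using b c by (simp add: coherent_iff_associator M.carrier_cocycle numeral_3_eq_3 numeral_2_eq_2)
qed

section \<open>Genuine actions\<close>

abbreviation "G_one \<equiv> \<one>\<^bsub>G\<^esub>"

lemma singleton_tuples [simp]: "[g] \<in> tuples G 1 \<longleftrightarrow> g \<in> carrier G"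
  by (simp add: tuples_def)

lemma coboundaries_1: "M.\<B> 1 = M.\<d> 0 ` carrier (M.\<C> 0)"
  and coboundaries_2: "M.\<B> 2 = M.\<d> 1 ` carrier (M.\<C> 1)"
  and coboundaries_3: "M.\<B> 3 = M.\<d> 2 ` carrier (M.\<C> 2)"
  by (simp_all add: numeral_3_eq_3 numeral_2_eq_2)

declare One_nat_def [simp del]

section \<open>The functor \<open>F 1\<close> and the unit of a genuine action\<close>

lemma F_one_nat: "nat_isos C id_endo (F G_one) \<noteq> {}"
proof -
  obtain \<eta> where "\<eta> \<in> nat_isos C (F G_one) id_endo"
    using gerbal_action unfolding gerbal_action_def nat_isomorphic_def by blast
  from nat_isos_inv[OF _ _ this] show ?thesis by auto
qed

lemma center_action_one:
  assumes "a \<in> carrier Z"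
  shows "center_action C F G_one a = a"
proof -
  obtain \<eta> where \<eta>: "\<eta> \<in> nat_isos C id_endo (F G_one)" using F_one_nat by blast
  show ?thesis
    unfolding center_action_eq by (rule center_endo_transport[OF _ _ \<eta>]) (use assms in simp_all)
qed

text \<open>\<open>F 1\<close> is isomorphic to the identity functor, and naturality of such an
  isomorphism recovers an arrow from its image.\<close>

lemma F_one_faithful:
  assumes f: "f \<in> Arr C" and g: "g \<in> Arr C" "Dom C g = Dom C f" "Cod C g = Cod C f"
    and eq: "on_arr (F G_one) f = on_arr (F G_one) g"
  shows "f = g"
proof -
  obtain \<eta> where \<eta>: "\<eta> \<in> nat_isos C id_endo (F G_one)" using F_one_nat by blast
  note [simp] = nat_simps[OF \<eta>] f g
  show ?thesis
  proof (rule iso_cancel_left[of "\<eta> (Cod C f)"])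
    show "\<eta> (Cod C f) \<cdot> f = \<eta> (Cod C f) \<cdot> g"
      using naturality[OF \<eta> f] naturality[OF \<eta> g(1)] by (simp add: eq)
  qed simp_all
qed

text \<open>After cancelling \<open>c (1, 1)\<close>, faithfulness of \<open>F 1\<close> recovers
  \<open>u X\<close>; so the unit equation at the neutral element has at most one solution.\<close>

lemma unit_unique:
  assumes c: "c \<in> K" and u: "u \<in> nat_isos C id_endo (F G_one)" and u': "u' \<in> nat_isos C id_endo (F G_one)"
    and eq: "\<And>X. X \<in> Obj C \<Longrightarrow>
      c (G_one, G_one) X \<cdot> on_arr (F G_one) (u X) = c (G_one, G_one) X \<cdot> on_arr (F G_one) (u' X)"
  shows "u = u'"
proof (rule nat_isos_ext[OF u u'])
  fix X assume X: "X \<in> Obj C"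
  note [simp] = nat_simps[OF u] nat_simps[OF u'] c X
  have "on_arr (F G_one) (u X) = on_arr (F G_one) (u' X)"
    by (rule iso_cancel_left[OF _ _ _ _ _ eq[OF X]]) simp_all
  then show "u X = u' X" by (rule F_one_faithful[rotated 4]) simp_all
qed

lemma genuine_actionD:
  assumes "genuine_action G C F c u"
  shows "c \<in> K" "coherent G C F c" "u \<in> nat_isos C id_endo (F G_one)"
    "\<And>g X. \<lbrakk>g \<in> carrier G; X \<in> Obj C\<rbrakk> \<Longrightarrow> c (g, G_one) X \<cdot> on_arr (F g) (u X) = Ide C (on_obj (F g) X)"
  using assms by (simp_all add: genuine_action_def)

text \<open>As for units in monoidal categories, coherence at triples with two neutral entries
  propagates the single equation at \<open>(1, 1)\<close> to both unit axioms for every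
  \<open>g\<close>.\<close>

lemma coherent_imp_unit_law:
  assumes c: "c \<in> K" and coh: "coherent G C F c" and u: "u \<in> nat_isos C id_endo (F G_one)"
    and unit: "\<And>X. X \<in> Obj C \<Longrightarrow>
      c (G_one, G_one) X \<cdot> on_arr (F G_one) (u X) = Ide C (on_obj (F G_one) X)"
  shows "genuine_action G C F c u"
proof -
  note [simp] = nat_simps[OF u] c
  have u_one: "u (on_obj (F G_one) X) = on_arr (F G_one) (u X)" if X: "X \<in> Obj C" for X
    by (rule iso_cancel_right[of "u X"]) (use naturality[OF u, of "u X"] X in simp_all)
  have right: "c (g, G_one) X \<cdot> on_arr (F g) (u X) = Ide C (on_obj (F g) X)"
    if g: "g \<in> carrier G" and X: "X \<in> Obj C" for g X
  proof -
    note [simp] = g X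
    let ?X1 = "on_obj (F G_one) X"
    \<comment> \<open>Coherence at \<open>(g, 1, 1)\<close>; cancelling the common factor
      \<open>c (g, 1) X\<close> leaves a formula for the component at \<open>F 1 X\<close>.\<close>
    have "c (g, G_one) X \<cdot> c (g, G_one) ?X1 = c (g, G_one) X \<cdot> on_arr (F g) (c (G_one, G_one) X)"
      using coh[unfolded coherent_def left_path_def right_path_def, rule_format, of g G_one G_one X] by simp
    then have assoc: "c (g, G_one) ?X1 = on_arr (F g) (c (G_one, G_one) X)"
      by (rule iso_cancel_left[rotated 5]) simp_all
    \<comment> \<open>The composite in question is shown to be the identity after composing with the
      isomorphism \<open>F g (u X)\<close>: naturality of \<open>c (g, 1)\<close> at
      \<open>u X\<close> moves the outer factor inside, where \<open>unit\<close> applies.\<close>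
    have "on_arr (F g) (u X) \<cdot> (c (g, G_one) X \<cdot> on_arr (F g) (u X))
        = (on_arr (F g) (u X) \<cdot> c (g, G_one) X) \<cdot> on_arr (F g) (u X)"
      by (simp add: comp_assoc)
    also have "on_arr (F g) (u X) \<cdot> c (g, G_one) X = c (g, G_one) ?X1 \<cdot> on_arr (F g) (on_arr (F G_one) (u X))"
      using compositor_natural[OF c g G.one_closed, of "u X"] by simp
    also have "\<dots> \<cdot> on_arr (F g) (u X) = on_arr (F g) (c (G_one, G_one) X \<cdot> on_arr (F G_one) (u X)) \<cdot> on_arr (F g) (u X)"
      by (simp add: assoc)
    also have "\<dots> = on_arr (F g) (u X) \<cdot> Ide C (on_obj (F g) X)"
      unfolding unit[OF X] by simp
    finally show ?thesis by (rule iso_cancel_left[rotated 5]) simp_all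
  qed
  have "c (G_one, g) X \<cdot> u (on_obj (F g) X) = Ide C (on_obj (F g) X)"
    if g: "g \<in> carrier G" and X: "X \<in> Obj C" for g X
  proof (rule F_one_faithful)
    note [simp] = g X
    \<comment> \<open>Coherence at \<open>(1, 1, g)\<close>. The equation is checked after applying
      the faithful \<open>F 1\<close>, which turns it into \<open>unit\<close> at the object
      \<open>F g X\<close>.\<close>
    have "c (G_one, g) X \<cdot> c (G_one, G_one) (on_obj (F g) X) = c (G_one, g) X \<cdot> on_arr (F G_one) (c (G_one, g) X)"
      using coh[unfolded coherent_def left_path_def right_path_def, rule_format, of G_one G_one g X] by simp
    then have assoc: "c (G_one, G_one) (on_obj (F g) X) = on_arr (F G_one) (c (G_one, g) X)"
      by (rule iso_cancel_left[rotated 5]) simp_all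
    have "on_arr (F G_one) (c (G_one, g) X \<cdot> u (on_obj (F g) X)) =
        c (G_one, G_one) (on_obj (F g) X) \<cdot> on_arr (F G_one) (u (on_obj (F g) X))"
      by (simp add: assoc)
    then show "on_arr (F G_one) (c (G_one, g) X \<cdot> u (on_obj (F g) X)) = on_arr (F G_one) (Ide C (on_obj (F g) X))"
      using unit[of "on_obj (F g) X"] by simp
  qed (use g X in simp_all)
  then show ?thesis using right c coh u by (simp add: genuine_action_def)
qed

text \<open>The unit is \<open>v : 1 \<rightarrow> F 1\<close>, chosen arbitrarily, corrected by the central element
  measuring the failure of \<open>c (1, 1) \<circ> F 1 v\<close> to be the identity.\<close>

lemma coherent_imp_genuine:
  assumes c: "c \<in> K" and coh: "coherent G C F c"
  shows "\<exists>u. genuine_action G C F c u"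
proof -
  obtain v where v: "v \<in> nat_isos C id_endo (F G_one)" using F_one_nat by blast
  note [simp] = nat_simps[OF v] c
  \<comment> \<open>The defect of \<open>v\<close> is an automorphism of \<open>F 1\<close>, hence
    given by a central element \<open>a\<close>.\<close>
  have "(\<lambda>X \<in> Obj C. c (G_one, G_one) X \<cdot> on_arr (F G_one) (v X)) \<in> nat_isos C (F G_one) (F G_one)"
  proof (rule nat_isosI)
    fix f assume f: "f \<in> Arr C"
    let ?X = "Dom C f" and ?Y = "Cod C f" and ?c = "c (G_one, G_one)" and ?F = "on_arr (F G_one)"
    have "(?c ?Y \<cdot> ?F (v ?Y)) \<cdot> ?F f = ?c ?Y \<cdot> ?F (v ?Y \<cdot> f)"
      using f by (simp add: comp_assoc)
    also have "v ?Y \<cdot> f = ?F f \<cdot> v ?X" using naturality[OF v f] by simp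
    also have "?c ?Y \<cdot> ?F (?F f \<cdot> v ?X) = (?c ?Y \<cdot> ?F (?F f)) \<cdot> ?F (v ?X)"
      using f by (simp add: comp_assoc)
    also have "?c ?Y \<cdot> ?F (?F f) = ?F f \<cdot> ?c ?X"
      using compositor_natural[OF c G.one_closed G.one_closed f] by simp
    also have "?F f \<cdot> ?c ?X \<cdot> ?F (v ?X) = ?F f \<cdot> (?c ?X \<cdot> ?F (v ?X))"
      using f by (simp add: comp_assoc)
    finally show "(?c ?Y \<cdot> ?F (v ?Y)) \<cdot> ?F f = ?F f \<cdot> (?c ?X \<cdot> ?F (v ?X))" .
  qed simp_all
  from automorphism_of_autoequivalence[OF F_auto[OF G.one_closed] this] obtain a
    where a: "a \<in> carrier Z"
      and eq: "\<And>X. X \<in> Obj C \<Longrightarrow> c (G_one, G_one) X \<cdot> on_arr (F G_one) (v X) = a (on_obj (F G_one) X)"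
    by auto
  let ?u = "\<lambda>X \<in> Obj C. inv\<^bsub>Z\<^esub> a \<star> v X"
  have u: "?u \<in> nat_isos C id_endo (F G_one)"
    by (rule nat_isos_act[OF _ _ v]) (use a in simp_all)
  have unit: "c (G_one, G_one) X \<cdot> on_arr (F G_one) (?u X) = Ide C (on_obj (F G_one) X)"
    if X: "X \<in> Obj C" for X
  proof -
    \<comment> \<open>The correction factor passes through \<open>F 1\<close> unchanged, because
      \<open>\<rho>\<close> is trivial at the neutral element, and then cancels
      \<open>a\<close>.\<close>
    have "c (G_one, G_one) X \<cdot> on_arr (F G_one) (?u X)
        = inv\<^bsub>Z\<^esub> a \<star> (c (G_one, G_one) X \<cdot> on_arr (F G_one) (v X))"
      using X a by (simp add: center_action_one)
    also have "\<dots> = (inv\<^bsub>Z\<^esub> a) (on_obj (F G_one) X) \<cdot> a (on_obj (F G_one) X)"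
      unfolding eq[OF X] using X a by (simp add: act_def)
    also have "\<dots> = Ide C (on_obj (F G_one) X)"
      using X a by (simp flip: Z_mult)
    finally show ?thesis .
  qed
  show ?thesis using coherent_imp_unit_law[OF c coh u unit] by blast
qed

lemma genuine_structures_eq: "genuine_structures G C F = {c \<in> K. coherent G C F c}"
  using coherent_imp_genuine genuine_actionD(1,2) by (auto simp: genuine_structures_def)

section \<open>1-cochains as families of automorphisms\<close>

lemma cochain_aut_apply:
  "\<lbrakk>z \<in> carrier (M.\<C> 1); g \<in> carrier G; X \<in> Obj C\<rbrakk>
    \<Longrightarrow> cochain_aut G C F z g X = z [g] \<star> Ide C (on_obj (F g) X)"
  by (simp add: cochain_aut_def act_def)

lemma Ide_nat: "g \<in> carrier G \<Longrightarrow> (\<lambda>X \<in> Obj C. Ide C (on_obj (F g) X)) \<in> nat_isos C (F g) (F g)"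
  by (rule nat_isosI) simp_all

lemma cochain_aut_nat:
  assumes z: "z \<in> carrier (M.\<C> 1)"
  shows "cochain_aut G C F z \<in> (\<Pi>\<^sub>E g \<in> carrier G. nat_isos C (F g) (F g))"
proof (rule PiE_I)
  fix g assume g: "g \<in> carrier G"
  have "cochain_aut G C F z g = (\<lambda>X \<in> Obj C. z [g] \<star> (\<lambda>X \<in> Obj C. Ide C (on_obj (F g) X)) X)"
    using z g by (auto simp: cochain_aut_def act_def intro!: restrict_ext)
  also have "\<dots> \<in> nat_isos C (F g) (F g)"
    by (rule nat_isos_act[OF _ _ Ide_nat]) (use z g in simp_all)
  finally show "cochain_aut G C F z g \<in> nat_isos C (F g) (F g)" .
qed (simp add: cochain_aut_def)

lemma cochain_aut_surj:
  assumes \<phi>: "\<phi> \<in> (\<Pi>\<^sub>E g \<in> carrier G. nat_isos C (F g) (F g))"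
  shows "\<exists>z \<in> carrier (M.\<C> 1). \<phi> = cochain_aut G C F z"
proof -
  have "\<forall>xs \<in> tuples G 1. \<exists>a \<in> carrier Z. \<forall>X \<in> Obj C. \<phi> (xs ! 0) X = a (on_obj (F (xs ! 0)) X)"
    unfolding M.ball_tuples_1
    using automorphism_of_autoequivalence[OF F_auto PiE_mem[OF \<phi>]] by simp
  then obtain b where b: "\<And>xs. xs \<in> tuples G 1 \<Longrightarrow> b xs \<in> carrier Z \<and>
      (\<forall>X \<in> Obj C. \<phi> (xs ! 0) X = b xs (on_obj (F (xs ! 0)) X))"
    by (metis (no_types, lifting))
  define z where "z = restrict b (tuples G 1)"
  have z: "z \<in> carrier (M.\<C> 1)" using b by (simp add: z_def cochain_group_def)
  have "\<phi> = cochain_aut G C F z"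
  proof (rule PiE_ext[OF \<phi> cochain_aut_nat[OF z]])
    fix g assume g: "g \<in> carrier G"
    show "\<phi> g = cochain_aut G C F z g"
    proof (rule nat_isos_ext[OF PiE_mem[OF \<phi> g] PiE_mem[OF cochain_aut_nat[OF z] g]])
      fix X assume "X \<in> Obj C"
      then show "\<phi> g X = cochain_aut G C F z g X"
        using b[of "[g]"] g by (simp add: cochain_aut_def z_def)
    qed
  qed
  then show ?thesis using z by blast
qed

lemma cochain_aut_inj:
  assumes z: "z \<in> carrier (M.\<C> 1)" and z': "z' \<in> carrier (M.\<C> 1)"
    and eq: "cochain_aut G C F z = cochain_aut G C F z'"
  shows "z = z'"
proof (rule M.cochain_ext[OF z z'])
  have "z [g] = z' [g]" if g: "g \<in> carrier G" for g
  proof (rule center_eqI_autoequivalence[OF F_auto[OF g]])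
    fix X assume "X \<in> Obj C"
    then show "z [g] (on_obj (F g) X) = z' [g] (on_obj (F g) X)"
      using arg_cong[OF eq, of "\<lambda>\<phi>. \<phi> g X"] g by (simp add: cochain_aut_def)
  qed (use z z' g in simp_all)
  then have "\<forall>xs \<in> tuples G 1. z xs = z' xs" unfolding M.ball_tuples_1 by blast
  then show "z xs = z' xs" if "xs \<in> tuples G 1" for xs using that by blast
qed

lemma differential_1_closed [simp]: "z \<in> carrier (M.\<C> 1) \<Longrightarrow> M.\<d> 1 z \<in> carrier (M.\<C> 2)"
  using M.differential_closed[of z 1] by simp

text \<open>Compatibility with the compositors reads \<open>z [g h] \<star> c = (z [g] \<otimes>
  \<rho> g (z [h])) \<star> c'\<close>, which is the twist by the differential of \<open>z\<close>.
  Compatibility with the units then follows from uniqueness of the unit of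
  \<open>c'\<close>.\<close>

lemma cochain_aut_genuine_iff:
  assumes gen: "genuine_action G C F c u" and gen': "genuine_action G C F c' u'"
    and z: "z \<in> carrier (M.\<C> 1)"
  shows "cochain_aut G C F z \<in> genuine_isos G C F c u F c' u' \<longleftrightarrow> c = twist G C F (M.\<d> 1 z) c'"
proof -
  note c = genuine_actionD(1)[OF gen] and c' = genuine_actionD(1)[OF gen']
    and u = genuine_actionD(3)[OF gen] and u' = genuine_actionD(3)[OF gen']
  note [simp] = c c' z nat_simps[OF u] nat_simps[OF u']
  let ?\<phi> = "cochain_aut G C F z"
  have d: "M.\<d> 1 z [g, h] = center_action C F g (z [h]) \<otimes>\<^bsub>Z\<^esub> inv\<^bsub>Z\<^esub> z [g \<otimes>\<^bsub>G\<^esub> h] \<otimes>\<^bsub>Z\<^esub> z [g]"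
    if "g \<in> carrier G" "h \<in> carrier G" for g h
    using that by (simp only: M.differential_1 z)
  have square: "?\<phi> (g \<otimes>\<^bsub>G\<^esub> h) X \<cdot> c (g, h) X = c' (g, h) X \<cdot> (?\<phi> g (on_obj (F h) X) \<cdot> on_arr (F g) (?\<phi> h X))
      \<longleftrightarrow> c (g, h) X = twist G C F (M.\<d> 1 z) c' (g, h) X"
    if g: "g \<in> carrier G" and h: "h \<in> carrier G" and X: "X \<in> Obj C" for g h X
  proof -
    note [simp] = g h X
    let ?z = "z [g \<otimes>\<^bsub>G\<^esub> h]" and ?w = "z [g] \<otimes>\<^bsub>Z\<^esub> center_action C F g (z [h])"
    have "?\<phi> (g \<otimes>\<^bsub>G\<^esub> h) X \<cdot> c (g, h) X = ?z \<star> c (g, h) X"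
      by (simp add: cochain_aut_apply)
    moreover have "c' (g, h) X \<cdot> (?\<phi> g (on_obj (F h) X) \<cdot> on_arr (F g) (?\<phi> h X)) = ?w \<star> c' (g, h) X"
      by (simp add: cochain_aut_apply Z.m_comm)
    moreover have "?z \<star> c (g, h) X = ?w \<star> c' (g, h) X \<longleftrightarrow> c (g, h) X = M.\<d> 1 z [g, h] \<star> c' (g, h) X"
    proof
      assume "?z \<star> c (g, h) X = ?w \<star> c' (g, h) X"
      from arg_cong[OF this, of "act (inv\<^bsub>Z\<^esub> ?z)"]
      show "c (g, h) X = M.\<d> 1 z [g, h] \<star> c' (g, h) X" by (simp add: d Z.m_ac)
    next
      assume "c (g, h) X = M.\<d> 1 z [g, h] \<star> c' (g, h) X"
      then have "?z \<star> c (g, h) X = (?z \<otimes>\<^bsub>Z\<^esub> M.\<d> 1 z [g, h]) \<star> c' (g, h) X"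
        by (simp add: d)
      also have "?z \<otimes>\<^bsub>Z\<^esub> M.\<d> 1 z [g, h] = ?w"
        by (simp add: d Z.m_ac M.mult_div_cancel M.mult_div_cancel' M.mult_div_cancel'')
      finally show "?z \<star> c (g, h) X = ?w \<star> c' (g, h) X" .
    qed
    ultimately show ?thesis by (simp add: twist_apply)
  qed
  show ?thesis
  proof
    assume "?\<phi> \<in> genuine_isos G C F c u F c' u'"
    then have "c (g, h) X = twist G C F (M.\<d> 1 z) c' (g, h) X"
      if "g \<in> carrier G" "h \<in> carrier G" "X \<in> Obj C" for g h X
      using that square[OF that] by (simp add: genuine_isos_def)
    then show "c = twist G C F (M.\<d> 1 z) c'" by (intro compositors_ext) simp_all
  next
    assume eq: "c = twist G C F (M.\<d> 1 z) c'"
    \<comment> \<open>The image of \<open>u\<close> under the family; it satisfies the unit equation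
      for \<open>c'\<close>, hence equals \<open>u'\<close>.\<close>
    let ?w = "\<lambda>X \<in> Obj C. z [G_one] \<star> u X"
    have w: "?w \<in> nat_isos C id_endo (F G_one)"
      by (rule nat_isos_act[OF _ _ u]) simp_all
    have weq: "?w = u'"
    proof (rule unit_unique[OF c' w u'])
      fix X assume X: "X \<in> Obj C"
      \<comment> \<open>At \<open>(1, 1)\<close> the differential has \<open>z [1]\<close> with both
        exponents and reduces to \<open>\<rho> 1 (z [1])\<close>, exactly the factor that
        \<open>F 1\<close> produces from \<open>?w\<close>.\<close>
      have "M.\<d> 1 z [G_one, G_one] = center_action C F G_one (z [G_one])"
        by (simp add: d Z.m_assoc)
      then have "c (G_one, G_one) X = center_action C F G_one (z [G_one]) \<star> c' (G_one, G_one) X"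
        using X arg_cong[OF eq, of "\<lambda>c. c (G_one, G_one) X"] by (simp add: twist_apply)
      then have "c' (G_one, G_one) X \<cdot> on_arr (F G_one) (?w X) = c (G_one, G_one) X \<cdot> on_arr (F G_one) (u X)"
        using X by simp
      then show "c' (G_one, G_one) X \<cdot> on_arr (F G_one) (?w X) = c' (G_one, G_one) X \<cdot> on_arr (F G_one) (u' X)"
        using genuine_actionD(4)[OF gen G.one_closed X] genuine_actionD(4)[OF gen' G.one_closed X] by simp
    qed
    have unit: "?\<phi> G_one X \<cdot> u X = u' X" if "X \<in> Obj C" for X
      using that arg_cong[OF weq, of "\<lambda>w. w X"] by (simp add: cochain_aut_apply)
    have "\<forall>g \<in> carrier G. \<forall>h \<in> carrier G. \<forall>X \<in> Obj C.
        ?\<phi> (g \<otimes>\<^bsub>G\<^esub> h) X \<cdot> c (g, h) X = c' (g, h) X \<cdot> (?\<phi> g (on_obj (F h) X) \<cdot> on_arr (F g) (?\<phi> h X))"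
      using square arg_cong[OF eq, of "\<lambda>c. c (_, _) _"] by blast
    then show "?\<phi> \<in> genuine_isos G C F c u F c' u'"
      unfolding genuine_isos_def using cochain_aut_nat[OF z] unit by blast
  qed
qed

lemma genuine_isos_eq:
  assumes "genuine_action G C F c u" "genuine_action G C F c' u'"
  shows "genuine_isos G C F c u F c' u' =
    cochain_aut G C F ` {z \<in> carrier (M.\<C> 1). c = twist G C F (M.\<d> 1 z) c'}" (is "?L = ?R")
proof (intro equalityI subsetI)
  fix \<phi> assume \<phi>: "\<phi> \<in> ?L"
  then have "\<phi> \<in> (\<Pi>\<^sub>E g \<in> carrier G. nat_isos C (F g) (F g))" by (simp add: genuine_isos_def)
  then obtain z where z: "z \<in> carrier (M.\<C> 1)" "\<phi> = cochain_aut G C F z"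
    using cochain_aut_surj by blast
  then show "\<phi> \<in> ?R" using \<phi> cochain_aut_genuine_iff[OF assms z(1)] by blast
next
  fix \<phi> assume "\<phi> \<in> ?R"
  then show "\<phi> \<in> ?L" using cochain_aut_genuine_iff[OF assms] by blast
qed

section \<open>Torsor and automorphism group\<close>

text \<open>Puts isomorphism of genuine structures into the form of the relation \<open>R\<close> in
  \<open>torsor_Mod\<close>, with the 2-coboundaries as subgroup and the units eliminated.\<close>

lemma structure_iso_eq:
  "structure_iso G C F = {(c, c'). c \<in> genuine_structures G C F \<and> c' \<in> genuine_structures G C F \<and>
     (\<exists>b \<in> M.\<B> 2. c = twist G C F b c')}"
proof -
  have "(c, c') \<in> structure_iso G C F \<longleftrightarrow> (c \<in> genuine_structures G C F \<and>
      c' \<in> genuine_structures G C F \<and> (\<exists>b \<in> M.\<B> 2. c = twist G C F b c'))" for c c'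
  proof
    assume "(c, c') \<in> structure_iso G C F"
    then obtain u u' where gen: "genuine_action G C F c u" "genuine_action G C F c' u'"
      and "genuine_isos G C F c u F c' u' \<noteq> {}"
      unfolding structure_iso_def by blast
    then have "\<exists>b \<in> M.\<B> 2. c = twist G C F b c'"
      unfolding genuine_isos_eq[OF gen] coboundaries_2 by blast
    then show "c \<in> genuine_structures G C F \<and> c' \<in> genuine_structures G C F \<and>
        (\<exists>b \<in> M.\<B> 2. c = twist G C F b c')"
      using gen unfolding genuine_structures_def by blast
  next
    assume "c \<in> genuine_structures G C F \<and> c' \<in> genuine_structures G C F \<and>
        (\<exists>b \<in> M.\<B> 2. c = twist G C F b c')"
    then obtain u u' where gen: "genuine_action G C F c u" "genuine_action G C F c' u'"
      and "\<exists>b \<in> M.\<B> 2. c = twist G C F b c'"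
      unfolding genuine_structures_def by blast
    then have "genuine_isos G C F c u F c' u' \<noteq> {}"
      unfolding genuine_isos_eq[OF gen] coboundaries_2 by blast
    then show "(c, c') \<in> structure_iso G C F" using gen unfolding structure_iso_def by blast
  qed
  then show ?thesis by auto
qed

lemma structure_torsor:
  assumes nonempty: "genuine_structures G C F \<noteq> {}"
  shows "torsor (Hgrp G C F 2) (structure_classes G C F) (class_twist G C F)"
  unfolding cohomology_group_def structure_classes_def class_twist_def
proof (rule torsor_Mod[OF M.cocycle_comm_group M.coboundaries_subgroup_cocycles[OF M.coboundary_2_imp_cocycle]
      _ _ _ _ _ nonempty structure_iso_eq])
  have Z2: "z \<in> carrier (M.\<C> 2)" if "z \<in> carrier (M.\<Z> 2)" for z
    using that by (simp add: M.carrier_cocycle)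
  show "twist G C F z c \<in> genuine_structures G C F"
    if "z \<in> carrier (M.\<Z> 2)" "c \<in> genuine_structures G C F" for z c
    using that Z2[OF that(1)] by (simp add: genuine_structures_eq coherent_twist_iff)
  show "twist G C F \<one>\<^bsub>M.\<Z> 2\<^esub> c = c" if "c \<in> genuine_structures G C F" for c
    using that by (simp add: genuine_structures_eq twist_one)
  show "twist G C F (z \<otimes>\<^bsub>M.\<Z> 2\<^esub> w) c = twist G C F z (twist G C F w c)"
    if "z \<in> carrier (M.\<Z> 2)" "w \<in> carrier (M.\<Z> 2)" "c \<in> genuine_structures G C F" for z w c
    using that Z2 by (simp add: genuine_structures_eq twist_mult)
  show "\<exists>z \<in> carrier (M.\<Z> 2). twist G C F z c = c'"
    if c: "c \<in> genuine_structures G C F" and c': "c' \<in> genuine_structures G C F" for c c'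
  proof -
    obtain z where z: "z \<in> carrier (M.\<C> 2)" "twist G C F z c = c'"
      using c c' twist_transitive unfolding genuine_structures_eq by blast
    then have "z \<in> carrier (M.\<Z> 2)"
      using c c' coherent_twist_iff[OF z(1)] unfolding genuine_structures_eq by blast
    then show ?thesis using z by blast
  qed
  show "z = w" if "z \<in> carrier (M.\<Z> 2)" "w \<in> carrier (M.\<Z> 2)" "c \<in> genuine_structures G C F"
    "twist G C F z c = twist G C F w c" for z w c
    by (rule twist_free[OF _ _ _ that(4)]) (use that Z2 in \<open>simp_all add: genuine_structures_eq\<close>)
qed

text \<open>For \<open>c' = c\<close> the condition says that twisting by the differential of
  \<open>z\<close> fixes \<open>c\<close>; freeness of twisting makes this the cocycle
  condition.\<close>

lemma cochain_aut_iso: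
  assumes gen: "genuine_action G C F c u"
  shows "cochain_aut G C F \<in> iso (M.\<Z> 1) (genuine_aut_group G C F c u)"
proof -
  note c = genuine_actionD(1)[OF gen]
  have Z1: "{z \<in> carrier (M.\<C> 1). c = twist G C F (M.\<d> 1 z) c} = carrier (M.\<Z> 1)"
  proof (intro equalityI subsetI)
    fix z assume z: "z \<in> {z \<in> carrier (M.\<C> 1). c = twist G C F (M.\<d> 1 z) c}"
    then have "twist G C F (M.\<d> 1 z) c = twist G C F \<one>\<^bsub>M.\<C> 2\<^esub> c" using c by (simp add: twist_one)
    then have "M.\<d> 1 z = \<one>\<^bsub>M.\<C> 2\<^esub>" by (rule twist_free[rotated 3]) (use z c in simp_all)
    then show "z \<in> carrier (M.\<Z> 1)" using z by (simp add: M.carrier_cocycle)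
  next
    fix z assume z: "z \<in> carrier (M.\<Z> 1)"
    then have "M.\<d> 1 z = \<one>\<^bsub>M.\<C> 2\<^esub>" "z \<in> carrier (M.\<C> 1)"
      by (simp_all add: M.carrier_cocycle)
    then show "z \<in> {z \<in> carrier (M.\<C> 1). c = twist G C F (M.\<d> 1 z) c}" using c by (simp add: twist_one)
  qed
  have img: "cochain_aut G C F ` carrier (M.\<Z> 1) = carrier (genuine_aut_group G C F c u)"
    using genuine_isos_eq[OF gen gen] by (simp only: Z1) (simp add: genuine_aut_group_def)
  have sub: "z \<in> carrier (M.\<C> 1)" if "z \<in> carrier (M.\<Z> 1)" for z
    using that by (simp add: M.carrier_cocycle)
  have "cochain_aut G C F (z \<otimes>\<^bsub>M.\<Z> 1\<^esub> z') =
      cochain_aut G C F z \<otimes>\<^bsub>genuine_aut_group G C F c u\<^esub> cochain_aut G C F z'"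
    if "z \<in> carrier (M.\<Z> 1)" "z' \<in> carrier (M.\<Z> 1)" for z z'
    by (auto simp: cochain_aut_def genuine_aut_group_def tuples_def cochain_group_def intro!: restrict_ext)
  moreover have "inj_on (cochain_aut G C F) (carrier (M.\<Z> 1))"
    using cochain_aut_inj sub by (blast intro: inj_onI)
  ultimately show ?thesis using img by (auto simp: iso_def hom_def bij_betw_def)
qed

text \<open>The condition on \<open>m\<close> says \<open>z [g] \<otimes> \<rho> g m = m\<close>.
  Solved for \<open>z [g]\<close>, it exhibits \<open>z\<close> as the differential of the 0-cochain
  with value the inverse of \<open>m\<close>.\<close>

lemma inner_auts_eq:
  assumes gen: "genuine_action G C F c u"
  shows "inner_auts G C F c u = cochain_aut G C F ` M.\<B> 1"
proof -
  have img: "carrier (genuine_aut_group G C F c u) = cochain_aut G C F ` carrier (M.\<Z> 1)"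
    using cochain_aut_iso[OF gen] by (simp add: iso_def bij_betw_def)
  have inner: "(\<exists>m \<in> carrier Z. \<forall>g \<in> carrier G. \<forall>X \<in> Obj C.
      cochain_aut G C F z g X \<cdot> on_arr (F g) (m X) = m (on_obj (F g) X)) \<longleftrightarrow> z \<in> M.\<B> 1"
    if z: "z \<in> carrier (M.\<Z> 1)" for z
  proof -
    have z1: "z \<in> carrier (M.\<C> 1)" using z by (simp add: M.carrier_cocycle)
    have pointwise: "(\<forall>X \<in> Obj C. cochain_aut G C F z g X \<cdot> on_arr (F g) (m X) = m (on_obj (F g) X))
        \<longleftrightarrow> z [g] = center_action C F g (inv\<^bsub>Z\<^esub> m) \<otimes>\<^bsub>Z\<^esub> m"
      if m: "m \<in> carrier Z" and g: "g \<in> carrier G" for m g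
    proof -
      note [simp] = m g z1
      let ?r = "center_action C F g m"
      have "(\<forall>X \<in> Obj C. cochain_aut G C F z g X \<cdot> on_arr (F g) (m X) = m (on_obj (F g) X))
          \<longleftrightarrow> (\<forall>X \<in> Obj C. (z [g] \<otimes>\<^bsub>Z\<^esub> ?r) (on_obj (F g) X) = m (on_obj (F g) X))"
        by (simp add: cochain_aut_def center_action_eq center_endo_apply)
      also have "\<dots> \<longleftrightarrow> z [g] \<otimes>\<^bsub>Z\<^esub> ?r = m"
      proof
        assume eq: "\<forall>X \<in> Obj C. (z [g] \<otimes>\<^bsub>Z\<^esub> ?r) (on_obj (F g) X) = m (on_obj (F g) X)"
        show "z [g] \<otimes>\<^bsub>Z\<^esub> ?r = m"
          by (rule center_eqI_autoequivalence[OF F_auto[OF g]]) (use eq in \<open>simp_all del: Z_mult\<close>)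
      qed simp
      also have "\<dots> \<longleftrightarrow> z [g] = m \<otimes>\<^bsub>Z\<^esub> inv\<^bsub>Z\<^esub> ?r"
      proof
        assume "z [g] \<otimes>\<^bsub>Z\<^esub> ?r = m"
        from arg_cong[OF this, of "\<lambda>x. x \<otimes>\<^bsub>Z\<^esub> inv\<^bsub>Z\<^esub> ?r"]
        show "z [g] = m \<otimes>\<^bsub>Z\<^esub> inv\<^bsub>Z\<^esub> ?r" by (simp add: Z.m_assoc)
      qed (simp add: Z.m_assoc)
      also have "m \<otimes>\<^bsub>Z\<^esub> inv\<^bsub>Z\<^esub> ?r = center_action C F g (inv\<^bsub>Z\<^esub> m) \<otimes>\<^bsub>Z\<^esub> m"
        by (simp add: M.rho_inv Z.m_comm)
      finally show ?thesis .
    qed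
    show ?thesis
    proof
      assume "\<exists>m \<in> carrier Z. \<forall>g \<in> carrier G. \<forall>X \<in> Obj C.
        cochain_aut G C F z g X \<cdot> on_arr (F g) (m X) = m (on_obj (F g) X)"
      then obtain m where m: "m \<in> carrier Z"
        and eq: "\<And>g. g \<in> carrier G \<Longrightarrow> z [g] = center_action C F g (inv\<^bsub>Z\<^esub> m) \<otimes>\<^bsub>Z\<^esub> m"
        using pointwise by blast
      \<comment> \<open>The inverse is due to the sign convention: the differential of
        \<open>n\<close> at \<open>[g]\<close> is \<open>\<rho> g\<close> of the value times the
        inverse of the value.\<close>
      define n where "n = (\<lambda>xs \<in> tuples G 0. inv\<^bsub>Z\<^esub> m)"
      have n: "n \<in> carrier (M.\<C> 0)" using m by (simp add: n_def cochain_group_def)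
      have "\<forall>xs \<in> tuples G 1. z xs = M.\<d> 0 n xs"
        unfolding M.ball_tuples_1 using eq m by (simp add: M.differential_0[OF n]) (simp add: n_def tuples_def)
      then have "z = M.\<d> 0 n"
        by (intro M.cochain_ext[OF z1]) (use M.differential_closed[OF n] in \<open>simp_all add: One_nat_def\<close>)
      then show "z \<in> M.\<B> 1" using n unfolding coboundaries_1 by blast
    next
      assume "z \<in> M.\<B> 1"
      then obtain n where n: "n \<in> carrier (M.\<C> 0)" "z = M.\<d> 0 n"
        unfolding coboundaries_1 by blast
      have n0: "n [] \<in> carrier Z" using n(1) by (simp add: tuples_def)
      have "z [g] = center_action C F g (inv\<^bsub>Z\<^esub> (inv\<^bsub>Z\<^esub> n [])) \<otimes>\<^bsub>Z\<^esub> inv\<^bsub>Z\<^esub> n []"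
        if "g \<in> carrier G" for g
        using that n n0 by (simp add: M.differential_0)
      then have "\<forall>g \<in> carrier G. \<forall>X \<in> Obj C. cochain_aut G C F z g X \<cdot> on_arr (F g) ((inv\<^bsub>Z\<^esub> n []) X)
          = (inv\<^bsub>Z\<^esub> n []) (on_obj (F g) X)"
        using pointwise[OF Z.inv_closed[OF n0]] by blast
      then show "\<exists>m \<in> carrier Z. \<forall>g \<in> carrier G. \<forall>X \<in> Obj C.
          cochain_aut G C F z g X \<cdot> on_arr (F g) (m X) = m (on_obj (F g) X)"
        using Z.inv_closed[OF n0] by blast
    qed
  qed
  show ?thesis
    unfolding inner_auts_def img using inner M.coboundary_1_imp_cocycle by blast
qed

lemma aut_group_quotient_iso:
  assumes gen: "genuine_action G C F c u"
  shows "(\<lambda>\<zeta>. cochain_aut G C F ` \<zeta>)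
    \<in> iso (Hgrp G C F 1) (genuine_aut_group G C F c u Mod inner_auts G C F c u)"
  unfolding cohomology_group_def inner_auts_eq[OF gen]
  by (rule iso_Mod_image[OF cochain_aut_iso[OF gen]])
    (rule comm_group.subgroup_imp_normal[OF M.cocycle_comm_group
        M.coboundaries_subgroup_cocycles[OF M.coboundary_1_imp_cocycle]])

section \<open>The class in degree 3\<close>

lemma associator_diff_coboundary:
  assumes "c \<in> K" "c' \<in> K"
  shows "\<exists>b \<in> M.\<B> 3. \<alpha> c' = b \<otimes>\<^bsub>M.\<C> 3\<^esub> \<alpha> c"
proof -
  obtain b where "b \<in> carrier (M.\<C> 2)" "twist G C F b c = c'"
    using twist_transitive[OF assms] by blast
  then show ?thesis using associator_twist[OF _ assms(1), of b] unfolding coboundaries_3 by blast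
qed

text \<open>Existence in the definite description is independence of the compositors; uniqueness
  holds because there is at least one choice of compositors.\<close>

lemma gerbal_class_eq:
  assumes c: "c \<in> K"
  shows "gerbal_class G C F = Hclass G C F 3 (\<alpha> c)"
  unfolding gerbal_class_def
proof (rule the_equality)
  show "\<forall>c' \<in> K. Hclass G C F 3 (\<alpha> c) = Hclass G C F 3 (\<alpha> c')"
  proof
    fix c' assume "c' \<in> K"
    then obtain b where "b \<in> M.\<B> 3" "\<alpha> c' = b \<otimes>\<^bsub>M.\<C> 3\<^esub> \<alpha> c"
      using associator_diff_coboundary[OF c] by blast
    then show "Hclass G C F 3 (\<alpha> c) = Hclass G C F 3 (\<alpha> c')"
      using M.cohomology_class_coboundary_mult[OF _ associator_cochain[OF c]] by simp
  qed
qed (use c in blast)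

text \<open>The elements of the quotient are the cosets of cocycles, so membership is the cocycle
  property of an associator.\<close>

lemma gerbal_class_closed: "gerbal_class G C F \<in> carrier (Hgrp G C F 3)"
proof -
  obtain c where c: "c \<in> K" using compositors_exist by blast
  show ?thesis
    unfolding gerbal_class_eq[OF c] cohomology_group_def cohomology_class_def carrier_FactGroup
    by (rule imageI) (rule associator_cocycle[OF c])
qed

lemma trivial_class_imp_coherent:
  assumes "gerbal_class G C F = \<one>\<^bsub>Hgrp G C F 3\<^esub>"
  shows "\<exists>c \<in> K. coherent G C F c"
proof -
  obtain c where c: "c \<in> K" using compositors_exist by blast
  have "Hclass G C F 3 (\<alpha> c) = M.\<B> 3"
    using assms gerbal_class_eq[OF c] by (simp add: cohomology_group_def)
  then have "\<alpha> c \<in> M.\<B> 3" using c by (simp add: M.cohomology_class_eq_one_iff)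
  then obtain b where b: "b \<in> carrier (M.\<C> 2)" "\<alpha> c = M.\<d> 2 b" unfolding coboundaries_3 by blast
  \<comment> \<open>If the associator is the differential of \<open>b\<close>, twisting by the
    inverse of \<open>b\<close> cancels it, since the differential is a homomorphism.\<close>
  let ?b = "inv\<^bsub>M.\<C> 2\<^esub> b"
  have "\<alpha> (twist G C F ?b c) = M.\<d> 2 ?b \<otimes>\<^bsub>M.\<C> 3\<^esub> M.\<d> 2 b"
    using associator_twist[OF M.C.inv_closed[OF b(1)] c] b(2) by simp
  also have "\<dots> = M.\<d> 2 (?b \<otimes>\<^bsub>M.\<C> 2\<^esub> b)"
    using M.differential_mult[OF M.C.inv_closed[OF b(1)] b(1)] by (simp add: numeral_3_eq_3 numeral_2_eq_2)
  also have "\<dots> = \<one>\<^bsub>M.\<C> 3\<^esub>"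
    unfolding M.C.l_inv[OF b(1)] using group_hom.hom_one[OF M.differential_group_hom[of 2]]
    by (simp add: numeral_3_eq_3 numeral_2_eq_2)
  finally have "coherent G C F (twist G C F ?b c)"
    using b(1) c by (simp add: coherent_iff_associator)
  then show ?thesis using b(1) c by (intro bexI[where x = "twist G C F ?b c"]) simp_all
qed

text \<open>Transporting the compositors along \<open>F g \<cong> F' g\<close> leaves the associator unchanged.\<close>

lemma gerbal_class_same_gerbal:
  assumes F': "gerbal_action G C F'" and same: "same_gerbal G C F F'"
  shows "gerbal_class G C F' = gerbal_class G C F"
proof -
  interpret F': gerbal C G F' by unfold_locales (rule F')
  obtain \<phi> where \<phi>: "\<And>g. g \<in> carrier G \<Longrightarrow> \<phi> g \<in> nat_isos C (F g) (F' g)"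
    using bchoice[of "carrier G" "\<lambda>g \<eta>. \<eta> \<in> nat_isos C (F g) (F' g)"] same
    unfolding same_gerbal_def nat_isomorphic_def by blast
  obtain c where c: "c \<in> K" using compositors_exist by blast
  note [simp] = nat_simps[OF \<phi>] c
  define p where "p g h = (\<lambda>X \<in> Obj C. \<phi> g (on_obj (F' h) X) \<cdot> on_arr (F g) (\<phi> h X))" for g h
  have p: "p g h \<in> nat_isos C (F g \<circ>\<^sub>F F h) (F' g \<circ>\<^sub>F F' h)"
    if "g \<in> carrier G" "h \<in> carrier G" for g h
    unfolding p_def using that by (intro nat_isos_hcomp \<phi>) simp_all
  define q where "q g h = (\<lambda>X \<in> Obj C. \<phi> (g \<otimes>\<^bsub>G\<^esub> h) X \<cdot> c (g, h) X)" for g h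
  have q: "q g h \<in> nat_isos C (F g \<circ>\<^sub>F F h) (F' (g \<otimes>\<^bsub>G\<^esub> h))"
    if "g \<in> carrier G" "h \<in> carrier G" for g h
    unfolding q_def using that by (intro nat_isos_comp[OF _ _ _ compositor_nat] \<phi>) simp_all
  \<comment> \<open>\<open>c'\<close> is forced: \<open>p\<close> is the horizontal composite of the
    chosen isomorphisms, and \<open>c'\<close> must complete the square in which \<open>q\<close> is
    the diagonal.\<close>
  define c' where "c' = (\<lambda>(g, h) \<in> carrier G \<times> carrier G.
    \<lambda>X \<in> Obj C. q g h X \<cdot> (\<lambda>X \<in> Obj C. inv_arr (p g h X)) X)"
  have c' [simp]: "c' \<in> compositors G C F'"
    unfolding c'_def
  proof (rule F'.compositorsI)
    fix g h assume g: "g \<in> carrier G" "h \<in> carrier G"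
    show "(\<lambda>X \<in> Obj C. q g h X \<cdot> (\<lambda>X \<in> Obj C. inv_arr (p g h X)) X)
        \<in> nat_isos C (F' g \<circ>\<^sub>F F' h) (F' (g \<otimes>\<^bsub>G\<^esub> h))"
      by (rule nat_isos_comp[OF _ _ _ nat_isos_inv[OF _ _ p] q]) (use g in simp_all)
  qed
  have c'_p: "c' (g, h) X \<cdot> (\<phi> g (on_obj (F' h) X) \<cdot> on_arr (F g) (\<phi> h X)) = \<phi> (g \<otimes>\<^bsub>G\<^esub> h) X \<cdot> c (g, h) X"
    if g: "g \<in> carrier G" "h \<in> carrier G" and X: "X \<in> Obj C" for g h X
  proof -
    note [simp] = nat_simps[OF p[OF g]] nat_simps[OF q[OF g]] g X
    have "c' (g, h) X \<cdot> p g h X = q g h X"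
      by (simp add: c'_def comp_assoc)
    then show ?thesis by (simp add: p_def q_def)
  qed
  have act: "center_action C F' g a = center_action C F g a" if "g \<in> carrier G" "a \<in> carrier Z" for g a
    unfolding center_action_eq F'.center_action_eq
    by (rule center_endo_transport[OF _ _ \<phi>]) (use that in \<open>simp_all add: center_endo_apply\<close>)
  have assoc: "\<alpha> c [g1, g2, g3] = F'.\<alpha> c' [g1, g2, g3]"
    if g: "g1 \<in> carrier G" "g2 \<in> carrier G" "g3 \<in> carrier G" for g1 g2 g3
  proof (rule F'.associator_unique[OF c' g, symmetric])
    note [simp] = g
    show "\<alpha> c [g1, g2, g3] \<in> carrier Z" by simp
    fix X assume X [simp]: "X \<in> Obj C"
    let ?X2 = "on_obj (F' g2) (on_obj (F' g3) X)" and ?X3 = "on_obj (F' g3) X"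
    \<comment> \<open>The threefold horizontal composite of the \<open>\<phi>\<close>. Each path for
      \<open>c'\<close> precomposed with \<open>?p\<close> will equal the corresponding path for
      \<open>c\<close> followed by \<open>?\<psi>\<close>, so the same central element relates both
      pairs of paths.\<close>
    let ?p = "\<phi> g1 ?X2 \<cdot> (on_arr (F g1) (\<phi> g2 ?X3) \<cdot> on_arr (F g1) (on_arr (F g2) (\<phi> g3 X)))"
    let ?\<psi> = "\<phi> (g1 \<otimes>\<^bsub>G\<^esub> (g2 \<otimes>\<^bsub>G\<^esub> g3)) X"
    have X3 [simp]: "?X3 \<in> Obj C" by simp
    have "F'.left c' g1 g2 g3 X \<cdot> ?p
        = c' (g1 \<otimes>\<^bsub>G\<^esub> g2, g3) X \<cdot> ((c' (g1, g2) ?X3 \<cdot> (\<phi> g1 ?X2 \<cdot> on_arr (F g1) (\<phi> g2 ?X3)))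
            \<cdot> on_arr (F g1) (on_arr (F g2) (\<phi> g3 X)))"
      by (simp add: left_path_def comp_assoc)
    also have "\<dots> = c' (g1 \<otimes>\<^bsub>G\<^esub> g2, g3) X \<cdot> (\<phi> (g1 \<otimes>\<^bsub>G\<^esub> g2) ?X3 \<cdot>
        (c (g1, g2) ?X3 \<cdot> on_arr (F g1) (on_arr (F g2) (\<phi> g3 X))))"
      unfolding c'_p[OF g(1,2) X3] by (simp add: comp_assoc)
    also have "c (g1, g2) ?X3 \<cdot> on_arr (F g1) (on_arr (F g2) (\<phi> g3 X))
        = on_arr (F (g1 \<otimes>\<^bsub>G\<^esub> g2)) (\<phi> g3 X) \<cdot> c (g1, g2) (on_obj (F g3) X)"
      using compositor_natural[OF c g(1,2), of "\<phi> g3 X"] by simp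
    also have "c' (g1 \<otimes>\<^bsub>G\<^esub> g2, g3) X \<cdot> (\<phi> (g1 \<otimes>\<^bsub>G\<^esub> g2) ?X3 \<cdot> (on_arr (F (g1 \<otimes>\<^bsub>G\<^esub> g2)) (\<phi> g3 X) \<cdot> c (g1, g2) (on_obj (F g3) X)))
        = (c' (g1 \<otimes>\<^bsub>G\<^esub> g2, g3) X \<cdot> (\<phi> (g1 \<otimes>\<^bsub>G\<^esub> g2) ?X3 \<cdot> on_arr (F (g1 \<otimes>\<^bsub>G\<^esub> g2)) (\<phi> g3 X))) \<cdot> c (g1, g2) (on_obj (F g3) X)"
      by (simp add: comp_assoc)
    also have "\<dots> = ?\<psi> \<cdot> left c g1 g2 g3 X"
      unfolding c'_p[OF G.m_closed[OF g(1,2)] g(3) X] by (simp add: left_path_def comp_assoc G.m_assoc)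
    finally have left: "F'.left c' g1 g2 g3 X \<cdot> ?p = ?\<psi> \<cdot> left c g1 g2 g3 X" .
    have "F'.right c' g1 g2 g3 X \<cdot> ?p
        = c' (g1, g2 \<otimes>\<^bsub>G\<^esub> g3) X \<cdot> ((on_arr (F' g1) (c' (g2, g3) X) \<cdot> \<phi> g1 ?X2)
            \<cdot> on_arr (F g1) (\<phi> g2 ?X3 \<cdot> on_arr (F g2) (\<phi> g3 X)))"
      by (simp add: right_path_def comp_assoc)
    \<comment> \<open>Naturality of \<open>\<phi> g1\<close> at \<open>c' (g2, g3) X\<close>
      exchanges \<open>F' g1\<close> for \<open>F g1\<close>, after which the defining square of
      \<open>c'\<close> can be applied inside \<open>F g1\<close>.\<close>
    also have "on_arr (F' g1) (c' (g2, g3) X) \<cdot> \<phi> g1 ?X2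
        = \<phi> g1 (on_obj (F' (g2 \<otimes>\<^bsub>G\<^esub> g3)) X) \<cdot> on_arr (F g1) (c' (g2, g3) X)"
      using naturality[OF \<phi>[OF g(1)], of "c' (g2, g3) X"] by simp
    also have "c' (g1, g2 \<otimes>\<^bsub>G\<^esub> g3) X \<cdot> ((\<phi> g1 (on_obj (F' (g2 \<otimes>\<^bsub>G\<^esub> g3)) X) \<cdot> on_arr (F g1) (c' (g2, g3) X))
            \<cdot> on_arr (F g1) (\<phi> g2 ?X3 \<cdot> on_arr (F g2) (\<phi> g3 X)))
        = c' (g1, g2 \<otimes>\<^bsub>G\<^esub> g3) X \<cdot> (\<phi> g1 (on_obj (F' (g2 \<otimes>\<^bsub>G\<^esub> g3)) X) \<cdot>
            on_arr (F g1) (c' (g2, g3) X \<cdot> (\<phi> g2 ?X3 \<cdot> on_arr (F g2) (\<phi> g3 X))))"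
      by (simp add: comp_assoc)
    also have "\<dots> = (c' (g1, g2 \<otimes>\<^bsub>G\<^esub> g3) X \<cdot> (\<phi> g1 (on_obj (F' (g2 \<otimes>\<^bsub>G\<^esub> g3)) X) \<cdot> on_arr (F g1) (\<phi> (g2 \<otimes>\<^bsub>G\<^esub> g3) X)))
        \<cdot> on_arr (F g1) (c (g2, g3) X)"
      unfolding c'_p[OF g(2,3) X] by (simp add: comp_assoc)
    also have "\<dots> = ?\<psi> \<cdot> right c g1 g2 g3 X"
      unfolding c'_p[OF g(1) G.m_closed[OF g(2,3)] X] by (simp add: right_path_def comp_assoc)
    finally have right: "F'.right c' g1 g2 g3 X \<cdot> ?p = ?\<psi> \<cdot> right c g1 g2 g3 X" .
    show "\<alpha> c [g1, g2, g3] \<star> F'.left c' g1 g2 g3 X = F'.right c' g1 g2 g3 X"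
    proof (rule iso_cancel_right[of ?p])
      have "(\<alpha> c [g1, g2, g3] \<star> F'.left c' g1 g2 g3 X) \<cdot> ?p = \<alpha> c [g1, g2, g3] \<star> (F'.left c' g1 g2 g3 X \<cdot> ?p)"
        by simp
      also have "\<dots> = ?\<psi> \<cdot> (\<alpha> c [g1, g2, g3] \<star> left c g1 g2 g3 X)"
        unfolding left by simp
      also have "\<dots> = F'.right c' g1 g2 g3 X \<cdot> ?p"
        unfolding right associator_act[OF c g X] ..
      finally show "(\<alpha> c [g1, g2, g3] \<star> F'.left c' g1 g2 g3 X) \<cdot> ?p = F'.right c' g1 g2 g3 X \<cdot> ?p" .
    qed simp_all
  qed
  then have "\<forall>xs \<in> tuples G 3. \<alpha> c xs = F'.\<alpha> c' xs" unfolding M.ball_tuples_3 by blast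
  then have "\<alpha> c = F'.\<alpha> c'"
    by (intro M.cochain_ext[OF associator_cochain[OF c] F'.associator_cochain[OF c']]) blast
  \<comment> \<open>The coboundaries are formed with the two actions on the centre, which agree
    there by transport along \<open>\<phi> g\<close>.\<close>
  moreover have "M.\<B> 3 = F'.M.\<B> 3"
    by (rule coboundaries_cong[OF G.is_group]) (simp add: act)
  ultimately show ?thesis
    unfolding gerbal_class_eq[OF c] F'.gerbal_class_eq[OF c'] M.cohomology_class_eq F'.M.cohomology_class_eq
    by simp
qed

end

theorem theorem2p10:
  fixes G :: "('g, 'b) monoid_scheme"
    and C :: "('o, 'm) cat"
    and F :: "'g \<Rightarrow> ('o, 'm) endo"
    and c :: "'g \<times> 'g \<Rightarrow> 'o \<Rightarrow> 'm"
  assumes "group G" and "category C" and "gerbal_action G C F" and "c \<in> compositors G C F"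
  shows
    "(\<comment> \<open>(i)\<close>
     associator G C F c \<in> carrier (Zgrp G C F 3) \<and>
     (\<forall>g1 \<in> carrier G. \<forall>g2 \<in> carrier G. \<forall>g3 \<in> carrier G. \<forall>g4 \<in> carrier G.
        center_action C F g1 (associator G C F c [g2, g3, g4])
          \<otimes>\<^bsub>center_units C\<^esub> associator G C F c [g1, g2 \<otimes>\<^bsub>G\<^esub> g3, g4]
          \<otimes>\<^bsub>center_units C\<^esub> associator G C F c [g1, g2, g3]
        = associator G C F c [g1 \<otimes>\<^bsub>G\<^esub> g2, g3, g4]
          \<otimes>\<^bsub>center_units C\<^esub> associator G C F c [g1, g2, g3 \<otimes>\<^bsub>G\<^esub> g4])) \<and>
     (\<comment> \<open>(ii)\<close>
     (\<forall>c' \<in> compositors G C F.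
           \<exists>b \<in> coboundaries G (center_units C) (center_action C F) 3.
             associator G C F c' = b \<otimes>\<^bsub>cochain_group G (center_units C) 3\<^esub> associator G C F c) \<and>
         gerbal_class G C F \<in> carrier (Hgrp G C F 3) \<and>
         (\<forall>c' \<in> compositors G C F. Hclass G C F 3 (associator G C F c') = gerbal_class G C F) \<and>
         (\<forall>F'. gerbal_action G C F' \<and> same_gerbal G C F F' \<longrightarrow>
            gerbal_class G C F' = gerbal_class G C F)) \<and>
     (\<comment> \<open>(iii)\<close>
     gerbal_class G C F = \<one>\<^bsub>Hgrp G C F 3\<^esub> \<longrightarrow>
           (\<exists>c' \<in> compositors G C F. coherent G C F c' \<and> (\<exists>u. genuine_action G C F c' u)) \<and>
           (\<forall>c' \<in> compositors G C F. coherent G C F c' \<longleftrightarrow> (\<exists>u. genuine_action G C F c' u)) \<and>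
           torsor (Hgrp G C F 2) (structure_classes G C F) (class_twist G C F) \<and>
           (\<forall>c' u. genuine_action G C F c' u \<longrightarrow>
              cochain_aut G C F \<in> iso (Zgrp G C F 1) (genuine_aut_group G C F c' u) \<and>
              (\<lambda>\<zeta>. cochain_aut G C F ` \<zeta>)
                \<in> iso (Hgrp G C F 1)
                      (genuine_aut_group G C F c' u Mod inner_auts G C F c' u)))"
proof -
  interpret gerbal C G F
    using assms(1-3) by (intro gerbal.intro gerbal_axioms.intro)
  have cocycle: "associator G C F c \<in> carrier (Zgrp G C F 3)"
    by (rule associator_cocycle[OF assms(4)])
  have class_eq: "Hclass G C F 3 (associator G C F c') = gerbal_class G C F"
    if "c' \<in> compositors G C F" for c'
    by (rule gerbal_class_eq[OF that, symmetric])
  have coherent_iff: "coherent G C F c' \<longleftrightarrow> (\<exists>u. genuine_action G C F c' u)"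
    if "c' \<in> compositors G C F" for c'
    using coherent_imp_genuine[OF that] genuine_actionD(2) by blast
  have exists: "\<exists>c' \<in> compositors G C F. coherent G C F c' \<and> (\<exists>u. genuine_action G C F c' u)"
    if "gerbal_class G C F = \<one>\<^bsub>Hgrp G C F 3\<^esub>"
    using trivial_class_imp_coherent[OF that] coherent_imp_genuine by blast
  have torsor: "torsor (Hgrp G C F 2) (structure_classes G C F) (class_twist G C F)"
    if "gerbal_class G C F = \<one>\<^bsub>Hgrp G C F 3\<^esub>"
    by (rule structure_torsor) (use trivial_class_imp_coherent[OF that] genuine_structures_eq in blast)
  show ?thesis
    by (intro conjI impI allI ballI; (elim conjE)?;
        rule cocycle associator_pentagon[OF assms(4)] associator_diff_coboundary[OF assms(4)]
          gerbal_class_closed class_eq gerbal_class_same_gerbal exists coherent_iff torsor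
          cochain_aut_iso aut_group_quotient_iso; assumption)
qed

end
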